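(* Let $D,E_1,\dots,E_m,F_1,\dots,F_n$ be homogeneous Hochschild cochains in $C^{\bullet,\bullet}(Z;A,A)$. Then the following two cyclic brace relations hold. (i) \[ \begin{aligned} &D\{E_1,\dots,E_m\}\{F_1,\dots,F_n,\Delta\}\\ &=\sum_{s=0}^{m}\ \sum_{0\le i_1\le j_1\le\cdots\le i_s\le j_s\le n}(-1)^{t}\,D\big\{F_1,\dots,F_{i_1},E_1\{F_{i_1+1},\dots,F_{j_1}\},F_{j_1+1},\dots,F_{i_2},E_2\{F_{i_2+1},\dots,F_{j_2}\},\dots,\\ &\qquad\qquad F_{i_s},E_s\{F_{i_s+1},\dots,F_{j_s}\},F_{j_s+1},\dots,F_n,\Delta,E_{s+1},\dots,E_m\big\}\\ &+\sum_{s=1}^{m}\ \sum_{0\le i_1\le j_1\le\cdots\le i_{s-1}\le j_{s-1}\le i_s\le n}(-1)^{t}\,D\big\{F_1,\dots,F_{i_1},E_1\{F_{i_1+1},\dots,F_{j_1}\},F_{j_1+1},\dots,F_{i_2},E_2\{F_{i_2+1},\dots,F_{j_2}\},\dots,\\ &\qquad\qquad F_{i_s},E_s\{F_{i_s+1},\dots,F_n,\lozenge\},E_{s+1},\dots,E_m\big\}, \end{aligned} \] where $t=\sum_{k=1}^s|E_k|\sum_{a=1}^{i_k}|F_a|+\sum_{k=s+1}^m|E_k|\sum_{a=1}^n|F_a|$. (ii) \[ \begin{aligned} &D\{E_1,\dots,E_m,\Delta\}\{F_1,\dots,F_n\}\\ &=\sum_{r=0}^n\ \sum_{r\le i_1\le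 j_1\le\cdots\le i_m\le j_m\le n}(-1)^{\tau}\,D\big\{F_{r+1},\dots,F_{i_1},E_1\{F_{i_1+1},\dots,F_{j_1}\},F_{j_1+1},\dots,F_{i_2},E_2\{F_{i_2+1},\dots,F_{j_2}\},\dots,\\ &\qquad\qquad F_{i_m},E_m\{F_{i_m+1},\dots,F_{j_m}\},F_{j_m+1},\dots,F_n,\Delta,F_1,\dots,F_r\big\}, \end{aligned} \] where $\tau=\sum_{k=1}^m|E_k|\sum_{a=r+1}^{i_k}|F_a|+\sum_{p=1}^r\sum_{q=r+1}^n|F_p||F_q|$.
   Context: Let $\Bbbk$ be the ground field, $Z,A$ graded vector spaces, $|\cdot|$ the degree, $[k]=\{1,\dots,k\}$. Fix an element $\mathbf 1\in A$ with $|\mathbf 1|=-1$ (no unit property assumed) and a constant symplectic structure: a non-degenerate bilinear $\omega:A\otimes A\to\Bbbk$ with $\omega(a_1,a_2)=(-1)^{|a_1||a_2|+1}\omega(a_2,a_1)$ and an integer $|\omega|$ such that $\omega(a_1,a_2)=0$ unless $|a_1|+|a_2|+|\omega|=0$. $Z^{\wedge\ell}$ is the graded symmetric tensor power; for an ordered subset $J=\{j_1<\dots<j_n\}$, $z_J=z_{j_1}\wedge\cdots\wedge z_{j_n}$, $a_J=a_{j_1}\otimes\cdots\otimes a_{j_n}$, with total degrees $|z_J|,|a_J|$; $a_{[p,q]}=a_p\otimes\cdots\otimes a_q$. Cochains: $C^{\bullet,\bullet}(Z;A,A)=\prod_{\ell,k\ge0,(\ell,k)\ne(0,0)}\mathrm{Hom}(Z^{\wedge\ell}\otimes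 A^{\otimes k},A)$. (The case $Z=0$ is the ordinary space $\prod_{k\ge1}\mathrm{Hom}(A^{\otimes k},A)$.) Brace operation: $D\{E_1,\dots,E_m\}(z_{[\ell]};a_{[k]})=\sum(-1)^{*}D(z_J;a_{I_0},E_1(z_{L_1};a_{K_1}),a_{I_1},\dots,E_m(z_{L_m};a_{K_m}),a_{I_m})$, summed over partitions $[\ell]=J\sqcup L_1\sqcup\cdots\sqcup L_m$ and decompositions of $(1,\dots,k)$ into successive, possibly empty, intervals $I_0,K_1,I_1,\dots,K_m,I_m$, with $*=\sum_{j=1}^m\big(\sum_{i=0}^{j-1}|a_{I_i}|+\sum_{i=1}^{j-1}|a_{K_i}|\big)(|E_j|+|z_{L_j}|)+\sum_{j=1}^m\big(|z_J|+\sum_{i=1}^{j-1}|z_{L_i}|\big)|E_j|+\epsilon$, $z_{[\ell]}=(-1)^\epsilon z_J\wedge z_{L_1}\wedge\cdots\wedge z_{L_m}$. For $m=0$, $D\{\}=D$. First-order cyclic brace: $D\{E_1,\dots,E_s,\Delta,E_{s+1},\dots,E_m\}\in C^{\bullet,\bullet}(Z;A,A)$ is determined via non-degeneracy of $\omega$ by: $\omega(D\{E_1,\dots,E_s,\Delta,E_{s+1},\dots,E_m\}(z_{[\ell]};a_1,\dots,a_k),a_0)$ equals the sum over $0\le r\le k$ of $(-1)^{|a_{[1,r]}|(|a_{[r+1,k]}|+|a_0|)}$ times $\omega(\,\cdot\,,\mathbf 1)$ of the sum of those terms, with their signs, in the expansion of the brace $D\{E_1,\dots,E_m\}(z_{[\ell]};a_{r+1},\dots,a_k,a_0,a_1,\dots,a_r)$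 as the signed sum $\sum(-1)^{*}D(z_J;b_{I_0},E_1(z_{L_1};b_{K_1}),b_{I_1},\dots,E_m(z_{L_m};b_{K_m}),b_{I_m})$ given by the brace operation formula applied to the input sequence $(b_1,\dots,b_{k+1})=(a_{r+1},\dots,a_k,a_0,a_1,\dots,a_r)$, in which $a_0$ is a direct input of $D$ lying after $E_s$ and before $E_{s+1}$ (for $s=0$: before $E_1$; for $s=m$: after $E_m$). For $m=0$ one writes $\Delta D=D\{\Delta\}$. Here the $E_i$ may themselves be cochains such as $E\{F,\dots\}$. Second-order cyclic brace: $D\{E_1,\dots,E_i\{F_1,\dots,F_j,\lozenge,F_{j+1},\dots,F_n\},\dots,E_m\}\in C^{\bullet,\bullet}(Z;A,A)$ is the element $G$ such that $\omega(G(z_{[\ell]};a_1,\dots,a_k),a_0)$ equals the sum over $0\le r\le k$ of $(-1)^{|a_{[1,r]}|(|a_{[r+1,k]}|+|a_0|)}$ times $\omega(\,\cdot\,,\mathbf 1)$ of the sum of those terms, with their (Koszul) signs, in the full expansion of the iterated usual brace $D\{E_1,\dots,E_i\{F_1,\dots,F_n\},\dots,E_m\}(z_{[\ell]};a_{r+1},\dots,a_k,a_0,a_1,\dots,a_r)$ in which $a_0$ is a direct input of $E_i$ lying after $F_j$ and before $F_{j+1}$. The number $n$ of $F$'s may be $0$. Iterated expressions such as $X\{F_1,\dots,F_n\}$ or $X\{F_1,\dots,F_n,\Delta\}$ with $X=D\{E_1,\dots,E_m\}$ or $D\{E_1,\dots,E_m,\Delta\}$ mean: first form the cochain $X$, then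 apply the (cyclic) brace. Empty lists of $F$'s are allowed. *)

theory Defs
  imports Complex_Main
begin

definition signed_by :: "int \<Rightarrow> 'v::ab_group_add \<Rightarrow> 'v" where
  "signed_by n x = (if even n then x else - x)"

definition is_decomposition :: "(int \<Rightarrow> 'v::ab_group_add set) \<Rightarrow> 'v \<Rightarrow> (int \<Rightarrow> 'v) \<Rightarrow> bool" where
  "is_decomposition gr v f \<longleftrightarrow>
     (\<forall>d. f d \<in> gr d) \<and> finite {d. f d \<noteq> 0} \<and> v = (\<Sum>d | f d \<noteq> 0. f d)"

locale graded_vector_space = vector_space scale
  for scale :: "'k::field \<Rightarrow> 'v::ab_group_add \<Rightarrow> 'v" +
  fixes gr :: "int \<Rightarrow> 'v set"
  assumes subspace_gr: "subspace (gr d)"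
    and direct_sum: "\<exists>!f. is_decomposition gr v f"

definition component :: "(int \<Rightarrow> 'v::ab_group_add set) \<Rightarrow> 'v \<Rightarrow> int \<Rightarrow> 'v" where
  "component gr v = (THE f. is_decomposition gr v f)"

text \<open>Homogeneous elements whose degree enters a sign are carried around as pairs of the degree
  and the element.\<close>

definition hcomps :: "(int \<Rightarrow> 'v::ab_group_add set) \<Rightarrow> 'v \<Rightarrow> (int \<times> 'v) set" where
  "hcomps gr v = {(d, x). x = component gr v d \<and> x \<noteq> 0}"

text \<open>All ways of choosing one nonzero homogeneous component of every entry of a list. A formula
  \<open>f\<close> given on homogeneous elements extends multilinearly to arbitrary inputs as the sum of
  \<open>f hs\<close> over \<open>hs \<in> hlists gr vs\<close>.\<close>

definition hlists :: "(int \<Rightarrow> 'v::ab_group_add set) \<Rightarrow> 'v list \<Rightarrow> (int \<times> 'v) list set" where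
  "hlists gr vs = listset (map (hcomps gr) vs)"

definition tdeg :: "(int \<times> 'v) list \<Rightarrow> int" where
  "tdeg xs = sum_list (map fst xs)"

record ('k, 'z, 'a) cyclic_data =
  zscale :: "'k \<Rightarrow> 'z \<Rightarrow> 'z"
  zgr :: "int \<Rightarrow> 'z set"
  ascale :: "'k \<Rightarrow> 'a \<Rightarrow> 'a"
  agr :: "int \<Rightarrow> 'a set"
  pairing :: "'a \<Rightarrow> 'a \<Rightarrow> 'k"
  pairing_deg :: int
  marked_elt :: 'a

text \<open>Non-degeneracy is that \<open>a \<mapsto> \<omega>(a, _)\<close> is a bijection from \<open>A\<close> onto its graded dual, the space
  spanned by the linear forms supported in a single degree. This is what makes the implicit
  definition of the cyclic braces below meaningful.\<close>

locale symplectic_data =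
  fixes S :: "('k::field, 'z::ab_group_add, 'a::ab_group_add) cyclic_data"
  assumes graded_Z: "graded_vector_space (zscale S) (zgr S)"
    and graded_A: "graded_vector_space (ascale S) (agr S)"
    and marked_deg: "marked_elt S \<in> agr S (- 1)"
    and linear_left: "Vector_Spaces.linear (ascale S) (*) (\<lambda>a. pairing S a b)"
    and linear_right: "Vector_Spaces.linear (ascale S) (*) (pairing S a)"
    and antisymmetric: "a \<in> agr S p \<Longrightarrow> b \<in> agr S q \<Longrightarrow>
          pairing S a b = signed_by (p * q + 1) (pairing S b a)"
    and pairing_degree: "a \<in> agr S p \<Longrightarrow> b \<in> agr S q \<Longrightarrow> p + q + pairing_deg S \<noteq> 0 \<Longrightarrow>
          pairing S a b = 0"
    and nondegenerate_inj: "(\<And>b. pairing S a b = 0) \<Longrightarrow> a = 0"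
    and nondegenerate_surj: "Vector_Spaces.linear (ascale S) (*) \<phi> \<Longrightarrow>
          (\<And>e b. e \<noteq> d \<Longrightarrow> b \<in> agr S e \<Longrightarrow> \<phi> b = 0) \<Longrightarrow> \<exists>a. \<forall>b. pairing S a b = \<phi> b"

text \<open>The component in \<open>Hom(Z\<^sup>\<and>\<^sup>l \<otimes> A\<^sup>\<otimes>\<^sup>k, A)\<close> is the restriction to lists of lengths \<open>l\<close> and \<open>k\<close>.\<close>

type_synonym ('z, 'a) cochain_map = "'z list \<Rightarrow> 'a list \<Rightarrow> 'a"

definition cochain ::
  "('k::field, 'z::ab_group_add, 'a::ab_group_add) cyclic_data \<Rightarrow> ('z, 'a) cochain_map \<Rightarrow> bool" where
  "cochain S D \<longleftrightarrow>
     D [] [] = 0 \<and>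
     (\<forall>zs as i. i < length zs \<longrightarrow>
        Vector_Spaces.linear (zscale S) (ascale S) (\<lambda>x. D (zs[i := x]) as)) \<and>
     (\<forall>zs as i. i < length as \<longrightarrow>
        Vector_Spaces.linear (ascale S) (ascale S) (\<lambda>x. D zs (as[i := x]))) \<and>
     (\<forall>zs as i p q. Suc i < length zs \<longrightarrow> zs ! i \<in> zgr S p \<longrightarrow> zs ! Suc i \<in> zgr S q \<longrightarrow>
        D (zs[i := zs ! Suc i, Suc i := zs ! i]) as = signed_by (p * q) (D zs as))"

definition homogeneous_of_degree ::
  "('k, 'z, 'a) cyclic_data \<Rightarrow> int \<Rightarrow> ('z, 'a) cochain_map \<Rightarrow> bool" where
  "homogeneous_of_degree S d D \<longleftrightarrow>
     (\<forall>zs as ps qs. list_all2 (\<lambda>z p. z \<in> zgr S p) zs ps \<longrightarrow>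
        list_all2 (\<lambda>a q. a \<in> agr S q) as qs \<longrightarrow>
        D zs as \<in> agr S (d + sum_list ps + sum_list qs))"

text \<open>A homogeneous cochain is a cochain together with its degree (the zero cochain is homogeneous
  of every degree).\<close>

type_synonym ('z, 'a) hcochain = "int \<times> ('z, 'a) cochain_map"

definition homogeneous_cochain ::
  "('k::field, 'z::ab_group_add, 'a::ab_group_add) cyclic_data \<Rightarrow> ('z, 'a) hcochain \<Rightarrow> bool" where
  "homogeneous_cochain S D \<longleftrightarrow> cochain S (snd D) \<and> homogeneous_of_degree S (fst D) (snd D)"

text \<open>Sequences of even length \<open>2m\<close> are read as
  \<open>i\<^sub>1 \<le> j\<^sub>1 \<le> \<dots> \<le> i\<^sub>m \<le> j\<^sub>m\<close>, so that \<open>i\<^sub>k = ps ! (2k-2)\<close> and \<open>j\<^sub>k = ps ! (2k-1)\<close>.\<close>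

definition weak_chains :: "nat \<Rightarrow> nat \<Rightarrow> nat \<Rightarrow> nat list set" where
  "weak_chains lo hi len = {ps. length ps = len \<and> sorted ps \<and> set ps \<subseteq> {lo..hi}}"

text \<open>\<open>slice xs i j\<close> is \<open>x\<^sub>i\<^sub>+\<^sub>1, \<dots>, x\<^sub>j\<close> in one-based numbering.\<close>

definition slice :: "'x list \<Rightarrow> nat \<Rightarrow> nat \<Rightarrow> 'x list" where
  "slice xs i j = take (j - i) (drop i xs)"

text \<open>\<open>weave lo [i\<^sub>1, j\<^sub>1, \<dots>, i\<^sub>m, j\<^sub>m] [g\<^sub>1, \<dots>, g\<^sub>m] xs\<close> is the list
  \<open>x\<^sub>l\<^sub>o\<^sub>+\<^sub>1, \<dots>, x\<^bsub>i\<^sub>1\<^esub>, g\<^sub>1(x\<^bsub>i\<^sub>1+1\<^esub>, \<dots>, x\<^bsub>j\<^sub>1\<^esub>), x\<^bsub>j\<^sub>1+1\<^esub>, \<dots>, g\<^sub>m(\<dots>), x\<^bsub>j\<^sub>m+1\<^esub>, \<dots>\<close>.\<close>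

fun weave :: "nat \<Rightarrow> nat list \<Rightarrow> ('x list \<Rightarrow> 'x) list \<Rightarrow> 'x list \<Rightarrow> 'x list" where
  "weave lo (i # j # ps) (g # gs) xs = slice xs lo i @ g (slice xs i j) # weave j ps gs xs"
| "weave lo _ _ xs = drop lo xs"

text \<open>A decomposition of \<open>(1, \<dots>, k)\<close> into intervals \<open>I\<^sub>0, K\<^sub>1, I\<^sub>1, \<dots>, K\<^sub>m, I\<^sub>m\<close> is given by a chain
  \<open>ps\<close> of length \<open>2m\<close>; \<open>K\<^sub>j\<close> and \<open>I\<^sub>j\<close> are the half-open ranges of zero-based positions
  \<open>[K_lo ps j, K_hi ps j)\<close> for \<open>1 \<le> j \<le> m\<close> and \<open>[I_lo ps j, I_hi k ps j)\<close> for \<open>0 \<le> j \<le> m\<close>.\<close>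

definition K_lo :: "nat list \<Rightarrow> nat \<Rightarrow> nat" where
  "K_lo ps j = ps ! (2 * j - 2)"

definition K_hi :: "nat list \<Rightarrow> nat \<Rightarrow> nat" where
  "K_hi ps j = ps ! (2 * j - 1)"

definition I_lo :: "nat list \<Rightarrow> nat \<Rightarrow> nat" where
  "I_lo ps j = (if j = 0 then 0 else K_hi ps j)"

definition I_hi :: "nat \<Rightarrow> nat list \<Rightarrow> nat \<Rightarrow> nat" where
  "I_hi k ps j = (if 2 * j < length ps then K_lo ps (Suc j) else k)"

text \<open>A partition \<open>[l] = J \<squnion> L\<^sub>1 \<squnion> \<dots> \<squnion> L\<^sub>m\<close> is given by the list that records, for every
  index, the number of its block, with \<open>J\<close> numbered \<open>0\<close>.\<close>

definition labellings :: "nat \<Rightarrow> nat \<Rightarrow> nat list set" where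
  "labellings m l = {c. length c = l \<and> set c \<subseteq> {0..m}}"

definition zblock :: "(int \<times> 'z) list \<Rightarrow> nat list \<Rightarrow> nat \<Rightarrow> (int \<times> 'z) list" where
  "zblock zs c j = nths zs {i. c ! i = j}"

text \<open>The exponent \<open>\<epsilon>\<close> in \<open>z\<^bsub>[l]\<^esub> = (-1)\<^sup>\<epsilon> z\<^sub>J \<and> z\<^bsub>L\<^sub>1\<^esub> \<and> \<dots> \<and> z\<^bsub>L\<^sub>m\<^esub>\<close>.\<close>

definition shuffle_exp :: "(int \<times> 'z) list \<Rightarrow> nat list \<Rightarrow> int" where
  "shuffle_exp zs c =
     (\<Sum>(i, i') | i < i' \<and> i' < length zs \<and> c ! i' < c ! i. fst (zs ! i) * fst (zs ! i'))"

definition brace_exp ::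
  "('z, 'a) hcochain list \<Rightarrow> (int \<times> 'z) list \<Rightarrow> (int \<times> 'a) list \<Rightarrow> nat list \<Rightarrow> nat list \<Rightarrow> int" where
  "brace_exp Es zs as c ps =
     (let m = length Es;
          E = (\<lambda>j. fst (Es ! (j - 1)));
          I = (\<lambda>i. tdeg (slice as (I_lo ps i) (I_hi (length as) ps i)));
          K = (\<lambda>i. tdeg (slice as (K_lo ps i) (K_hi ps i)));
          L = (\<lambda>i. tdeg (zblock zs c i));
          J = tdeg (zblock zs c 0)
      in (\<Sum>j = 1..m. ((\<Sum>i = 0..<j. I i) + (\<Sum>i = 1..<j. K i)) * (E j + L j))
         + (\<Sum>j = 1..m. (J + (\<Sum>i = 1..<j. L i)) * E j)
         + shuffle_exp zs c)"

text \<open>One signed summand of \<open>D{E\<^sub>1, \<dots>, E\<^sub>m}(zs; as)\<close>, for homogeneous \<open>zs\<close>, \<open>as\<close>.\<close>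

definition brace_term ::
  "('z, 'a::ab_group_add) hcochain \<Rightarrow> ('z, 'a) hcochain list \<Rightarrow>
   (int \<times> 'z) list \<Rightarrow> (int \<times> 'a) list \<Rightarrow> nat list \<Rightarrow> nat list \<Rightarrow> 'a" where
  "brace_term D Es zs as c ps =
     signed_by (brace_exp Es zs as c ps)
       (snd D (map snd (zblock zs c 0))
          (weave 0 ps
             (map (\<lambda>j. snd (Es ! (j - 1)) (map snd (zblock zs c j))) [1..<Suc (length Es)])
             (map snd as)))"

definition brace ::
  "('k, 'z::ab_group_add, 'a::ab_group_add) cyclic_data \<Rightarrow>
   ('z, 'a) hcochain \<Rightarrow> ('z, 'a) hcochain list \<Rightarrow> ('z, 'a) hcochain" where
  "brace S D Es =
     (fst D + tdeg Es,
      \<lambda>zs as. \<Sum>hz \<in> hlists (zgr S) zs. \<Sum>ha \<in> hlists (agr S) as.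
        \<Sum>c \<in> labellings (length Es) (length zs). \<Sum>ps \<in> weak_chains 0 (length as) (2 * length Es).
          brace_term D Es hz ha c ps)"

text \<open>The part of the expansion of \<open>D{E\<^sub>1, \<dots>, E\<^sub>m}(zs; as)\<close> in which the input at zero-based
  position \<open>p\<close> of \<open>as\<close> is a direct input of \<open>D\<close> lying after \<open>E\<^sub>s\<close> and before \<open>E\<^sub>s\<^sub>+\<^sub>1\<close>.\<close>

definition direct_part ::
  "('z, 'a::ab_group_add) hcochain \<Rightarrow> ('z, 'a) hcochain list \<Rightarrow> nat \<Rightarrow> nat \<Rightarrow>
   (int \<times> 'z) list \<Rightarrow> (int \<times> 'a) list \<Rightarrow> 'a" where
  "direct_part D Es s p zs as =
     (\<Sum>c \<in> labellings (length Es) (length zs).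
        \<Sum>ps \<in> {ps \<in> weak_chains 0 (length as) (2 * length Es).
                 I_lo ps s \<le> p \<and> p < I_hi (length as) ps s}.
          brace_term D Es zs as c ps)"

definition direct_brace ::
  "('k, 'z::ab_group_add, 'a::ab_group_add) cyclic_data \<Rightarrow>
   ('z, 'a) hcochain \<Rightarrow> ('z, 'a) hcochain list \<Rightarrow> nat \<Rightarrow> nat \<Rightarrow> ('z, 'a) hcochain" where
  "direct_brace S D Es s p =
     (fst D + tdeg Es,
      \<lambda>zs as. \<Sum>hz \<in> hlists (zgr S) zs. \<Sum>ha \<in> hlists (agr S) as. direct_part D Es s p hz ha)"

text \<open>The part of the expansion of \<open>D{E\<^sub>1, \<dots>, E\<^sub>i{F\<^sub>1, \<dots>, F\<^sub>n}, \<dots>, E\<^sub>m}(zs; as)\<close> in which the input at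
  zero-based position \<open>p\<close> of \<open>as\<close> is a direct input of \<open>E\<^sub>i\<close> lying after \<open>F\<^sub>j\<close> and before
  \<open>F\<^sub>j\<^sub>+\<^sub>1\<close>, where \<open>Es = [E\<^sub>1, \<dots>, E\<^sub>m]\<close> and \<open>1 \<le> i \<le> m\<close>. Within \<open>K\<^sub>i\<close> that input has position
  \<open>p - K_lo ps i\<close>.\<close>

definition nested_part ::
  "('k, 'z::ab_group_add, 'a::ab_group_add) cyclic_data \<Rightarrow>
   ('z, 'a) hcochain \<Rightarrow> ('z, 'a) hcochain list \<Rightarrow> nat \<Rightarrow> ('z, 'a) hcochain list \<Rightarrow> nat \<Rightarrow> nat \<Rightarrow>
   (int \<times> 'z) list \<Rightarrow> (int \<times> 'a) list \<Rightarrow> 'a" where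
  "nested_part S D Es i Fs j p zs as =
     (\<Sum>c \<in> labellings (length Es) (length zs).
        \<Sum>ps \<in> {ps \<in> weak_chains 0 (length as) (2 * length Es). K_lo ps i \<le> p \<and> p < K_hi ps i}.
          brace_term D (Es[i - 1 := direct_brace S (Es ! (i - 1)) Fs j (p - K_lo ps i)])
            zs as c ps)"

text \<open>The cochain \<open>G\<close> with
  \<open>\<omega>(G(zs; a\<^sub>1, \<dots>, a\<^sub>k), a\<^sub>0) = \<Sum>\<^sub>r \<plusminus> \<omega>(T (k - r) (zs; a\<^sub>r\<^sub>+\<^sub>1, \<dots>, a\<^sub>k, a\<^sub>0, a\<^sub>1, \<dots>, a\<^sub>r), \<one>)\<close>; the first
  argument of \<open>T\<close> is the zero-based position of \<open>a\<^sub>0\<close>. It is defined pointwise; multilinearity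
  follows from the uniqueness of \<open>g\<close>. Cochains have no component in arity \<open>(0, 0)\<close>.\<close>

definition cyclic_dual ::
  "('k::field, 'z::ab_group_add, 'a::ab_group_add) cyclic_data \<Rightarrow>
   (nat \<Rightarrow> (int \<times> 'z) list \<Rightarrow> (int \<times> 'a) list \<Rightarrow> 'a) \<Rightarrow> ('z, 'a) cochain_map" where
  "cyclic_dual S T zs as =
     (if zs = [] \<and> as = [] then 0
      else THE g. \<forall>a0. pairing S g a0 =
        (\<Sum>hz \<in> hlists (zgr S) zs. \<Sum>ha \<in> hlists (agr S) as. \<Sum>h0 \<in> hcomps (agr S) a0.
           \<Sum>r = 0..length as.
             signed_by (tdeg (take r ha) * (tdeg (drop r ha) + fst h0))
               (pairing S (T (length as - r) hz (drop r ha @ h0 # take r ha)) (marked_elt S))))"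

text \<open>\<open>D{E\<^sub>1, \<dots>, E\<^sub>s, \<Delta>, E\<^sub>s\<^sub>+\<^sub>1, \<dots>, E\<^sub>m}\<close> is \<open>cyclic_brace S D [E\<^sub>1, \<dots>, E\<^sub>s] [E\<^sub>s\<^sub>+\<^sub>1, \<dots>, E\<^sub>m]\<close>. The summand
  \<open>-1\<close> in its degree is the degree of the marked element.\<close>

definition cyclic_brace ::
  "('k::field, 'z::ab_group_add, 'a::ab_group_add) cyclic_data \<Rightarrow>
   ('z, 'a) hcochain \<Rightarrow> ('z, 'a) hcochain list \<Rightarrow> ('z, 'a) hcochain list \<Rightarrow> ('z, 'a) hcochain" where
  "cyclic_brace S D Es Es' =
     (fst D + tdeg (Es @ Es') - 1,
      cyclic_dual S (direct_part D (Es @ Es') (length Es)))"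

text \<open>\<open>D{E\<^sub>1, \<dots>, E\<^sub>i\<^sub>-\<^sub>1, E\<^sub>i{F\<^sub>1, \<dots>, F\<^sub>j, \<lozenge>, F\<^sub>j\<^sub>+\<^sub>1, \<dots>, F\<^sub>n}, E\<^sub>i\<^sub>+\<^sub>1, \<dots>, E\<^sub>m}\<close> is
  \<open>cyclic_brace2 S D [E\<^sub>1, \<dots>, E\<^sub>i\<^sub>-\<^sub>1] E\<^sub>i [F\<^sub>1, \<dots>, F\<^sub>j] [F\<^sub>j\<^sub>+\<^sub>1, \<dots>, F\<^sub>n] [E\<^sub>i\<^sub>+\<^sub>1, \<dots>, E\<^sub>m]\<close>.\<close>

definition cyclic_brace2 ::
  "('k::field, 'z::ab_group_add, 'a::ab_group_add) cyclic_data \<Rightarrow>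
   ('z, 'a) hcochain \<Rightarrow> ('z, 'a) hcochain list \<Rightarrow> ('z, 'a) hcochain \<Rightarrow>
   ('z, 'a) hcochain list \<Rightarrow> ('z, 'a) hcochain list \<Rightarrow> ('z, 'a) hcochain list \<Rightarrow>
   ('z, 'a) hcochain" where
  "cyclic_brace2 S D Es E Fs Fs' Es' =
     (fst D + tdeg (Es @ E # Es') + tdeg (Fs @ Fs') - 1,
      cyclic_dual S
        (nested_part S D (Es @ E # Es') (Suc (length Es)) (Fs @ Fs') (length Fs)))"

end

theory Submission
  imports Defs "HOL-Library.Z2" "HOL-Library.Multiset"
begin

text \<open>
  Both relations say that two ways of expanding a nested expression produce the same terms. A term
  of an expansion is a word: the inputs of \<open>D\<close> read from left to right, where an entry is either an
  original input or the output of an operation that has swallowed an interval of them. For ordinary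
  braces this is the pre-Lie type identity
  \<open>D{E}{F} = \<Sum> \<plusminus> D{F, E\<^sub>1{F}, F, \<dots>, E\<^sub>m{F}, F}\<close>: inserting first the \<open>F\<close>'s and then the \<open>E\<close>'s into a
  sequence yields the same words as first distributing the \<open>F\<close>'s among the \<open>E\<close>'s and the gaps between
  them, and then inserting the resulting compound operations
  (\<open>wsum_wsum_word\<close>). It rests on one fact, \<open>wsum_csum_word\<close>: cutting a word in two is the same as
  cutting the list of operations and the list of inputs in two and forming a word from either half.
  The cyclic refinements only add bookkeeping of the distinguished input \<open>a\<^sub>0\<close>. In the first relation,
  where all \<open>F\<close>'s precede \<open>a\<^sub>0\<close>, the input \<open>a\<^sub>0\<close> of \<open>D{E}\<close> is either a direct input of \<open>D\<close>, lying in one of the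
  gaps left by the \<open>E\<close>'s, or is swallowed by a single \<open>E\<^sub>s\<close>; these are the two sums
  (\<open>wsum_wsum_word_mark\<close>). In the second relation the rotation cuts the word of \<open>F\<close>-outputs at a place between \<open>F\<^sub>r\<close> and
  \<open>F\<^sub>r\<^sub>+\<^sub>1\<close>, which gives the sum over \<open>r\<close> (\<open>wsum_wsum_word_rotate\<close>).

  These identities are proved without signs and without linear structure, for formal sums of words.
  The signs are then supplied once and for all. Every operation, every \<open>Z\<close>-input and every \<open>A\<close>-input
  gets its own token, and \<open>kos\<close> assigns to an arrangement of tokens the parity of its weighted number
  of inversions. Exchanging two adjacent disjoint blocks changes \<open>kos\<close> by the product of their
  degrees, so every sign in the definitions is the difference of \<open>kos\<close> at the final arrangement and at
  the initial one (\<open>brace_term_kos\<close>, \<open>kos_weaving\<close>, \<open>sg_rotate\<close>). Multiplying an expansion by the sign of its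
  initial arrangement thus leaves each word with a sign that depends on nothing but the word, and
  two expansions with the same words and the same tokens agree
  (\<open>kos_part_full\<close>, \<open>kos_direct_part\<close>, \<open>kos_nested_part\<close>).

  A compound operation \<open>E{F, \<dots>}\<close> is an honest cochain in the definitions but a formal sum of outputs in
  the word identities. The two may be exchanged inside a word because the value of a word is additive
  in every entry and its sign changes consistently under permuting the tokens of one entry
  (\<open>wsum_keq\<close>). What remains is the passage between inputs and their homogeneous components, and the
  fact that the linear forms which define the cyclic braces are represented by elements of \<open>A\<close>; the
  latter uses that such a form, for homogeneous inputs, is supported in a single degree
  (\<open>pairing_cyclic_dual\<close>).
\<close>

section \<open>Formal sums of words\<close>

definition lsum :: "'i list \<Rightarrow> ('i \<Rightarrow> 'b::comm_monoid_add) \<Rightarrow> 'b" where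
  "lsum xs f = (\<Sum>x\<leftarrow>xs. f x)"

lemma lsum_simps [simp]:
  "lsum [] f = 0" "lsum (x # xs) f = f x + lsum xs f" "lsum (xs @ ys) f = lsum xs f + lsum ys f"
  "lsum xs (\<lambda>x. 0) = 0"
  by (simp_all add: lsum_def)

lemma lsum_map [simp]: "lsum (map h xs) f = lsum xs (\<lambda>x. f (h x))"
  by (simp add: lsum_def o_def)

lemma lsum_concat [simp]: "lsum (concat xss) f = lsum xss (\<lambda>xs. lsum xs f)"
  by (induction xss) auto

lemma lsum_add: "lsum xs (\<lambda>x. f x + g x) = lsum xs f + lsum xs g"
  by (simp add: lsum_def sum_list_addf)

lemma lsum_swap: "lsum xs (\<lambda>x. lsum ys (f x)) = lsum ys (\<lambda>y. lsum xs (\<lambda>x. f x y))"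
  by (induction xs) (auto simp: lsum_add)

lemma lsum_cong: "(\<And>x. x \<in> set xs \<Longrightarrow> f x = g x) \<Longrightarrow> lsum xs f = lsum xs g"
  unfolding lsum_def by (metis (no_types, lifting) map_eq_conv)

primrec cuts :: "'x list \<Rightarrow> ('x list \<times> 'x list) list" where
  "cuts [] = [([], [])]"
| "cuts (x # xs) = ([], x # xs) # map (apfst (Cons x)) (cuts xs)"

primrec unshuffles :: "'z list \<Rightarrow> ('z list \<times> 'z list) list" where
  "unshuffles [] = [([], [])]"
| "unshuffles (z # zs) =
     map (apfst (Cons z)) (unshuffles zs) @ map (apsnd (Cons z)) (unshuffles zs)"

text \<open>Deconcatenation of a list and unshuffling of a list into two complementary sublists are the
  coproducts of the tensor and the symmetric coalgebra. Sums over them are written as functionals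
  on curried functions, so that their coassociativity and their mutual commutation are equations
  that can be used for rewriting.\<close>

definition csum :: "'x list \<Rightarrow> ('x list \<Rightarrow> 'x list \<Rightarrow> 'b::comm_monoid_add) \<Rightarrow> 'b" where
  "csum xs f = lsum (cuts xs) (\<lambda>(u, v). f u v)"

definition usum :: "'z list \<Rightarrow> ('z list \<Rightarrow> 'z list \<Rightarrow> 'b::comm_monoid_add) \<Rightarrow> 'b" where
  "usum zs f = lsum (unshuffles zs) (\<lambda>(u, v). f u v)"

lemma csum_simps [simp]:
  "csum [] f = f [] []" "csum (x # xs) f = f [] (x # xs) + csum xs (\<lambda>u v. f (x # u) v)"
  by (simp_all add: csum_def split_def)

lemma usum_simps [simp]:
  "usum [] f = f [] []"
  "usum (z # zs) f = usum zs (\<lambda>L J. f (z # L) J) + usum zs (\<lambda>L J. f L (z # J))"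
  by (simp_all add: usum_def split_def)

lemma csum_add: "csum xs (\<lambda>u v. f u v + g u v) = csum xs f + csum xs g"
  by (simp add: csum_def split_def lsum_add)

lemma usum_add: "usum xs (\<lambda>u v. f u v + g u v) = usum xs f + usum xs g"
  by (simp add: usum_def split_def lsum_add)

type_synonym ('z, 'x) oper = "'z list \<Rightarrow> 'x list \<Rightarrow> 'x list"

primrec words :: "('z, 'x) oper list \<Rightarrow> 'z list \<Rightarrow> 'x list \<Rightarrow> ('z list \<times> 'x list) list" where
  "words [] zs xs = [(zs, xs)]"
| "words (g # gs) zs xs =
     [(J, u @ y # w). (L, zs') \<leftarrow> unshuffles zs, (u, r) \<leftarrow> cuts xs, (k, r') \<leftarrow> cuts r,
        y \<leftarrow> g L k, (J, w) \<leftarrow> words gs zs' r']"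

definition wsum ::
  "('z, 'x) oper list \<Rightarrow> 'z list \<Rightarrow> 'x list \<Rightarrow> ('z list \<Rightarrow> 'x list \<Rightarrow> 'b::comm_monoid_add) \<Rightarrow> 'b" where
  "wsum gs zs xs f = lsum (words gs zs xs) (\<lambda>(J, w). f J w)"

lemma wsum_simps [simp]:
  "wsum [] zs xs f = f zs xs"
  "wsum (g # gs) zs xs f =
     usum zs (\<lambda>L z. csum xs (\<lambda>u r. csum r (\<lambda>k r'. lsum (g L k) (\<lambda>y.
       wsum gs z r' (\<lambda>J w. f J (u @ y # w))))))"
  by (simp_all add: wsum_def usum_def csum_def split_def)

text \<open>All these functionals are finite sums over index sets that are independent of each other, so any two of
  them commute.\<close>

lemma wsum_lsum: "wsum gs zs xs (\<lambda>u v. lsum l (f u v)) = lsum l (\<lambda>i. wsum gs zs xs (\<lambda>u v. f u v i))"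
  unfolding wsum_def split_def by (rule lsum_swap)

lemma wsum_add: "wsum gs zs xs (\<lambda>u v. f u v + g u v) = wsum gs zs xs f + wsum gs zs xs g"
  by (simp add: wsum_def split_def lsum_add)

lemma csum_usum: "csum xs (\<lambda>u v. usum zs (f u v)) = usum zs (\<lambda>L J. csum xs (\<lambda>u v. f u v L J))"
  unfolding csum_def usum_def split_def by (rule lsum_swap)
lemma csum_csum: "csum xs (\<lambda>u v. csum zs (f u v)) = csum zs (\<lambda>L J. csum xs (\<lambda>u v. f u v L J))"
  unfolding csum_def split_def by (rule lsum_swap)
lemma wsum_csum: "wsum gs zs xs (\<lambda>J w. csum ys (f J w)) = csum ys (\<lambda>p q. wsum gs zs xs (\<lambda>J w. f J w p q))"
  unfolding wsum_def csum_def split_def by (rule lsum_swap)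
lemma wsum_usum: "wsum gs zs xs (\<lambda>J w. usum ys (f J w)) = usum ys (\<lambda>p q. wsum gs zs xs (\<lambda>J w. f J w p q))"
  unfolding wsum_def usum_def split_def by (rule lsum_swap)
lemma lsum_csum: "lsum ys (\<lambda>y. csum xs (f y)) = csum xs (\<lambda>p q. lsum ys (\<lambda>y. f y p q))"
  unfolding csum_def split_def by (rule lsum_swap)
lemma lsum_usum: "lsum ys (\<lambda>y. usum xs (f y)) = usum xs (\<lambda>p q. lsum ys (\<lambda>y. f y p q))"
  unfolding usum_def split_def by (rule lsum_swap)
lemma lsum_wsum: "lsum ys (\<lambda>y. wsum gs zs xs (f y)) = wsum gs zs xs (\<lambda>p q. lsum ys (\<lambda>y. f y p q))"
  unfolding wsum_def split_def by (rule lsum_swap)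
lemma wsum_wsum:
  "wsum gs zs xs (\<lambda>J w. wsum hs zs' ys (f J w)) = wsum hs zs' ys (\<lambda>J' w'. wsum gs zs xs (\<lambda>J w. f J w J' w'))"
  unfolding wsum_def split_def by (rule lsum_swap)

lemma csum_assoc:
  "csum xs (\<lambda>p r'. csum p (\<lambda>u k. f u k r')) = csum xs (\<lambda>u r. csum r (\<lambda>k r'. f u k r'))"
proof (induction xs arbitrary: f)
  case (Cons x xs)
  show ?case by (simp add: csum_add Cons[of "\<lambda>u. f (x # u)"] ac_simps)
qed simp

lemma csum_append_Cons:
  "csum (u @ y # w) f = csum u (\<lambda>p q. f p (q @ y # w)) + csum w (\<lambda>p q. f (u @ y # p) q)"
  by (induction u arbitrary: f) (simp_all add: ac_simps)

lemma usum_sym: "usum zs (\<lambda>L J. f J L) = usum zs f"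
proof (induction zs arbitrary: f)
  case (Cons z zs)
  show ?case
    using Cons[of "\<lambda>a b. f (z # a) b"] Cons[of "\<lambda>a b. f a (z # b)"] by (simp add: ac_simps)
qed simp

text \<open>Unshuffling is coassociative and cocommutative; both sides sum over all splittings into three
  parts.\<close>

lemma usum_comm:
  "usum zs (\<lambda>L0 z0. usum z0 (\<lambda>L z. f L0 L z)) = usum zs (\<lambda>L z0. usum z0 (\<lambda>L0 z. f L0 L z))"
proof (induction zs arbitrary: f)
  case (Cons z zs)
  show ?case
    by (simp add: usum_add ac_simps Cons[of "\<lambda>a b c. f (z # a) b c"]
        Cons[of "\<lambda>a b c. f a (z # b) c"] Cons[of "\<lambda>a b c. f a b (z # c)"])
qed simp

text \<open>A cut of a word never falls inside the interval that an output has swallowed. So it determines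
  which operations and which inputs lie on its left.\<close>

lemma wsum_csum_word:
  "wsum gs zs xs (\<lambda>J w. csum w (f J)) =
     csum gs (\<lambda>A B. csum xs (\<lambda>P Q. wsum A zs P (\<lambda>z u. wsum B z Q (\<lambda>J v. f J u v))))"
proof (induction gs arbitrary: zs xs f)
  case (Cons g gs)
  have "wsum (g # gs) zs xs (\<lambda>J w. csum w (f J)) =
      usum zs (\<lambda>L z. csum xs (\<lambda>u r. csum r (\<lambda>k r'. lsum (g L k) (\<lambda>y. wsum gs z r' (\<lambda>J w.
        csum u (\<lambda>p q. f J p (q @ y # w)))))))
    + usum zs (\<lambda>L z. csum xs (\<lambda>u r. csum r (\<lambda>k r'. lsum (g L k) (\<lambda>y. wsum gs z r' (\<lambda>J w.
        csum w (\<lambda>p q. f J (u @ y # p) q))))))" (is "_ = ?a + ?b")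
    by (simp add: csum_append_Cons wsum_add lsum_add csum_add usum_add)
  also have "?a = csum xs (\<lambda>P Q. wsum (g # gs) zs Q (\<lambda>J v. f J P v))"
  proof -
    have "?a = usum zs (\<lambda>L z. csum xs (\<lambda>u r. csum u (\<lambda>p q. csum r (\<lambda>k r'. lsum (g L k) (\<lambda>y.
        wsum gs z r' (\<lambda>J w. f J p (q @ y # w)))))))"
      by (simp only: wsum_csum lsum_csum) (subst csum_csum, rule refl)
    also have "\<dots> = usum zs (\<lambda>L z. csum xs (\<lambda>p Q. csum Q (\<lambda>q r. csum r (\<lambda>k r'. lsum (g L k) (\<lambda>y.
        wsum gs z r' (\<lambda>J w. f J p (q @ y # w)))))))"
      by (subst csum_assoc) (rule refl)
    also have "\<dots> = csum xs (\<lambda>p Q. wsum (g # gs) zs Q (\<lambda>J v. f J p v))"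
      by (simp add: csum_usum)
    finally show ?thesis .
  qed
  also have "?b = csum gs (\<lambda>A B. csum xs (\<lambda>P Q. wsum (g # A) zs P (\<lambda>z u. wsum B z Q (\<lambda>J v. f J u v))))"
  proof -
    have "?b = usum zs (\<lambda>L z. csum xs (\<lambda>u r. csum r (\<lambda>k r'. csum gs (\<lambda>A B. csum r' (\<lambda>P Q. lsum (g L k) (\<lambda>y.
        wsum A z P (\<lambda>z' p. wsum B z' Q (\<lambda>J v. f J (u @ y # p) v))))))))"
      by (simp add: Cons[of _ _ "\<lambda>J p q. f J (_ @ _ # p) q"] lsum_csum)
    also have "\<dots> = csum gs (\<lambda>A B. usum zs (\<lambda>L z. csum xs (\<lambda>u r. csum r (\<lambda>k r'. csum r' (\<lambda>P Q. lsum (g L k) (\<lambda>y.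
        wsum A z P (\<lambda>z' p. wsum B z' Q (\<lambda>J v. f J (u @ y # p) v))))))))"
      by (simp only: csum_csum[where zs = gs] csum_usum[where xs = gs, symmetric])
    also have "\<dots> = csum gs (\<lambda>A B. csum xs (\<lambda>P Q. wsum (g # A) zs P (\<lambda>z u. wsum B z Q (\<lambda>J v. f J u v))))"
      by (simp only: wsum_simps csum_usum csum_assoc[symmetric])
    finally show ?thesis .
  qed
  finally show ?case by simp
qed simp

text \<open>The \<open>Z\<close>-inputs that are left over can be split before the word is formed, since the operations
  in the word take theirs from the complement of the part that is set aside.\<close>

lemma wsum_usum_left:
  "wsum gs zs xs (\<lambda>J w. usum J (\<lambda>L J. f L J w)) = usum zs (\<lambda>L z. wsum gs z xs (\<lambda>J w. f L J w))"
proof (induction gs arbitrary: zs xs f)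
  case (Cons g gs)
  show ?case
    by (simp add: Cons[of _ _ "\<lambda>L J w. f L J (_ @ _ # w)"] lsum_usum csum_usum)
      (subst usum_comm, rule refl)
qed simp

lemma wsum_usum_right:
  "wsum gs zs xs (\<lambda>J w. usum J (\<lambda>L J. f L J w)) = usum zs (\<lambda>z J. wsum gs z xs (\<lambda>L w. f L J w))"
  using wsum_usum_left[of gs zs xs "\<lambda>J L. f L J"]
  by (simp add: usum_sym[of _ "\<lambda>L J. f L J _"] usum_sym[of _ "\<lambda>L z. wsum gs z xs (\<lambda>L' w. f L' L w)"])

lemma wsum_append_Cons:
  "wsum (A @ g # B) zs xs f =
     csum xs (\<lambda>P R. csum R (\<lambda>K Q. wsum A zs P (\<lambda>z u. usum z (\<lambda>L z. lsum (g L K) (\<lambda>y.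
       wsum B z Q (\<lambda>J v. f J (u @ y # v)))))))"
proof (induction A arbitrary: zs xs f)
  case Nil
  show ?case by (simp add: csum_usum)
next
  case (Cons h A)
  have "wsum ((h # A) @ g # B) zs xs f =
    usum zs (\<lambda>L z. csum xs (\<lambda>u r. csum r (\<lambda>k r'. csum r' (\<lambda>P R. csum R (\<lambda>K Q. lsum (h L k) (\<lambda>y'.
      wsum A z P (\<lambda>z u'. usum z (\<lambda>L z. lsum (g L K) (\<lambda>y.
        wsum B z Q (\<lambda>J v. f J (u @ y' # u' @ y # v)))))))))))"
    by (simp add: Cons lsum_csum)
  also have "\<dots> = csum xs (\<lambda>P R. csum R (\<lambda>K Q. usum zs (\<lambda>L z. csum P (\<lambda>u r. csum r (\<lambda>k r'. lsum (h L k) (\<lambda>y'.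
      wsum A z r' (\<lambda>z u'. usum z (\<lambda>L z. lsum (g L K) (\<lambda>y.
        wsum B z Q (\<lambda>J v. f J (u @ y' # u' @ y # v)))))))))))"
    by (simp only: wsum_simps csum_usum csum_assoc[symmetric])
  finally show ?case by simp
qed

text \<open>Weaving operations into a list of operations involves neither \<open>Z\<close>-inputs nor formal sums, hence
  the empty list of \<open>Z\<close>-inputs and the singleton outputs.\<close>

definition dsum :: "('x list \<Rightarrow> 'x) list \<Rightarrow> 'x list \<Rightarrow> ('x list \<Rightarrow> 'b::comm_monoid_add) \<Rightarrow> 'b" where
  "dsum gs xs f = wsum (map (\<lambda>g _ k. [g k]) gs) ([] :: unit list) xs (\<lambda>_ w. f w)"

lemma dsum_simps [simp]:
  "dsum [] xs f = f xs"
  "dsum (g # gs) xs f = csum xs (\<lambda>u r. csum r (\<lambda>k r'. dsum gs r' (\<lambda>w. f (u @ g k # w))))"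
  by (simp_all add: dsum_def)

lemma dsum_csum: "dsum gs xs (\<lambda>w. csum ys (f w)) = csum ys (\<lambda>p q. dsum gs xs (\<lambda>w. f w p q))"
  unfolding dsum_def by (rule wsum_csum)
lemma dsum_usum: "dsum gs xs (\<lambda>w. usum ys (f w)) = usum ys (\<lambda>p q. dsum gs xs (\<lambda>w. f w p q))"
  unfolding dsum_def by (rule wsum_usum)
lemma dsum_lsum: "dsum gs xs (\<lambda>w. lsum ys (f w)) = lsum ys (\<lambda>p. dsum gs xs (\<lambda>w. f w p))"
  unfolding dsum_def by (rule wsum_lsum)
lemma dsum_wsum: "dsum gs xs (\<lambda>w. wsum hs zs ys (f w)) = wsum hs zs ys (\<lambda>p q. dsum gs xs (\<lambda>w. f w p q))"
  unfolding dsum_def by (rule wsum_wsum)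

text \<open>The formal version of the brace \<open>g{gs}\<close>.\<close>

definition graft :: "('z, 'x) oper \<Rightarrow> ('z, 'x) oper list \<Rightarrow> ('z, 'x) oper" where
  "graft g gs zs xs = concat (map (\<lambda>(J, w). g J w) (words gs zs xs))"

lemma lsum_graft: "lsum (graft g gs zs xs) f = wsum gs zs xs (\<lambda>J w. lsum (g J w) f)"
  by (simp add: graft_def wsum_def split_def)

text \<open>The word form of the brace relation. The interval swallowed by \<open>E\<^sub>1\<close> cuts the word of \<open>F\<close>-outputs
  into three pieces, and by the cutting lemma it cuts the \<open>F\<close>'s and the inputs accordingly: the first group of
  \<open>F\<close>'s stays in front of \<open>E\<^sub>1\<close>, the second is grafted into it, and the third is treated
  by induction.\<close>

theorem wsum_wsum_word:
  "wsum Fs zs xs (\<lambda>J w. wsum Es J w f) = dsum (map graft Es) Fs (\<lambda>G. wsum G zs xs f)"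
proof (induction Es arbitrary: Fs zs xs f)
  case (Cons E Es)
  have "wsum Fs zs xs (\<lambda>J w. wsum (E # Es) J w f) =
    csum Fs (\<lambda>A BC. csum xs (\<lambda>P QR. wsum A zs P (\<lambda>z1 u. csum BC (\<lambda>B C. csum QR (\<lambda>Q R. wsum B z1 Q (\<lambda>z2 k.
      wsum C z2 R (\<lambda>z3 v. usum z3 (\<lambda>L J. lsum (E L k) (\<lambda>y. wsum Es J v (\<lambda>J w. f J (u @ y # w)))))))))))"
    by (simp add: wsum_csum_word flip: csum_usum)
  also have "\<dots> =
    csum Fs (\<lambda>A BC. csum xs (\<lambda>P QR. wsum A zs P (\<lambda>z1 u. csum BC (\<lambda>B C. csum QR (\<lambda>Q R. wsum B z1 Q (\<lambda>z2 k.
      usum z2 (\<lambda>L J. lsum (E L k) (\<lambda>y. dsum (map graft Es) C (\<lambda>G. wsum G J R (\<lambda>J w. f J (u @ y # w)))))))))))"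
    by (simp add: wsum_usum_left wsum_lsum Cons)
  also have "\<dots> =
    csum Fs (\<lambda>A BC. csum xs (\<lambda>P QR. wsum A zs P (\<lambda>z1 u. csum BC (\<lambda>B C. csum QR (\<lambda>Q R.
      usum z1 (\<lambda>L J. lsum (graft E B L Q) (\<lambda>y. dsum (map graft Es) C (\<lambda>G. wsum G J R (\<lambda>J w. f J (u @ y # w))))))))))"
    by (simp add: wsum_usum_right lsum_graft)
  also have "\<dots> = csum Fs (\<lambda>A BC. csum BC (\<lambda>B C. dsum (map graft Es) C (\<lambda>G.
     csum xs (\<lambda>P QR. csum QR (\<lambda>Q R. wsum A zs P (\<lambda>z1 u. usum z1 (\<lambda>L J. lsum (graft E B L Q) (\<lambda>y.
       wsum G J R (\<lambda>J w. f J (u @ y # w))))))))))"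
    by (simp only: wsum_csum wsum_usum dsum_csum dsum_wsum dsum_usum dsum_lsum)
      (simp only: csum_csum[where xs = xs])
  also have "\<dots> = dsum (map graft (E # Es)) Fs (\<lambda>G. wsum G zs xs f)"
    by (simp add: wsum_append_Cons)
  finally show ?case .
qed simp

text \<open>Following a marked input: it is either a direct entry of the word, with a certain number
  of operations in front of it, or lies in the interval swallowed by exactly one of them.\<close>

lemma wsum_split_at:
  fixes f :: "'z list \<Rightarrow> 'x list \<Rightarrow> 'b::comm_monoid_add"
  shows "wsum gs zs (P @ a # Q) f =
     (\<Sum>s = 0..length gs. wsum (take s gs) zs P (\<lambda>z u. wsum (drop s gs) z Q (\<lambda>J v. f J (u @ a # v))))
   + (\<Sum>s < length gs. csum P (\<lambda>P1 P2. csum Q (\<lambda>Q1 Q2. wsum (take s gs) zs P1 (\<lambda>z u. usum z (\<lambda>L z.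
        lsum ((gs ! s) L (P2 @ a # Q1)) (\<lambda>y. wsum (drop (Suc s) gs) z Q2 (\<lambda>J v. f J (u @ y # v))))))))"
proof (induction gs arbitrary: zs P f)
  case (Cons g gs)
  have sum_out: "usum zs (\<lambda>L z. csum P (\<lambda>u r. csum r (\<lambda>k r'. lsum (g L k) (\<lambda>y. \<Sum>s\<in>I. F L z u k r' y s)))) =
     (\<Sum>s\<in>I. usum zs (\<lambda>L z. csum P (\<lambda>u r. csum r (\<lambda>k r'. lsum (g L k) (\<lambda>y. F L z u k r' y s)))))"
    if "finite I" for I :: "nat set" and F :: "_ \<Rightarrow> _ \<Rightarrow> _ \<Rightarrow> _ \<Rightarrow> _ \<Rightarrow> _ \<Rightarrow> _ \<Rightarrow> 'b"
    using that by (induction I) (simp_all add: lsum_add csum_add usum_add, simp_all add: usum_def csum_def split_def)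
  let ?R = "\<lambda>L z u k r y. wsum gs z (r @ a # Q) (\<lambda>J w. f J (u @ y # w))"
  have "wsum (g # gs) zs (P @ a # Q) f =
      wsum (g # gs) zs Q (\<lambda>J v. f J (P @ a # v))
    + (csum P (\<lambda>P1 P2. csum Q (\<lambda>Q1 Q2. usum zs (\<lambda>L z. lsum (g L (P2 @ a # Q1)) (\<lambda>y.
        wsum gs z Q2 (\<lambda>J v. f J (P1 @ y # v))))))
    + usum zs (\<lambda>L z. csum P (\<lambda>u r. csum r (\<lambda>k r'. lsum (g L k) (\<lambda>y. ?R L z u k r' y)))))"
    by (simp add: csum_append_Cons csum_add usum_add csum_usum ac_simps)
  also have "usum zs (\<lambda>L z. csum P (\<lambda>u r. csum r (\<lambda>k r'. lsum (g L k) (\<lambda>y. ?R L z u k r' y)))) =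
      (\<Sum>s = 0..length gs. wsum (g # take s gs) zs P (\<lambda>z u. wsum (drop s gs) z Q (\<lambda>J v. f J (u @ a # v))))
    + (\<Sum>s < length gs. csum P (\<lambda>P1 P2. csum Q (\<lambda>Q1 Q2. wsum (g # take s gs) zs P1 (\<lambda>z u. usum z (\<lambda>L z.
        lsum ((gs ! s) L (P2 @ a # Q1)) (\<lambda>y. wsum (drop (Suc s) gs) z Q2 (\<lambda>J v. f J (u @ y # v))))))))"
    by (simp add: Cons lsum_add csum_add usum_add sum_out)
      (simp only: lsum_csum csum_csum[where zs = Q] csum_usum[where xs = Q, symmetric],
       simp only: csum_usum csum_assoc[symmetric])
  finally show ?case
    by (simp only: length_Cons sum.atLeast0_atMost_Suc_shift sum.lessThan_Suc_shift o_def)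
      (simp add: ac_simps)
qed simp

text \<open>Two words formed from disjoint lists of inputs draw on the same supply of \<open>Z\<close>-inputs; it does not matter
  which of them is served first, as unshuffling is cocommutative.\<close>

lemma wsum_commute:
  "wsum A zs P (\<lambda>z u. wsum B z Q (\<lambda>J v. f J u v)) = wsum B zs Q (\<lambda>z v. wsum A z P (\<lambda>J u. f J u v))"
proof (induction A arbitrary: zs P f)
  case (Cons g A)
  have "wsum (g # A) zs P (\<lambda>z u. wsum B z Q (\<lambda>J v. f J u v)) =
     usum zs (\<lambda>L z. csum P (\<lambda>u r. csum r (\<lambda>k r'. lsum (g L k) (\<lambda>y. wsum B z Q (\<lambda>z v.
       wsum A z r' (\<lambda>J w. f J (u @ y # w) v))))))"
    by (simp add: Cons[of _ _ "\<lambda>J w v. f J (_ @ _ # w) v"])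
  also have "\<dots> = wsum B zs Q (\<lambda>z v. wsum (g # A) z P (\<lambda>J u. f J u v))"
    by (simp only: wsum_simps wsum_usum_left wsum_csum wsum_lsum)
  finally show ?case .
qed simp

lemma wsum_usum_commute:
  "wsum F zs P (\<lambda>z u2. wsum A z u1 (\<lambda>z u'. usum z (\<lambda>L z. f L z u2 u'))) =
   wsum A zs u1 (\<lambda>z u'. usum z (\<lambda>L z. wsum F L P (\<lambda>L u2. f L z u2 u')))"
proof -
  have "wsum F zs P (\<lambda>z u2. wsum A z u1 (\<lambda>z u'. usum z (\<lambda>L z. f L z u2 u'))) =
      usum zs (\<lambda>L z. wsum F L P (\<lambda>L u2. wsum A z u1 (\<lambda>z u'. f L z u2 u')))"
    by (simp only: wsum_usum_left[of A]) (simp only: wsum_usum_right[of F])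
  also have "\<dots> = usum zs (\<lambda>L z. wsum A z u1 (\<lambda>z u'. wsum F L P (\<lambda>L u2. f L z u2 u')))"
    by (subst wsum_wsum) (rule refl)
  finally show ?thesis
    by (simp only: wsum_usum_left[of A])
qed

lemma csum_sum: "csum xs (\<lambda>u v. \<Sum>i\<in>I. f u v i) = (\<Sum>i\<in>I. csum xs (\<lambda>u v. f u v i))"
proof (cases "finite I")
  case True
  then show ?thesis by (induction I) (simp_all add: csum_add, simp add: csum_def split_def)
qed (simp add: csum_def split_def)

lemma wsum_sum: "wsum gs zs xs (\<lambda>u v. \<Sum>i\<in>I. f u v i) = (\<Sum>i\<in>I. wsum gs zs xs (\<lambda>u v. f u v i))"
proof (cases "finite I")
  case True
  then show ?thesis by (induction I) (simp_all add: wsum_add, simp add: wsum_def split_def)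
qed (simp add: wsum_def split_def)

text \<open>The formal content of the first relation. In the second case the \<open>F\<close>'s are cut at the left end of the
  interval that swallows the marked input: the second group of them ends up inside \<open>E\<^sub>s\<close>, in front of the
  marked input, and none can be inserted after \<open>E\<^sub>s\<close> since all of them precede the mark.\<close>

theorem wsum_wsum_word_mark:
  fixes f :: "'z list \<Rightarrow> 'x list \<Rightarrow> 'b::comm_monoid_add"
  shows "wsum Fs zs P (\<lambda>J u. wsum Es J (u @ a # Q) f) =
    (\<Sum>s = 0..length Es. dsum (map graft (take s Es)) Fs (\<lambda>G. wsum G zs P (\<lambda>z u.
       wsum (drop s Es) z Q (\<lambda>J v. f J (u @ a # v)))))
  + (\<Sum>s < length Es. csum Fs (\<lambda>F1 F2. dsum (map graft (take s Es)) F1 (\<lambda>G.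
       csum P (\<lambda>P1 P2. csum Q (\<lambda>Q1 Q2. wsum G zs P1 (\<lambda>z u. usum z (\<lambda>L z.
         wsum F2 L P2 (\<lambda>L w. lsum ((Es ! s) L (w @ a # Q1)) (\<lambda>y.
           wsum (drop (Suc s) Es) z Q2 (\<lambda>J v. f J (u @ y # v)))))))))))"
proof -
  have expand: "\<And>s. wsum Fs zs P (\<lambda>J w. csum w (\<lambda>u1 u2. csum Q (\<lambda>Q1 Q2. wsum (take s Es) J u1 (\<lambda>z u. usum z (\<lambda>L z.
        lsum ((Es ! s) L (u2 @ a # Q1)) (\<lambda>y. wsum (drop (Suc s) Es) z Q2 (\<lambda>J v. f J (u @ y # v)))))))) =
     csum Fs (\<lambda>F1 F2. csum P (\<lambda>P1 P2. csum Q (\<lambda>Q1 Q2. wsum F1 zs P1 (\<lambda>z u1. wsum F2 z P2 (\<lambda>z u2.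
       wsum (take s Es) z u1 (\<lambda>z u. usum z (\<lambda>L z.
        lsum ((Es ! s) L (u2 @ a # Q1)) (\<lambda>y. wsum (drop (Suc s) Es) z Q2 (\<lambda>J v. f J (u @ y # v))))))))))"
    by (simp only: wsum_csum_word wsum_csum)
  have collect: "\<And>s. csum Fs (\<lambda>F1 F2. csum P (\<lambda>P1 P2. csum Q (\<lambda>Q1 Q2. wsum F1 zs P1 (\<lambda>z u1. wsum F2 z P2 (\<lambda>z u2.
       wsum (take s Es) z u1 (\<lambda>z u. usum z (\<lambda>L z.
        lsum ((Es ! s) L (u2 @ a # Q1)) (\<lambda>y. wsum (drop (Suc s) Es) z Q2 (\<lambda>J v. f J (u @ y # v)))))))))) =
     csum Fs (\<lambda>F1 F2. csum P (\<lambda>P1 P2. csum Q (\<lambda>Q1 Q2. dsum (map graft (take s Es)) F1 (\<lambda>G. wsum G zs P1 (\<lambda>z u. usum z (\<lambda>L z.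
         wsum F2 L P2 (\<lambda>L w. lsum ((Es ! s) L (w @ a # Q1)) (\<lambda>y.
           wsum (drop (Suc s) Es) z Q2 (\<lambda>J v. f J (u @ y # v))))))))))"
    by (simp only: wsum_usum_commute wsum_wsum_word)
  have "wsum Fs zs P (\<lambda>J u. wsum Es J (u @ a # Q) f) =
    (\<Sum>s = 0..length Es. wsum Fs zs P (\<lambda>J u. wsum (take s Es) J u (\<lambda>z u.
       wsum (drop s Es) z Q (\<lambda>J v. f J (u @ a # v)))))
  + (\<Sum>s < length Es. wsum Fs zs P (\<lambda>J w. csum w (\<lambda>u1 u2. csum Q (\<lambda>Q1 Q2. wsum (take s Es) J u1 (\<lambda>z u. usum z (\<lambda>L z.
        lsum ((Es ! s) L (u2 @ a # Q1)) (\<lambda>y. wsum (drop (Suc s) Es) z Q2 (\<lambda>J v. f J (u @ y # v)))))))))"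
    by (simp only: wsum_split_at wsum_add wsum_sum)
  then show ?thesis
    by (simp only: expand collect wsum_wsum_word dsum_csum)
qed

text \<open>The formal content of the second relation. Rotation moves an initial part \<open>u\<close> of the word of
  \<open>F\<close>-outputs behind \<open>a\<^sub>0\<close>, where none of the \<open>E\<close>'s may be inserted.\<close>

theorem wsum_wsum_word_rotate:
  "wsum Fs zs xs (\<lambda>J w. csum w (\<lambda>u v. wsum Es J v (\<lambda>J v. f J v u))) =
   csum Fs (\<lambda>A B. csum xs (\<lambda>P Q. dsum (map graft Es) B (\<lambda>G. wsum G zs Q (\<lambda>z v. wsum A z P (\<lambda>J u. f J v u)))))"
proof -
  have "wsum Fs zs xs (\<lambda>J w. csum w (\<lambda>u v. wsum Es J v (\<lambda>J v. f J v u))) =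
    csum Fs (\<lambda>A B. csum xs (\<lambda>P Q. wsum A zs P (\<lambda>z u. dsum (map graft Es) B (\<lambda>G. wsum G z Q (\<lambda>J v. f J v u)))))"
    by (simp only: wsum_csum_word wsum_wsum_word)
  also have "\<dots> = csum Fs (\<lambda>A B. csum xs (\<lambda>P Q. dsum (map graft Es) B (\<lambda>G. wsum A zs P (\<lambda>z u. wsum G z Q (\<lambda>J v. f J v u)))))"
    by (simp only: dsum_wsum)
  also have "\<dots> = csum Fs (\<lambda>A B. csum xs (\<lambda>P Q. dsum (map graft Es) B (\<lambda>G. wsum G zs Q (\<lambda>z v. wsum A z P (\<lambda>J u. f J v u)))))"
    by (subst wsum_commute) (rule refl)
  finally show ?thesis .
qed

section \<open>Chains and labellings as sums of words\<close>

lemma weak_chains_0 [simp]: "weak_chains lo hi 0 = {[]}"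
  by (auto simp: weak_chains_def)

lemma finite_weak_chains [simp]: "finite (weak_chains lo hi k)"
proof -
  have "weak_chains lo hi k \<subseteq> {ps. set ps \<subseteq> {lo..hi} \<and> length ps = k}"
    by (auto simp: weak_chains_def)
  then show ?thesis by (rule finite_subset) (simp add: finite_lists_length_eq)
qed

lemma sum_weak_chains_Suc:
  "(\<Sum>ps\<in>weak_chains lo hi (Suc k). f ps) = (\<Sum>i = lo..hi. \<Sum>ps\<in>weak_chains i hi k. f (i # ps))"
proof -
  have "(\<Sum>i = lo..hi. \<Sum>ps\<in>weak_chains i hi k. f (i # ps)) =
      (\<Sum>(i, ps)\<in>(SIGMA i:{lo..hi}. weak_chains i hi k). f (i # ps))"
    by (simp add: sum.Sigma)
  also have "\<dots> = (\<Sum>ps\<in>weak_chains lo hi (Suc k). f ps)"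
  proof (rule sum.reindex_bij_witness[of _ "\<lambda>ps. (hd ps, tl ps)" "\<lambda>(i, ps). i # ps"])
    fix ps assume "ps \<in> weak_chains lo hi (Suc k)"
    then show "(hd ps, tl ps) \<in> (SIGMA i:{lo..hi}. weak_chains i hi k)"
      "(case (hd ps, tl ps) of (i, ps) \<Rightarrow> i # ps) = ps"
      by (cases ps; auto simp: weak_chains_def)+
  qed (force simp: weak_chains_def)+
  finally show ?thesis by simp
qed

lemma sum_weak_chains_snoc:
  "(\<Sum>ps\<in>weak_chains lo hi (Suc k). f ps) = (\<Sum>i = lo..hi. \<Sum>ps\<in>weak_chains lo i k. f (ps @ [i]))"
proof -
  have "(\<Sum>i = lo..hi. \<Sum>ps\<in>weak_chains lo i k. f (ps @ [i])) =
      (\<Sum>(i, ps)\<in>(SIGMA i:{lo..hi}. weak_chains lo i k). f (ps @ [i]))"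
    by (simp add: sum.Sigma)
  also have "\<dots> = (\<Sum>ps\<in>weak_chains lo hi (Suc k). f ps)"
  proof (rule sum.reindex_bij_witness[of _ "\<lambda>ps. (last ps, butlast ps)" "\<lambda>(i, ps). ps @ [i]"])
    fix ps assume "ps \<in> weak_chains lo hi (Suc k)"
    then show "(last ps, butlast ps) \<in> (SIGMA i:{lo..hi}. weak_chains lo i k)"
      "(case (last ps, butlast ps) of (i, ps) \<Rightarrow> ps @ [i]) = ps"
      by (cases ps rule: rev_cases; auto simp: weak_chains_def sorted_append)+
  qed (force simp: weak_chains_def sorted_append)+
  finally show ?thesis by simp
qed

lemma weak_chains_nth:
  assumes "ps \<in> weak_chains lo hi k" "i < k"
  shows "lo \<le> ps ! i \<and> ps ! i \<le> hi"
proof -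
  have "ps ! i \<in> {lo..hi}" using assms nth_mem[of i ps] unfolding weak_chains_def by blast
  then show ?thesis by simp
qed

lemma csum_eq_sum: "csum xs f = (\<Sum>i = 0..length xs. f (take i xs) (drop i xs))"
proof (induction xs arbitrary: f)
  case (Cons x xs)
  then show ?case
    by (simp only: length_Cons sum.atLeast0_atMost_Suc_shift o_def) simp
qed simp

lemma csum_slice:
  assumes "lo \<le> p" "p \<le> length xs"
  shows "csum (slice xs lo p) f = (\<Sum>i = lo..p. f (slice xs lo i) (slice xs i p))"
proof -
  have "csum (slice xs lo p) f = (\<Sum>i = 0..p - lo. f (take i (slice xs lo p)) (drop i (slice xs lo p)))"
    using assms by (simp add: csum_eq_sum slice_def)
  also have "\<dots> = (\<Sum>i = lo..p. f (slice xs lo i) (slice xs i p))"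
    by (rule sum.reindex_bij_witness[of _ "\<lambda>i. i - lo" "\<lambda>i. i + lo"])
      (use assms in \<open>auto simp: slice_def min_def drop_take add.commute\<close>)
  finally show ?thesis .
qed

lemma slice_length [simp]: "slice xs lo (length xs) = drop lo xs"
  by (simp add: slice_def)

lemma csum_drop:
  "lo \<le> length xs \<Longrightarrow> csum (drop lo xs) f = (\<Sum>i = lo..length xs. f (slice xs lo i) (drop i xs))"
  using csum_slice[of lo "length xs" xs f] by simp

lemma weave_Nil [simp]: "weave lo ps ([] :: ('x list \<Rightarrow> 'x) list) xs = drop lo xs"
  by (cases "(lo, ps, [] :: ('x list \<Rightarrow> 'x) list, xs)" rule: weave.cases) auto

text \<open>Reading a chain two positions at a time is the same as cutting off a gap and a block.\<close>

lemma sum_weave: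
  "lo \<le> length xs \<Longrightarrow>
   (\<Sum>ps\<in>weak_chains lo (length xs) (2 * length gs). f (weave lo ps gs xs)) = dsum gs (drop lo xs) f"
  by (induction gs arbitrary: lo f) (auto simp: sum_weak_chains_Suc csum_drop intro!: sum.cong)

text \<open>The conditions \<open>p \<in> I\<^sub>s\<close> and \<open>p \<in> K\<^sub>s\<^sub>+\<^sub>1\<close> on a chain. The explicit lower bound \<open>lo\<close> makes the first one
  stable under removing the leading pair of a chain.\<close>

definition in_gap :: "nat \<Rightarrow> nat \<Rightarrow> nat \<Rightarrow> nat \<Rightarrow> nat list \<Rightarrow> bool" where
  "in_gap lo N s p ps \<longleftrightarrow> (if s = 0 then lo else ps ! (2 * s - 1)) \<le> p \<and>
     p < (if 2 * s < length ps then ps ! (2 * s) else N)"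

definition in_block :: "nat \<Rightarrow> nat \<Rightarrow> nat list \<Rightarrow> bool" where
  "in_block s p ps \<longleftrightarrow> ps ! (2 * s) \<le> p \<and> p < ps ! Suc (2 * s)"

lemma in_gap_Suc: "in_gap lo N (Suc s) p (i # j # ps) = in_gap j N s p ps"
  by (cases s) (auto simp: in_gap_def)

lemma slice_Suc: "lo \<le> p \<Longrightarrow> p < length xs \<Longrightarrow> slice xs lo (Suc p) = slice xs lo p @ [xs ! p]"
  by (simp add: slice_def Suc_diff_le take_Suc_conv_app_nth)

lemma slice_split: "lo \<le> i \<Longrightarrow> i \<le> hi \<Longrightarrow> slice xs lo hi = slice xs lo i @ slice xs i hi"
proof -
  assume a: "lo \<le> i" "i \<le> hi"
  then have "hi - lo = (i - lo) + (hi - i)" by simp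
  then show ?thesis using a unfolding slice_def by (simp only: take_add drop_drop) simp
qed

lemma length_slice: "j \<le> length xs \<Longrightarrow> length (slice xs i j) = j - i"
  by (simp add: slice_def)

lemma slice_split_at: "lo \<le> p \<Longrightarrow> p < i \<Longrightarrow> i \<le> length xs \<Longrightarrow> slice xs lo i = slice xs lo p @ xs ! p # slice xs (Suc p) i"
  using slice_split[of lo p i xs] slice_split[of p "Suc p" i xs] slice_Suc[of p p xs]
  by (simp add: slice_def)

lemma sum_weave_gap_0:
  assumes "lo \<le> p" "p < length xs"
  shows "(\<Sum>ps | ps \<in> weak_chains lo (length xs) (2 * length gs) \<and> in_gap lo (length xs) 0 p ps. f (weave lo ps gs xs)) =
     dsum gs (drop (Suc p) xs) (\<lambda>v. f (slice xs lo p @ xs ! p # v))"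
proof (cases gs)
  case Nil
  then have "{ps \<in> weak_chains lo (length xs) (2 * length gs). in_gap lo (length xs) 0 p ps} = {[]}"
    using assms by (auto simp: in_gap_def)
  then show ?thesis
    using assms slice_split_at[of lo p "length xs" xs] Nil by simp
next
  case (Cons g gs')
  have "{ps \<in> weak_chains lo (length xs) (2 * length gs). in_gap lo (length xs) 0 p ps} =
     weak_chains (Suc p) (length xs) (2 * length gs)" (is "?A = ?B")
  proof
    show "?A \<subseteq> ?B"
    proof
      fix ps assume a: "ps \<in> ?A"
      then obtain i ps' where "ps = i # ps'" using Cons by (cases ps) (auto simp: weak_chains_def)
      then show "ps \<in> ?B" using a Cons by (auto simp: weak_chains_def in_gap_def subset_iff; fastforce)
    qed
    show "?B \<subseteq> ?A"
    proof
      fix ps assume a: "ps \<in> ?B"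
      then obtain i ps' where "ps = i # ps'" using Cons by (cases ps) (auto simp: weak_chains_def)
      then show "ps \<in> ?A" using a assms by (auto simp: weak_chains_def in_gap_def)
    qed
  qed
  moreover have "weave lo ps gs xs = slice xs lo p @ xs ! p # weave (Suc p) ps gs xs"
    if ps': "ps \<in> ?B" for ps
  proof -
    obtain i j ps' where ps: "ps = i # j # ps'"
      using ps' Cons by (cases ps; cases "tl ps") (auto simp: weak_chains_def)
    then have "p < i" "i \<le> length xs" using ps' by (auto simp: weak_chains_def)
    then show ?thesis using ps Cons slice_split_at[of lo p i xs] assms by simp
  qed
  ultimately show ?thesis using assms by (simp flip: sum_weave)
qed

lemma sum_filter_weak_chains_Suc2:
  "(\<Sum>ps | ps \<in> weak_chains lo hi (Suc (Suc k)) \<and> C ps. f ps) =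
   (\<Sum>i = lo..hi. \<Sum>j = i..hi. \<Sum>ps | ps \<in> weak_chains j hi k \<and> C (i # j # ps). f (i # j # ps))"
proof -
  have "(\<Sum>ps | ps \<in> weak_chains lo hi (Suc (Suc k)) \<and> C ps. f ps) =
      (\<Sum>ps \<in> weak_chains lo hi (Suc (Suc k)). if C ps then f ps else 0)"
    by (simp add: sum.inter_filter)
  then show ?thesis by (simp add: sum_weak_chains_Suc sum.inter_filter)
qed

lemma sum_triangle_restrict:
  fixes F :: "nat \<Rightarrow> nat \<Rightarrow> 'b::comm_monoid_add"
  assumes "\<And>i j. lo \<le> i \<Longrightarrow> i \<le> j \<Longrightarrow> p < j \<Longrightarrow> F i j = 0" and "p \<le> hi"
  shows "(\<Sum>i = lo..hi. \<Sum>j = i..hi. F i j) = (\<Sum>i = lo..p. \<Sum>j = i..p. F i j)"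
proof -
  have "(\<Sum>i = lo..hi. \<Sum>j = i..hi. F i j) = (\<Sum>i = lo..hi. \<Sum>j = i..p. F i j)"
    using assms by (intro sum.cong refl sum.mono_neutral_right) auto
  also have "\<dots> = (\<Sum>i = lo..p. \<Sum>j = i..p. F i j)"
    using assms by (intro sum.mono_neutral_right) auto
  finally show ?thesis .
qed

text \<open>A chain with position \<open>p\<close> in the gap \<open>I\<^sub>s\<close> is a chain below \<open>p\<close> for the first \<open>s\<close> operations
  followed by a chain above \<open>p\<close> for the others.\<close>

lemma sum_weave_gap:
  assumes "lo \<le> p" "p < length xs" "s \<le> length gs"
  shows "(\<Sum>ps | ps \<in> weak_chains lo (length xs) (2 * length gs) \<and> in_gap lo (length xs) s p ps. f (weave lo ps gs xs)) =
     dsum (take s gs) (slice xs lo p) (\<lambda>u. dsum (drop s gs) (drop (Suc p) xs) (\<lambda>v. f (u @ xs ! p # v)))"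
  using assms
proof (induction s arbitrary: lo gs f)
  case 0
  then show ?case by (simp add: sum_weave_gap_0)
next
  case (Suc s)
  then obtain g gs' where gs: "gs = g # gs'" by (cases gs) auto
  have z: "{ps \<in> weak_chains j N k. in_gap j N s p ps} = {}" if "p < j" "2 * s \<le> k" for j N k
  proof -
    have "\<not> in_gap j N s p ps" if "ps \<in> weak_chains j N k" for ps
    proof (cases s)
      case (Suc s')
      then have "2 * s - 1 < length ps" using that \<open>2 * s \<le> k\<close> by (auto simp: weak_chains_def)
      then have "ps ! (2 * s - 1) \<in> {j..N}" using that by (auto simp: weak_chains_def dest: nth_mem)
      then show ?thesis using Suc \<open>p < j\<close> by (auto simp: in_gap_def)
    qed (use \<open>p < j\<close> in \<open>auto simp: in_gap_def\<close>)
    then show ?thesis by auto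
  qed
  have "(\<Sum>ps | ps \<in> weak_chains lo (length xs) (2 * length gs) \<and> in_gap lo (length xs) (Suc s) p ps.
        f (weave lo ps gs xs)) =
     (\<Sum>i = lo..length xs. \<Sum>j = i..length xs.
        \<Sum>ps | ps \<in> weak_chains j (length xs) (2 * length gs') \<and> in_gap j (length xs) s p ps.
        f (slice xs lo i @ g (slice xs i j) # weave j ps gs' xs))"
    by (simp add: gs sum_filter_weak_chains_Suc2 in_gap_Suc)
  also have "\<dots> = (\<Sum>i = lo..p. \<Sum>j = i..p.
        \<Sum>ps | ps \<in> weak_chains j (length xs) (2 * length gs') \<and> in_gap j (length xs) s p ps.
        f (slice xs lo i @ g (slice xs i j) # weave j ps gs' xs))"
    using Suc.prems gs by (intro sum_triangle_restrict) (auto simp: z)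
  also have "\<dots> = (\<Sum>i = lo..p. \<Sum>j = i..p. dsum (take s gs') (slice xs j p) (\<lambda>u.
        dsum (drop s gs') (drop (Suc p) xs) (\<lambda>v. f (slice xs lo i @ g (slice xs i j) # u @ xs ! p # v))))"
    using Suc.prems gs by (intro sum.cong refl, subst Suc.IH) auto
  also have "\<dots> = dsum (take (Suc s) gs) (slice xs lo p) (\<lambda>u. dsum (drop (Suc s) gs) (drop (Suc p) xs) (\<lambda>v. f (u @ xs ! p # v)))"
    using Suc.prems by (auto simp: gs csum_slice intro!: sum.cong)
  finally show ?case .
qed

text \<open>If \<open>p\<close> lies in the block of an operation instead, that block consists of a final piece of the
  entries before \<open>p\<close>, of \<open>p\<close> itself, and of an initial piece of the entries after it. The operation
  may depend on the position of \<open>p\<close> within its block.\<close>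

lemma sum_weave_block:
  assumes "lo \<le> p" "p < length xs" "s < length gs"
  shows "(\<Sum>ps | ps \<in> weak_chains lo (length xs) (2 * length gs) \<and> in_block s p ps.
             f (weave lo ps (gs[s := h (p - ps ! (2 * s))]) xs)) =
     csum (slice xs lo p) (\<lambda>P1 P2. csum (drop (Suc p) xs) (\<lambda>Q1 Q2.
       dsum (take s gs) P1 (\<lambda>u. dsum (drop (Suc s) gs) Q2 (\<lambda>v. f (u @ h (length P2) (P2 @ xs ! p # Q1) # v)))))"
  using assms
proof (induction s arbitrary: lo gs f)
  case 0
  then obtain g gs' where gs: "gs = g # gs'" by (cases gs) auto
  have "(\<Sum>ps | ps \<in> weak_chains lo (length xs) (2 * length gs) \<and> in_block 0 p ps.
             f (weave lo ps (gs[0 := h (p - ps ! (2 * 0))]) xs)) =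
     (\<Sum>i = lo..length xs. \<Sum>j = i..length xs. \<Sum>ps | ps \<in> weak_chains j (length xs) (2 * length gs') \<and> i \<le> p \<and> p < j.
        f (slice xs lo i @ h (p - i) (slice xs i j) # weave j ps gs' xs))"
    by (simp add: gs sum_filter_weak_chains_Suc2 in_block_def)
  also have "\<dots> = (\<Sum>i = lo..p. \<Sum>j = i..length xs. \<Sum>ps | ps \<in> weak_chains j (length xs) (2 * length gs') \<and> i \<le> p \<and> p < j.
        f (slice xs lo i @ h (p - i) (slice xs i j) # weave j ps gs' xs))"
    using 0 by (intro sum.mono_neutral_right) auto
  also have "\<dots> = (\<Sum>i = lo..p. \<Sum>j = Suc p..length xs. \<Sum>ps | ps \<in> weak_chains j (length xs) (2 * length gs') \<and> i \<le> p \<and> p < j.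
        f (slice xs lo i @ h (p - i) (slice xs i j) # weave j ps gs' xs))"
    using 0 by (intro sum.cong refl sum.mono_neutral_right) auto
  also have "\<dots> = (\<Sum>i = lo..p. \<Sum>j = Suc p..length xs. dsum gs' (drop j xs) (\<lambda>v.
        f (slice xs lo i @ h (p - i) (slice xs i p @ xs ! p # slice xs (Suc p) j) # v)))"
  proof (intro sum.cong refl)
    fix i j assume ij: "i \<in> {lo..p}" "j \<in> {Suc p..length xs}"
    then have "{ps. ps \<in> weak_chains j (length xs) (2 * length gs') \<and> i \<le> p \<and> p < j} = weak_chains j (length xs) (2 * length gs')"
      by auto
    then show "(\<Sum>ps | ps \<in> weak_chains j (length xs) (2 * length gs') \<and> i \<le> p \<and> p < j.
        f (slice xs lo i @ h (p - i) (slice xs i j) # weave j ps gs' xs)) =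
      dsum gs' (drop j xs) (\<lambda>v. f (slice xs lo i @ h (p - i) (slice xs i p @ xs ! p # slice xs (Suc p) j) # v))"
      using ij slice_split_at[of i p j xs] sum_weave[of j xs "\<lambda>v. f (slice xs lo i @ h (p - i) (slice xs i j) # v)" gs'] by simp
  qed
  also have "\<dots> = csum (slice xs lo p) (\<lambda>P1 P2. csum (drop (Suc p) xs) (\<lambda>Q1 Q2.
       dsum (take 0 gs) P1 (\<lambda>u. dsum (drop (Suc 0) gs) Q2 (\<lambda>v. f (u @ h (length P2) (P2 @ xs ! p # Q1) # v)))))"
    using 0 by (simp add: csum_slice csum_drop gs length_slice)
  finally show ?case .
next
  case (Suc s)
  then obtain g gs' where gs: "gs = g # gs'" by (cases gs) auto
  have z: "{ps \<in> weak_chains j N (2 * length gs'). in_block s p ps} = {}" if "p < j" for j N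
  proof -
    have "\<not> in_block s p ps" if ps: "ps \<in> weak_chains j N (2 * length gs')" for ps
    proof -
      have "2 * s < length ps" using ps Suc.prems gs by (auto simp: weak_chains_def)
      then have "ps ! (2 * s) \<in> {j..N}" using ps nth_mem[of "2 * s" ps] unfolding weak_chains_def by blast
      then show ?thesis using \<open>p < j\<close> by (auto simp: in_block_def)
    qed
    then show ?thesis by auto
  qed
  let ?F = "\<lambda>i j. \<Sum>ps | ps \<in> weak_chains j (length xs) (2 * length gs') \<and> in_block s p ps.
        f (slice xs lo i @ g (slice xs i j) # weave j ps (gs'[s := h (p - ps ! (2 * s))]) xs)"
  have "(\<Sum>ps | ps \<in> weak_chains lo (length xs) (2 * length gs) \<and> in_block (Suc s) p ps.
             f (weave lo ps (gs[Suc s := h (p - ps ! (2 * Suc s))]) xs)) =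
     (\<Sum>i = lo..length xs. \<Sum>j = i..length xs. ?F i j)"
    by (simp add: gs sum_filter_weak_chains_Suc2 in_block_def)
  also have "\<dots> = (\<Sum>i = lo..p. \<Sum>j = i..p. ?F i j)"
    using Suc.prems gs by (intro sum_triangle_restrict) (auto simp: z)
  also have "\<dots> = (\<Sum>i = lo..p. \<Sum>j = i..p. csum (slice xs j p) (\<lambda>P1 P2. csum (drop (Suc p) xs) (\<lambda>Q1 Q2.
       dsum (take s gs') P1 (\<lambda>u. dsum (drop (Suc s) gs') Q2 (\<lambda>v.
         f (slice xs lo i @ g (slice xs i j) # u @ h (length P2) (P2 @ xs ! p # Q1) # v))))))"
    using Suc.prems gs by (intro sum.cong refl, subst Suc.IH) auto
  also have "\<dots> = csum (slice xs lo p) (\<lambda>u r. csum r (\<lambda>k r. csum r (\<lambda>P1 P2. csum (drop (Suc p) xs) (\<lambda>Q1 Q2.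
       dsum (take s gs') P1 (\<lambda>u'. dsum (drop (Suc s) gs') Q2 (\<lambda>v.
         f (u @ g k # u' @ h (length P2) (P2 @ xs ! p # Q1) # v)))))))"
    using Suc.prems by (auto simp: csum_slice intro!: sum.cong)
  also have "\<dots> = csum (slice xs lo p) (\<lambda>P1 P2. csum (drop (Suc p) xs) (\<lambda>Q1 Q2.
       dsum (take (Suc s) gs) P1 (\<lambda>u. dsum (drop (Suc (Suc s)) gs) Q2 (\<lambda>v. f (u @ h (length P2) (P2 @ xs ! p # Q1) # v)))))"
    by (simp add: gs) (simp only: csum_csum[where zs = "drop (Suc p) xs"] csum_assoc[symmetric])
  finally show ?case .
qed

text \<open>Distributing a list over a remainder and \<open>m\<close> labelled sublists by splitting off one sublist at a
  time.\<close>

primrec bsum :: "nat \<Rightarrow> 'z list \<Rightarrow> ('z list \<Rightarrow> 'z list list \<Rightarrow> 'b::comm_monoid_add) \<Rightarrow> 'b" where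
  "bsum 0 zs f = f zs []"
| "bsum (Suc m) zs f = usum zs (\<lambda>L z. bsum m z (\<lambda>J Ls. f J (L # Ls)))"

lemma bsum_csum: "bsum m zs (\<lambda>J Ls. csum xs (f J Ls)) = csum xs (\<lambda>u v. bsum m zs (\<lambda>J Ls. f J Ls u v))"
  by (induction m arbitrary: zs f) (simp_all add: csum_usum)

lemma bsum_dsum: "bsum m zs (\<lambda>J Ls. dsum gs xs (f J Ls)) = dsum gs xs (\<lambda>w. bsum m zs (\<lambda>J Ls. f J Ls w))"
  by (induction m arbitrary: zs f) (simp_all add: dsum_usum)

lemma bsum_cong:
  "(\<And>J Ls. length Ls = m \<Longrightarrow> f J Ls = g J Ls) \<Longrightarrow> bsum m zs f = bsum m zs g"
proof (induction m arbitrary: zs f g)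
  case (Suc m)
  have "bsum m z (\<lambda>J Ls. f J (L # Ls)) = bsum m z (\<lambda>J Ls. g J (L # Ls))" for L z
    by (rule Suc.IH) (simp add: Suc.prems)
  then show ?case by simp
qed simp

lemma bsum_add: "bsum (m + n) zs f = bsum m zs (\<lambda>J Ls. bsum n J (\<lambda>J Ls'. f J (Ls @ Ls')))"
  by (induction m arbitrary: zs f) simp_all

lemma bsum_Cons:
  fixes f :: "'z list \<Rightarrow> 'z list list \<Rightarrow> 'b::comm_monoid_add"
  shows "bsum m (z # zs) f = bsum m zs (\<lambda>J Ls. f (z # J) Ls) + (\<Sum>j<m. bsum m zs (\<lambda>J Ls. f J (Ls[j := z # Ls ! j])))"
proof (induction m arbitrary: zs f)
  case (Suc m)
  have usum_sum: "usum zs (\<lambda>L z. \<Sum>i<k. F L z i) = (\<Sum>i<k. usum zs (\<lambda>L z. F L z i))" for F :: "_ \<Rightarrow> _ \<Rightarrow> nat \<Rightarrow> 'b" and k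
    by (induction k) (simp_all add: usum_add, simp add: usum_def split_def)
  show ?case
    by (simp add: Suc usum_add usum_sum sum.lessThan_Suc_shift ac_simps del: sum.lessThan_Suc)
qed simp

definition tblock :: "'z list \<Rightarrow> nat list \<Rightarrow> nat \<Rightarrow> 'z list" where
  "tblock zs c j = nths zs {i. c ! i = j}"

lemma tblock_Nil [simp]: "tblock [] c j = []"
  by (simp add: tblock_def)

lemma tblock_Cons [simp]: "tblock (z # zs) (b # c) j = (if b = j then z # tblock zs c j else tblock zs c j)"
  by (simp add: tblock_def nths_Cons)

lemma labellings_Suc: "(\<Sum>c\<in>labellings m (Suc l). f c) = (\<Sum>b = 0..m. \<Sum>c\<in>labellings m l. f (b # c))"
proof -
  have "finite (labellings m l)"
    using finite_lists_length_eq[of "{0..m}" l] by (simp add: labellings_def conj_commute)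
  then have "(\<Sum>b = 0..m. \<Sum>c\<in>labellings m l. f (b # c)) = (\<Sum>(b, c)\<in>{0..m} \<times> labellings m l. f (b # c))"
    by (simp add: sum.cartesian_product)
  also have "\<dots> = (\<Sum>c\<in>labellings m (Suc l). f c)"
  proof (rule sum.reindex_bij_witness[of _ "\<lambda>c. (hd c, tl c)" "\<lambda>(b, c). b # c"])
    fix c assume "c \<in> labellings m (Suc l)"
    then show "(hd c, tl c) \<in> {0..m} \<times> labellings m l" "(case (hd c, tl c) of (b, c) \<Rightarrow> b # c) = c"
      by (cases c; auto simp: labellings_def)+
  qed (auto simp: labellings_def)
  finally show ?thesis by simp
qed

text \<open>By induction on the list: its head joins the block that its label names.\<close>

lemma sum_labellings:
  fixes f :: "'z list \<Rightarrow> 'z list list \<Rightarrow> 'b::comm_monoid_add"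
  shows "(\<Sum>c\<in>labellings m (length zs). f (tblock zs c 0) (map (tblock zs c) [1..<Suc m])) = bsum m zs f"
proof (induction zs arbitrary: f)
  case Nil
  have "bsum m [] f = f [] (replicate m [])" for f :: "'z list \<Rightarrow> 'z list list \<Rightarrow> 'b"
    by (induction m arbitrary: f) simp_all
  moreover have "labellings m 0 = {[]}"
    by (auto simp: labellings_def)
  ultimately show ?case by (simp add: map_replicate_const del: upt_Suc)
next
  case (Cons z zs)
  let ?B = "\<lambda>c. map (tblock zs c) [1..<Suc m]"
  have direct: "map (tblock (z # zs) (0 # c)) [1..<Suc m] = ?B c" for c
    by simp
  have upd: "map (tblock (z # zs) (Suc j # c)) [1..<Suc m] = (?B c)[j := z # ?B c ! j]"
    if "j < m" for j c
    using that by (intro nth_equalityI) (simp_all add: nth_list_update del: upt_Suc)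
  have "(\<Sum>c\<in>labellings m (length (z # zs)). f (tblock (z # zs) c 0) (map (tblock (z # zs) c) [1..<Suc m])) =
    (\<Sum>b = 0..m. \<Sum>c\<in>labellings m (length zs). f (tblock (z # zs) (b # c) 0) (map (tblock (z # zs) (b # c)) [1..<Suc m]))"
    by (simp only: list.size add_0_right add_Suc_right One_nat_def labellings_Suc)
  also have "\<dots> = (\<Sum>c\<in>labellings m (length zs). f (z # tblock zs c 0) (?B c))
    + (\<Sum>j<m. \<Sum>c\<in>labellings m (length zs). f (tblock zs c 0) ((?B c)[j := z # ?B c ! j]))"
    unfolding atLeast0AtMost sum.atMost_shift
    by (intro arg_cong2[where f = "(+)"] sum.cong refl)
      (simp_all only: upd direct lessThan_iff tblock_Cons simp_thms if_True if_False nat.distinct)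
  also have "\<dots> = bsum m (z # zs) f"
    unfolding bsum_Cons Cons[symmetric] by (rule refl)
  finally show ?case .
qed

declare add_bit_eq_xor [simp del] mult_bit_eq_and [simp del]

lemma bit_double [simp]: "(a::bit) + a = 0" "(a::bit) + (a + b) = b"
  by (cases a; cases b; simp add: add_bit_eq_xor)+

section \<open>Koszul signs\<close>

text \<open>Exponents of signs matter only modulo 2 and live in the field with two elements, where
  equations between them can be rewritten without regard to signs.\<close>

definition sg :: "bit \<Rightarrow> 'v::ab_group_add \<Rightarrow> 'v" where
  "sg b x = (if b = 0 then x else - x)"

lemma bit_of_int: "(of_int n :: bit) = of_bool (odd n)"
proof -
  have "(of_int (2 * k) :: bit) = 0" for k by simp
  moreover have "(of_int (2 * k + 1) :: bit) = 1" for k by simp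
  ultimately show ?thesis by (cases "even n") (auto elim!: evenE oddE)
qed

lemma signed_by_eq_sg: "signed_by n x = sg (of_int n) x"
  by (simp add: signed_by_def sg_def bit_of_int)

lemma sg_sg [simp]: "sg a (sg b x) = sg (a + b) x"
  by (cases a; cases b; simp add: sg_def)

lemma sg_0 [simp]: "sg 0 x = x" "sg b 0 = 0"
  by (simp_all add: sg_def)

lemma sg_add: "sg b (x + y) = sg b x + sg b y"
  by (simp add: sg_def)

lemma sg_sum: "sg b (sum f A) = (\<Sum>x\<in>A. sg b (f x))"
  by (simp add: sg_def sum_negf)

lemma sg_lsum: "sg b (lsum xs f) = lsum xs (\<lambda>x. sg b (f x))"
  by (induction xs) (simp_all add: sg_add)

lemma sg_eq_iff: "sg a x = sg b y \<longleftrightarrow> x = sg (a + b) y"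
  by (cases a; cases b; auto simp: sg_def)

definition bdeg :: "(nat \<Rightarrow> int) \<Rightarrow> nat list \<Rightarrow> bit" where
  "bdeg d ts = (\<Sum>t\<leftarrow>ts. of_int (d t))"

lemma bdeg_simps [simp]:
  "bdeg d [] = 0" "bdeg d (t # ts) = of_int (d t) + bdeg d ts" "bdeg d (ts @ ts') = bdeg d ts + bdeg d ts'"
  by (simp_all add: bdeg_def)

lemma bdeg_sum_list: "bdeg d ts = of_int (\<Sum>t\<leftarrow>ts. d t)"
  by (induction ts) simp_all

text \<open>The weighted number of inversions between two blocks, and within one arrangement of
  tokens. The order of the natural numbers serves as an arbitrary reference order: only
  differences of \<open>kos\<close> between arrangements of the same tokens have a meaning.\<close>

definition crossing :: "(nat \<Rightarrow> int) \<Rightarrow> nat list \<Rightarrow> nat list \<Rightarrow> bit" where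
  "crossing d u v = (\<Sum>x\<leftarrow>u. \<Sum>y\<leftarrow>v. if y < x then of_int (d x) * of_int (d y) else 0)"

primrec kos :: "(nat \<Rightarrow> int) \<Rightarrow> nat list \<Rightarrow> bit" where
  "kos d [] = 0"
| "kos d (t # ts) = crossing d [t] ts + kos d ts"

lemma crossing_simps [simp]:
  "crossing d [] v = 0" "crossing d u [] = 0"
  "crossing d (u @ u') v = crossing d u v + crossing d u' v"
  "crossing d u (v @ v') = crossing d u v + crossing d u v'"
  by (simp_all add: crossing_def sum_list_addf)

lemma crossing_Cons: "crossing d (t # u) v = crossing d [t] v + crossing d u v"
  by (simp add: crossing_def)

lemma kos_append: "kos d (u @ v) = kos d u + crossing d u v + kos d v"
proof (induction u)
  case (Cons t u)
  then show ?case by (simp add: crossing_Cons[of d t u] ac_simps)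
qed simp

lemma crossing_sym:
  assumes "set u \<inter> set v = {}"
  shows "crossing d u v + crossing d v u = bdeg d u * bdeg d v"
proof -
  have "crossing d [t] v + crossing d v [t] = of_int (d t) * bdeg d v" if "t \<notin> set v" for t
    using that by (induction v) (auto simp: crossing_def algebra_simps)
  then show ?thesis
    using assms
  proof (induction u)
    case (Cons t u)
    have "crossing d v (t # u) = crossing d v [t] + crossing d v u"
      using crossing_simps(4)[of d v "[t]" u] by simp
    with Cons show ?case by (simp add: crossing_Cons[of d t u] algebra_simps)
  qed simp
qed

lemma kos_swap:
  assumes "set v \<inter> set w = {}"
  shows "kos d (u @ v @ w @ x) = kos d (u @ w @ v @ x) + bdeg d v * bdeg d w"
proof -
  have "bdeg d v * bdeg d w = crossing d v w + crossing d w v"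
    using crossing_sym[OF assms] by simp
  then show ?thesis by (simp add: kos_append ac_simps)
qed

lemma distinct_rearrange:
  "distinct (p @ h @ H @ S @ T @ R) \<Longrightarrow>
     set S \<inter> set h = {} \<and> set (S @ T) \<inter> set H = {} \<and> distinct ((p @ S @ h @ T) @ H @ R)"
  by auto

lemma distinct_rearrange':
  "distinct (p @ N @ M @ L @ K @ R) \<Longrightarrow> set L \<inter> set M = {} \<and> distinct ((p @ N @ L) @ M @ K @ R)"
  by auto

text \<open>To bring the headers \<open>h\<^sub>k\<close> from the front of all entries to the front of their own blocks, each of them
  has to pass the entries that precede its block.\<close>

lemma kos_weave:
  assumes "distinct (pre @ concat hs @ concat (drop lo xs))" "ps \<in> weak_chains lo (length xs) (2 * length hs)"
    "lo \<le> length xs"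
  shows "kos d (pre @ concat (weave lo ps (map (\<lambda>h k. h @ concat k) hs) xs)) =
     kos d (pre @ concat hs @ concat (drop lo xs))
     + (\<Sum>k<length hs. bdeg d (hs ! k) * bdeg d (concat (slice xs lo (ps ! (2 * k)))))"
  using assms
proof (induction hs arbitrary: pre lo ps)
  case (Cons h hs)
  then obtain i j ps' where ps: "ps = i # j # ps'"
    by (cases ps; cases "tl ps") (auto simp: weak_chains_def)
  have ij: "lo \<le> i" "i \<le> j" "j \<le> length xs" and ps': "ps' \<in> weak_chains j (length xs) (2 * length hs)"
    using Cons.prems ps by (auto simp: weak_chains_def)
  let ?S = "concat (slice xs lo i)" and ?T = "concat (slice xs i j)" and ?R = "concat (drop j xs)"
    and ?H = "concat hs"
  have dr: "drop lo xs = slice xs lo i @ slice xs i j @ drop j xs"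
    using slice_split[of lo i "length xs" xs] slice_split[of i j "length xs" xs] ij by simp
  have dist: "distinct (pre @ h @ ?H @ ?S @ ?T @ ?R)"
    using Cons.prems(1) by (simp add: dr)
  have sl: "slice xs lo (ps' ! (2 * k)) = slice xs lo i @ slice xs i j @ slice xs j (ps' ! (2 * k))" if "k < length hs" for k
  proof -
    have "2 * k < length ps'" using that ps' by (auto simp: weak_chains_def)
    then have "ps' ! (2 * k) \<in> {j..length xs}" using ps' nth_mem[of "2 * k" ps'] unfolding weak_chains_def by blast
    then show ?thesis using ij slice_split[of lo i "ps' ! (2 * k)" xs] slice_split[of i j "ps' ! (2 * k)" xs] by simp
  qed
  have bH: "bdeg d ?H = (\<Sum>k<length hs. bdeg d (hs ! k))"
    by (induction hs) (simp_all add: sum.lessThan_Suc_shift del: sum.lessThan_Suc)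
  have "kos d (pre @ concat (weave lo ps (map (\<lambda>h k. h @ concat k) (h # hs)) xs)) =
      kos d ((pre @ ?S @ h @ ?T) @ concat (weave j ps' (map (\<lambda>h k. h @ concat k) hs) xs))"
    by (simp add: ps)
  also have "\<dots> = kos d ((pre @ ?S @ h @ ?T) @ ?H @ ?R)
      + (\<Sum>k<length hs. bdeg d (hs ! k) * bdeg d (concat (slice xs j (ps' ! (2 * k)))))"
    using distinct_rearrange[OF dist] ps' ij(3) by (intro Cons.IH) blast+
  also have "kos d ((pre @ ?S @ h @ ?T) @ ?H @ ?R) = kos d (pre @ h @ ?S @ ?T @ ?H @ ?R) + bdeg d h * bdeg d ?S"
  proof -
    have "set ?S \<inter> set h = {}" using distinct_rearrange[OF dist] by blast
    from kos_swap[OF this, of d pre "?T @ ?H @ ?R"] show ?thesis by (simp add: ac_simps)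
  qed
  also have "kos d (pre @ h @ ?S @ ?T @ ?H @ ?R) = kos d (pre @ h @ ?H @ ?S @ ?T @ ?R) + bdeg d ?H * (bdeg d ?S + bdeg d ?T)"
  proof -
    have "set (?S @ ?T) \<inter> set ?H = {}" using distinct_rearrange[OF dist] by blast
    from kos_swap[OF this, of d "pre @ h" ?R] show ?thesis by (simp add: ac_simps)
  qed
  finally have "kos d (pre @ concat (weave lo ps (map (\<lambda>h k. h @ concat k) (h # hs)) xs)) =
      kos d (pre @ h @ ?H @ ?S @ ?T @ ?R) + bdeg d h * bdeg d ?S + (bdeg d ?H * (bdeg d ?S + bdeg d ?T)
      + (\<Sum>k<length hs. bdeg d (hs ! k) * bdeg d (concat (slice xs j (ps' ! (2 * k))))))"
    by (simp only: ac_simps)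
  also have "bdeg d ?H * (bdeg d ?S + bdeg d ?T) + (\<Sum>k<length hs. bdeg d (hs ! k) * bdeg d (concat (slice xs j (ps' ! (2 * k)))))
     = (\<Sum>k<length hs. bdeg d (hs ! k) * bdeg d (concat (slice xs lo (ps' ! (2 * k)))))"
    unfolding bH sum_distrib_right sum.distrib[symmetric]
    by (rule sum.cong) (simp_all add: sl distrib_left add.assoc)
  finally show ?case
    by (simp add: ps dr sum.lessThan_Suc_shift ac_simps del: sum.lessThan_Suc)
qed simp

text \<open>Interleaving operation tokens \<open>N\<^sub>j\<close> with their \<open>Z\<close>-blocks \<open>L\<^sub>j\<close>: \<open>N\<^sub>j\<close> passes the blocks
  \<open>L\<^sub>i\<close> with \<open>i < j\<close>.\<close>

lemma kos_pull:
  assumes "distinct (pre @ concat Ns @ concat Ls @ post)" "length Ns = length Ls"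
  shows "kos d (pre @ concat (map2 (@) Ns Ls) @ post) = kos d (pre @ concat Ns @ concat Ls @ post)
     + (\<Sum>j<length Ns. (\<Sum>i<j. bdeg d (Ls ! i)) * bdeg d (Ns ! j))"
  using assms(2,1)
proof (induction Ns Ls arbitrary: pre rule: list_induct2)
  case (Cons N Ns L Ls)
  have bN: "bdeg d (concat Ns) = (\<Sum>k<length Ns. bdeg d (Ns ! k))"
    by (induction Ns) (simp_all add: sum.lessThan_Suc_shift del: sum.lessThan_Suc)
  have dist: "distinct (pre @ N @ concat Ns @ L @ concat Ls @ post)"
    using Cons.prems by simp
  have "kos d ((pre @ N @ L) @ concat (map2 (@) Ns Ls) @ post) = kos d ((pre @ N @ L) @ concat Ns @ concat Ls @ post)
     + (\<Sum>j<length Ns. (\<Sum>i<j. bdeg d (Ls ! i)) * bdeg d (Ns ! j))"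
    using distinct_rearrange'[OF dist] by (intro Cons.IH) blast
  moreover have "set L \<inter> set (concat Ns) = {}"
    using distinct_rearrange'[OF dist] by blast
  then have "kos d (pre @ N @ L @ concat Ns @ concat Ls @ post) =
     kos d (pre @ N @ concat Ns @ L @ concat Ls @ post) + bdeg d L * bdeg d (concat Ns)"
    using kos_swap[of L "concat Ns" d "pre @ N" "concat Ls @ post"] by simp
  ultimately show ?case
    by (simp add: sum.lessThan_Suc_shift bN sum_distrib_left sum.distrib algebra_simps del: sum.lessThan_Suc)
qed simp

text \<open>The inversions that involve the first index are those with a later entry of smaller label.\<close>

lemma shuffle_exp_Cons:
  assumes "length c = length zs"
  shows "shuffle_exp (z # zs) (b # c) = shuffle_exp zs c + (\<Sum>i | i < length zs \<and> c ! i < b. fst z * fst (zs ! i))"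
proof -
  let ?S = "{(i, i'). i < i' \<and> i' < length zs \<and> c ! i' < c ! i}"
  let ?A = "map_prod Suc Suc ` ?S" and ?B = "(\<lambda>i. (0::nat, Suc i)) ` {i. i < length zs \<and> c ! i < b}"
  have fin: "finite ?S"
    by (rule finite_subset[of _ "{..<length zs} \<times> {..<length zs}"]) auto
  have eq: "{(i, i'). i < i' \<and> i' < length (z # zs) \<and> (b # c) ! i' < (b # c) ! i} = ?A \<union> ?B"
  proof (intro set_eqI iffI)
    fix x assume x: "x \<in> {(i, i'). i < i' \<and> i' < length (z # zs) \<and> (b # c) ! i' < (b # c) ! i}"
    obtain i i' where "x = (i, i')" by (cases x)
    with x show "x \<in> ?A \<union> ?B"
      by (cases i; cases i') (auto simp: image_iff)
  qed auto
  have "shuffle_exp (z # zs) (b # c) = (\<Sum>(i, i')\<in>?A \<union> ?B. fst ((z # zs) ! i) * fst ((z # zs) ! i'))"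
    unfolding shuffle_exp_def eq ..
  also have "\<dots> = (\<Sum>(i, i')\<in>?A. fst ((z # zs) ! i) * fst ((z # zs) ! i')) + (\<Sum>(i, i')\<in>?B. fst ((z # zs) ! i) * fst ((z # zs) ! i'))"
    by (rule sum.union_disjoint) (use fin in auto)
  also have "(\<Sum>(i, i')\<in>?A. fst ((z # zs) ! i) * fst ((z # zs) ! i')) = shuffle_exp zs c"
    unfolding shuffle_exp_def
    by (subst sum.reindex) (auto simp: inj_on_def split_def intro!: sum.cong)
  also have "(\<Sum>(i, i')\<in>?B. fst ((z # zs) ! i) * fst ((z # zs) ! i')) = (\<Sum>i | i < length zs \<and> c ! i < b. fst z * fst (zs ! i))"
    by (subst sum.reindex) (auto simp: inj_on_def)
  finally show ?thesis .
qed

lemma bdeg_blocks_below: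
  "length c = length zs \<Longrightarrow>
   bdeg d (concat (map (tblock zs c) [0..<b])) = (\<Sum>i | i < length zs \<and> c ! i < b. of_int (d (zs ! i)))"
proof (induction zs arbitrary: c)
  case (Cons z zs)
  then obtain a c' where c: "c = a # c'" "length c' = length zs" by (cases c) auto
  let ?A = "{i. i < length zs \<and> c' ! i < b}"
  have "bdeg d (concat (map (tblock (z # zs) (a # c')) [0..<b])) =
      (if a < b then of_int (d z) else 0) + bdeg d (concat (map (tblock zs c') [0..<b]))"
  proof (induction b)
    case (Suc b)
    then show ?case by (cases "a < b"; cases "a = b") (simp_all add: ac_simps)
  qed simp
  also have "\<dots> = (if a < b then of_int (d z) else 0) + (\<Sum>i\<in>?A. of_int (d (zs ! i)))"
    using Cons.IH c by simp
  also have "\<dots> = (\<Sum>i\<in>(if a < b then {0} else {}) \<union> Suc ` ?A. of_int (d ((z # zs) ! i)))"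
    by (subst sum.union_disjoint) (auto simp: sum.reindex)
  also have "(if a < b then {0} else {}) \<union> Suc ` ?A = {i. i < length (z # zs) \<and> c ! i < b}"
  proof (intro set_eqI)
    fix i show "i \<in> (if a < b then {0} else {}) \<union> Suc ` ?A \<longleftrightarrow> i \<in> {i. i < length (z # zs) \<and> c ! i < b}"
      using c by (cases i) auto
  qed
  finally show ?case using c by simp
next
  case Nil
  then show ?case by (induction b) simp_all
qed

text \<open>Collecting a list into its labelled blocks costs the sign of the unshuffle. The head moves past
  the part of the tail that goes to earlier blocks.\<close>

lemma kos_shuffle:
  assumes "c \<in> labellings m (length zs)" "distinct (pre @ zs @ post)"
  shows "kos d (pre @ concat (map (tblock zs c) [0..<Suc m]) @ post) =
     kos d (pre @ zs @ post) + of_int (shuffle_exp (map (\<lambda>t. (d t, v t)) zs) c)"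
  using assms
proof (induction zs arbitrary: c pre)
  case Nil
  then show ?case by (auto simp: labellings_def shuffle_exp_def map_replicate_const simp del: upt_Suc)
next
  case (Cons z zs)
  then obtain b c' where c: "c = b # c'" "c' \<in> labellings m (length zs)" "b \<le> m" "length c' = length zs"
    by (cases c) (auto simp: labellings_def)
  let ?B = "tblock zs c'"
  let ?pre = "concat (map ?B [0..<b])" and ?suf = "?B b @ concat (map ?B [Suc b..<Suc m])"
  have split: "[0..<Suc m] = [0..<b] @ b # [Suc b..<Suc m]"
    using c upt_add_eq_append[of 0 b "Suc m - b"] by (simp add: upt_conv_Cons del: upt_Suc)
  have e1: "concat (map (tblock (z # zs) c) [0..<Suc m]) = ?pre @ [z] @ ?suf"
  proof -
    have "map (tblock (z # zs) c) [0..<b] = map ?B [0..<b]" "map (tblock (z # zs) c) [Suc b..<Suc m] = map ?B [Suc b..<Suc m]"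
      using c by (auto simp del: upt_Suc)
    then have "concat (map (tblock (z # zs) c) [0..<Suc m]) = ?pre @ tblock (z # zs) c b @ concat (map ?B [Suc b..<Suc m])"
      unfolding split map_append list.map concat_append concat.simps by (simp only:)
    then show ?thesis using c by (simp del: upt_Suc)
  qed
  have e2: "concat (map ?B [0..<Suc m]) = ?pre @ ?suf"
    unfolding split by simp
  have sub: "set (tblock zs c' j) \<subseteq> set zs" for j
    by (auto simp: tblock_def dest: in_set_nthsD)
  have "kos d (pre @ concat (map (tblock (z # zs) c) [0..<Suc m]) @ post) =
      kos d (pre @ ?pre @ [z] @ ?suf @ post)"
    unfolding e1 by simp
  also have "\<dots> = kos d (pre @ [z] @ ?pre @ ?suf @ post) + bdeg d ?pre * of_int (d z)"
  proof -
    have "set ?pre \<inter> set [z] = {}" using sub Cons.prems(2) by auto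
    from kos_swap[OF this, of d pre "?suf @ post"] show ?thesis by simp
  qed
  also have "kos d (pre @ [z] @ ?pre @ ?suf @ post) = kos d ((pre @ [z]) @ concat (map ?B [0..<Suc m]) @ post)"
    unfolding e2 by simp
  also have "\<dots> = kos d ((pre @ [z]) @ zs @ post) + of_int (shuffle_exp (map (\<lambda>t. (d t, v t)) zs) c')"
    by (rule Cons.IH) (use Cons.prems c in auto)
  finally show ?case
    using c by (simp add: shuffle_exp_Cons bdeg_blocks_below sum_distrib_left sum_distrib_right algebra_simps del: upt_Suc)
qed

lemma weave_map:
  "list_all2 (\<lambda>g g'. \<forall>k. h (g k) = g' (map h k)) gs gs' \<Longrightarrow>
   map h (weave lo ps gs xs) = weave lo ps gs' (map h xs)"
proof (induction lo ps gs xs arbitrary: gs' rule: weave.induct)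
  case (1 lo i j ps g gs xs)
  then obtain g' gs'' where "gs' = g' # gs''" "\<forall>k. h (g k) = g' (map h k)"
    "list_all2 (\<lambda>g g'. \<forall>k. h (g k) = g' (map h k)) gs gs''"
    by (auto simp: list_all2_Cons1)
  then show ?case using "1.IH"[of gs''] by (simp add: slice_def take_map drop_map)
next
  case ("2_1" lo v xs)
  then show ?case by (simp add: drop_map)
next
  case ("2_2" lo v va xs)
  then show ?case by (cases gs') (simp_all add: drop_map)
next
  case ("2_3" lo ps xs)
  then show ?case by (simp add: drop_map)
qed

text \<open>An item is a value together with the list of tokens that went into it, in the order
  in which they appear in the expression for the value. The degree of the value is the sum of the
  degrees of its tokens.\<close>

definition hitem :: "(nat \<Rightarrow> int) \<Rightarrow> nat list \<times> 'a \<Rightarrow> int \<times> 'a" where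
  "hitem d x = ((\<Sum>t\<leftarrow>fst x. d t), snd x)"

definition zitem :: "(nat \<Rightarrow> int) \<Rightarrow> (nat \<Rightarrow> 'z) \<Rightarrow> nat \<Rightarrow> int \<times> 'z" where
  "zitem d v t = (d t, v t)"

abbreviation toks :: "(nat list \<times> 'a) list \<Rightarrow> nat list" where
  "toks xs \<equiv> concat (map fst xs)"

text \<open>The output of one operation, presented as an item.\<close>

definition plain :: "(nat \<Rightarrow> 'z) \<Rightarrow> nat list \<times> ('z, 'a) hcochain \<Rightarrow> nat list \<Rightarrow> (nat list \<times> 'a) list \<Rightarrow> nat list \<times> 'a" where
  "plain v X L k = (fst X @ L @ toks k, snd (snd X) (map v L) (map snd k))"

lemma tdeg_hitem: "of_int (tdeg (map (hitem d) xs)) = bdeg d (toks xs)"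
  by (induction xs) (simp_all add: tdeg_def hitem_def bdeg_sum_list)

lemma tdeg_zitem: "of_int (tdeg (map (zitem d v) ts)) = bdeg d ts"
  by (induction ts) (simp_all add: tdeg_def zitem_def)

lemma tdeg_append: "tdeg (xs @ ys) = tdeg xs + tdeg ys"
  by (simp add: tdeg_def)

lemma slice_map: "slice (map f xs) i j = map f (slice xs i j)"
  by (simp add: slice_def take_map drop_map)

text \<open>The gaps and blocks before the \<open>(k+1)\<close>-st block make up the initial segment that ends where that block begins.\<close>

lemma gaps_blocks_prefix:
  assumes "ps \<in> weak_chains 0 (length as) (2 * m)" "k < m"
  shows "(\<Sum>i = 0..<Suc k. tdeg (slice as (I_lo ps i) (I_hi (length as) ps i)))
      + (\<Sum>i = 1..<Suc k. tdeg (slice as (K_lo ps i) (K_hi ps i))) = tdeg (slice as 0 (ps ! (2 * k)))"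
  using assms(2)
proof (induction k)
  case 0
  then show ?case using assms(1) by (auto simp: I_lo_def I_hi_def K_lo_def weak_chains_def)
next
  case (Suc k)
  have len: "length ps = 2 * m" "sorted ps" using assms(1) by (auto simp: weak_chains_def)
  have le: "ps ! (2 * k) \<le> ps ! Suc (2 * k)" "ps ! Suc (2 * k) \<le> ps ! Suc (Suc (2 * k))"
    using len Suc.prems by (auto intro!: sorted_nth_mono)
  have "slice as 0 (ps ! (2 * Suc k)) = slice as 0 (ps ! (2 * k)) @ slice as (ps ! (2 * k)) (ps ! Suc (2 * k))
      @ slice as (ps ! Suc (2 * k)) (ps ! Suc (Suc (2 * k)))"
    using slice_split[of 0 "ps ! (2 * k)" "ps ! (2 * Suc k)" as] le
      slice_split[of "ps ! (2 * k)" "ps ! Suc (2 * k)" "ps ! (2 * Suc k)" as] by simp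
  then show ?case
    using Suc len by (simp add: tdeg_append I_lo_def I_hi_def K_lo_def K_hi_def)
qed

lemma of_int_brace_exp:
  assumes "ps \<in> weak_chains 0 (length xs) (2 * length Es)"
  shows "of_int (brace_exp Es (map (zitem d v) zs) (map (hitem d) xs) c ps) =
    (\<Sum>k<length Es. bdeg d (toks (slice xs 0 (ps ! (2 * k)))) * (of_int (fst (Es ! k)) + bdeg d (tblock zs c (Suc k))))
    + (\<Sum>k<length Es. (bdeg d (tblock zs c 0) + (\<Sum>i<k. bdeg d (tblock zs c (Suc i)))) * of_int (fst (Es ! k)))
    + of_int (shuffle_exp (map (zitem d v) zs) c)"
proof -
  let ?as = "map (hitem d) xs"
  have blk: "zblock (map (zitem d v) zs) c j = map (zitem d v) (tblock zs c j)" for j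
    by (simp add: zblock_def tblock_def nths_map)
  have shift: "(\<Sum>i = Suc 0..<Suc k. F i) = (\<Sum>i<k. F (Suc i))" for F :: "nat \<Rightarrow> int" and k
    by (simp only: sum.shift_bounds_Suc_ivl atLeast0LessThan)
  have pre: "(\<Sum>i = 0..<Suc k. tdeg (slice ?as (I_lo ps i) (I_hi (length ?as) ps i)))
      + (\<Sum>i<k. tdeg (slice ?as (K_lo ps (Suc i)) (K_hi ps (Suc i)))) = tdeg (slice ?as 0 (ps ! (2 * k)))"
    if "k < length Es" for k
    using gaps_blocks_prefix[of ps ?as "length Es" k, unfolded One_nat_def shift] assms that
    by (simp del: sum.op_ivl_Suc)
  have "brace_exp Es (map (zitem d v) zs) ?as c ps =
    (\<Sum>k<length Es. tdeg (slice ?as 0 (ps ! (2 * k))) * (fst (Es ! k) + tdeg (map (zitem d v) (tblock zs c (Suc k)))))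
    + (\<Sum>k<length Es. (tdeg (map (zitem d v) (tblock zs c 0)) + (\<Sum>i<k. tdeg (map (zitem d v) (tblock zs c (Suc i))))) * fst (Es ! k))
    + shuffle_exp (map (zitem d v) zs) c"
    unfolding brace_exp_def Let_def One_nat_def sum.atLeast1_atMost_eq[unfolded One_nat_def] blk
    by (intro arg_cong2[where f = "(+)"] sum.cong refl) (simp_all only: pre shift lessThan_iff diff_Suc_Suc diff_zero)
  then show ?thesis
    by (simp add: slice_map tdeg_hitem tdeg_zitem)
qed

lemma mset_blocks:
  "c \<in> labellings m (length zs) \<Longrightarrow> mset (concat (map (tblock zs c) [0..<Suc m])) = mset zs"
proof (induction zs arbitrary: c)
  case Nil
  have "concat (map (tblock [] c) [0..<n]) = []" for n
    by (induction n) simp_all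
  then show ?case by (simp del: upt_Suc)
next
  case (Cons z zs)
  then obtain b c' where c: "c = b # c'" "c' \<in> labellings m (length zs)" "b \<le> m"
    by (cases c) (auto simp: labellings_def)
  have "mset (concat (map (tblock (z # zs) (b # c')) [0..<n])) =
      (if b < n then {#z#} else {#}) + mset (concat (map (tblock zs c') [0..<n]))" for n
  proof (induction n)
    case (Suc n)
    then show ?case by (cases "b < n"; cases "b = n") simp_all
  qed simp
  from this[of "Suc m"] show ?case using Cons.IH[OF c(2)] c(1,3) by (simp del: upt_Suc tblock_Cons)
qed

lemma mset_concat_map2_append:
  "length As = length Bs \<Longrightarrow> mset (concat (map2 (@) As Bs)) = mset (concat As) + mset (concat Bs)"
  by (induction As Bs rule: list_induct2) simp_all

text \<open>The exponent in the definition of the brace is the difference of \<open>kos\<close> between the arrangement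
  (operations, \<open>Z\<close>-inputs, \<open>A\<close>-inputs) and the order in which a term of the expansion uses them. Its three
  summands are the costs of three moves: sorting the \<open>Z\<close>-inputs into blocks, moving the operations
  past blocks of \<open>Z\<close>-inputs, and moving the operations with their blocks past \<open>A\<close>-inputs.\<close>

theorem brace_term_kos:
  assumes c: "c \<in> labellings (length Xs) (length zs)" and ps: "ps \<in> weak_chains 0 (length xs) (2 * length Xs)"
    and dist: "distinct (N0 @ concat (map fst Xs) @ zs @ toks xs)"
    and deg: "\<And>X. X \<in> set Xs \<Longrightarrow> of_int (fst (snd X)) = bdeg d (fst X)"
    and w_def: "w = weave 0 ps (map2 (plain v) Xs (map (tblock zs c) [1..<Suc (length Xs)])) xs"
    and J_def: "J = tblock zs c 0"
  shows "sg (kos d (N0 @ concat (map fst Xs) @ zs @ toks xs))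
       (brace_term D (map snd Xs) (map (zitem d v) zs) (map (hitem d) xs) c ps) =
     sg (kos d (N0 @ J @ toks w)) (snd D (map v J) (map snd w))"
proof -
  let ?m = "length Xs" and ?Ns = "map fst Xs" and ?Ls = "map (tblock zs c) [1..<Suc (length Xs)]"
  have blk: "zblock (map (zitem d v) zs) c j = map (zitem d v) (tblock zs c j)" for j
    by (simp add: zblock_def tblock_def nths_map)
  have snd_zitem: "map snd (map (zitem d v) ts) = map v ts" for ts
    by (simp add: zitem_def)
  have Lnth: "k < ?m \<Longrightarrow> ?Ls ! k = tblock zs c (Suc k)" for k
    by (simp del: upt_Suc)
  have JL: "J @ concat ?Ls = concat (map (tblock zs c) [0..<Suc ?m])"
    by (simp add: J_def upt_conv_Cons del: upt_Suc)
  have perm: "mset J + mset (concat ?Ls) = mset zs"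
    using mset_blocks[OF c] JL by (metis mset_append)
  have distI: "distinct ts" if "mset ts = mset (N0 @ concat ?Ns @ zs @ toks xs)" for ts
    using dist that mset_eq_imp_distinct_iff by blast
  have val: "map snd w = weave 0 ps (map (\<lambda>j. snd (map snd Xs ! (j - 1)) (map snd (zblock (map (zitem d v) zs) c j)))
      [1..<Suc (length (map snd Xs))]) (map snd (map (hitem d) xs))"
    unfolding w_def map_map o_def hitem_def snd_conv
    by (rule weave_map) (auto simp: list_all2_conv_all_nth plain_def blk zitem_def o_def simp del: upt_Suc)
  have tok: "map fst w = weave 0 ps (map (\<lambda>h k. h @ concat k) (map2 (@) ?Ns ?Ls)) (map fst xs)"
    unfolding w_def
    by (rule weave_map) (auto simp: list_all2_conv_all_nth plain_def simp del: upt_Suc; cases Xs; simp)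
  have bN: "bdeg d (concat ?Ns) = (\<Sum>k<?m. bdeg d (fst (Xs ! k)))"
    by (induction Xs) (simp_all add: sum.lessThan_Suc_shift del: sum.lessThan_Suc)
  have "kos d (N0 @ J @ toks w) = kos d (N0 @ J @ concat (map2 (@) ?Ns ?Ls) @ toks xs)
      + (\<Sum>k<?m. bdeg d (fst (Xs ! k) @ tblock zs c (Suc k)) * bdeg d (toks (slice xs 0 (ps ! (2 * k)))))"
  proof -
    have "mset (concat (map2 (@) ?Ns ?Ls)) = mset (concat ?Ns) + mset (concat ?Ls)"
      by (rule mset_concat_map2_append) (simp del: upt_Suc)
    then have "distinct ((N0 @ J) @ concat (map2 (@) ?Ns ?Ls) @ concat (drop 0 (map fst xs)))"
      using perm by (intro distI) (simp add: ac_simps)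
    from kos_weave[OF this, of ps d] ps show ?thesis
      by (simp add: tok slice_map nth_append del: upt_Suc)
  qed
  also have "kos d (N0 @ J @ concat (map2 (@) ?Ns ?Ls) @ toks xs) =
     kos d (N0 @ J @ concat ?Ns @ concat ?Ls @ toks xs)
     + (\<Sum>j<?m. (\<Sum>i<j. bdeg d (tblock zs c (Suc i))) * bdeg d (fst (Xs ! j)))"
  proof -
    have "distinct ((N0 @ J) @ concat ?Ns @ concat ?Ls @ toks xs)"
      using perm by (intro distI) (simp add: ac_simps)
    from kos_pull[OF this, of d] show ?thesis
      by (simp del: upt_Suc)
  qed
  also have "kos d (N0 @ J @ concat ?Ns @ concat ?Ls @ toks xs) =
     kos d (N0 @ concat ?Ns @ J @ concat ?Ls @ toks xs) + bdeg d J * bdeg d (concat ?Ns)"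
  proof -
    have "distinct (N0 @ J @ concat ?Ns @ concat ?Ls @ toks xs)"
      using perm by (intro distI) (simp add: ac_simps)
    then have "set J \<inter> set (concat ?Ns) = {}" unfolding distinct_append set_append by blast
    from kos_swap[OF this] show ?thesis .
  qed
  also have "kos d (N0 @ concat ?Ns @ J @ concat ?Ls @ toks xs) =
     kos d (N0 @ concat ?Ns @ zs @ toks xs) + of_int (shuffle_exp (map (zitem d v) zs) c)"
  proof -
    have "distinct ((N0 @ concat ?Ns) @ zs @ toks xs)"
      using dist by simp
    from kos_shuffle[OF c this, of d v] show ?thesis
      by (simp only: append_assoc zitem_def[abs_def] flip: JL)
  qed
  finally have "kos d (N0 @ J @ toks w) = kos d (N0 @ concat ?Ns @ zs @ toks xs)
      + of_int (brace_exp (map snd Xs) (map (zitem d v) zs) (map (hitem d) xs) c ps)"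
    using ps deg
    by (simp add: of_int_brace_exp bN sum_distrib_left sum_distrib_right sum.distrib algebra_simps J_def)
  then show ?thesis
    by (simp only: brace_term_def signed_by_eq_sg sg_sg val blk snd_zitem J_def)
qed

section \<open>Homogeneous components\<close>

context graded_vector_space
begin

lemma decomposition_component: "is_decomposition gr v (component gr v)"
  unfolding component_def using theI'[of "is_decomposition gr v"] direct_sum[of v] by blast

lemma component_eqI: "is_decomposition gr v f \<Longrightarrow> component gr v = f"
  using direct_sum decomposition_component by blast

lemma component_in: "component gr v d \<in> gr d"
  using decomposition_component by (simp add: is_decomposition_def)

lemma finite_component: "finite {d. component gr v d \<noteq> 0}"
  using decomposition_component by (simp add: is_decomposition_def)

lemma sum_component:
  assumes "finite F" "{d. component gr v d \<noteq> 0} \<subseteq> F"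
  shows "v = (\<Sum>d\<in>F. component gr v d)"
proof -
  have "v = (\<Sum>d | component gr v d \<noteq> 0. component gr v d)"
    using decomposition_component by (simp add: is_decomposition_def)
  also have "\<dots> = (\<Sum>d\<in>F. component gr v d)"
    by (rule sum.mono_neutral_left) (use assms in auto)
  finally show ?thesis .
qed

lemma is_decompositionI:
  assumes "finite F" "\<And>d. f d \<in> gr d" "\<And>d. d \<notin> F \<Longrightarrow> f d = 0" "v = (\<Sum>d\<in>F. f d)"
  shows "is_decomposition gr v f"
proof -
  have sub: "{d. f d \<noteq> 0} \<subseteq> F" using assms(3) by auto
  then have "finite {d. f d \<noteq> 0}" using assms(1) finite_subset by blast
  moreover have "(\<Sum>d\<in>F. f d) = (\<Sum>d | f d \<noteq> 0. f d)"
    by (rule sum.mono_neutral_right) (use assms sub in auto)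
  ultimately show ?thesis using assms by (simp add: is_decomposition_def)
qed

lemma zero_in_gr: "0 \<in> gr d"
  using subspace_gr subspace_0 by blast

lemma component_homogeneous: "v \<in> gr d \<Longrightarrow> component gr v = (\<lambda>e. if e = d then v else 0)"
  by (rule component_eqI, rule is_decompositionI[of "{d}"]) (auto simp: zero_in_gr)

lemma component_add: "component gr (x + y) = (\<lambda>d. component gr x d + component gr y d)"
proof (rule component_eqI, rule is_decompositionI)
  let ?F = "{d. component gr x d \<noteq> 0} \<union> {d. component gr y d \<noteq> 0}"
  show "finite ?F" using finite_component by simp
  then show "x + y = (\<Sum>d\<in>?F. component gr x d + component gr y d)"
    using sum_component[of ?F x] sum_component[of ?F y] by (simp add: sum.distrib)
qed (use component_in subspace_gr subspace_add in auto)

lemma component_scale: "component gr (scale c x) = (\<lambda>d. scale c (component gr x d))"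
proof (rule component_eqI, rule is_decompositionI)
  let ?F = "{d. component gr x d \<noteq> 0}"
  show "finite ?F" using finite_component by simp
  then show "scale c x = (\<Sum>d\<in>?F. scale c (component gr x d))"
    using sum_component[of ?F x] by (simp flip: scale_sum_right)
qed (use component_in subspace_gr subspace_scale in auto)

lemma sum_hcomps:
  assumes "finite F" "{d. component gr v d \<noteq> 0} \<subseteq> F" "\<And>d. f (d, 0) = 0"
  shows "(\<Sum>h\<in>hcomps gr v. f h) = (\<Sum>d\<in>F. f (d, component gr v d))"
proof -
  have "hcomps gr v = (\<lambda>d. (d, component gr v d)) ` {d. component gr v d \<noteq> 0}"
    by (auto simp: hcomps_def)
  then have "(\<Sum>h\<in>hcomps gr v. f h) = (\<Sum>d | component gr v d \<noteq> 0. f (d, component gr v d))"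
    by (simp add: sum.reindex inj_on_def)
  also have "\<dots> = (\<Sum>d\<in>F. f (d, component gr v d))"
    by (rule sum.mono_neutral_left) (use assms in auto)
  finally show ?thesis .
qed

lemma hcomps_homogeneous: "v \<in> gr d \<Longrightarrow> v \<noteq> 0 \<Longrightarrow> hcomps gr v = {(d, v)}"
  by (auto simp: hcomps_def component_homogeneous split: if_splits)

lemma hcomps_0 [simp]: "hcomps gr 0 = {}"
  using component_homogeneous[OF zero_in_gr] by (auto simp: hcomps_def split: if_splits)

lemma in_hcomps: "h \<in> hcomps gr v \<Longrightarrow> snd h \<in> gr (fst h) \<and> snd h \<noteq> 0"
  using component_in by (auto simp: hcomps_def)

text \<open>A formula given on homogeneous elements, linear in each degree, extends linearly.\<close>

lemma linear_sum_hcomps: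
  assumes lin: "\<And>d. Vector_Spaces.linear scale s2 (\<lambda>x. f (d, x))"
  shows "Vector_Spaces.linear scale s2 (\<lambda>v. \<Sum>h\<in>hcomps gr v. f h)"
proof -
  have vs: "vector_space s2" and add: "f (d, x + y) = f (d, x) + f (d, y)" and sc: "f (d, scale c x) = s2 c (f (d, x))" for d x y c
    using lin[of d] by (auto simp: Vector_Spaces.linear_iff)
  interpret s2: vector_space s2 by (rule vs)
  have 0: "f (d, 0) = 0" for d using add[of d 0 0] by simp
  show ?thesis
    unfolding Vector_Spaces.linear_iff
  proof (intro conjI allI vs)
    show "vector_space scale" ..
    fix x y
    let ?F = "{d. component gr x d \<noteq> 0} \<union> {d. component gr y d \<noteq> 0} \<union> {d. component gr (x + y) d \<noteq> 0}"
    have F: "finite ?F" using finite_component by simp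
    show "(\<Sum>h\<in>hcomps gr (x + y). f h) = (\<Sum>h\<in>hcomps gr x. f h) + (\<Sum>h\<in>hcomps gr y. f h)"
      using sum_hcomps[OF F, of x f] sum_hcomps[OF F, of y f] sum_hcomps[OF F, of "x + y" f]
      by (simp add: 0 component_add add sum.distrib subset_iff)
  next
    fix c x
    let ?F = "{d. component gr x d \<noteq> 0} \<union> {d. component gr (scale c x) d \<noteq> 0}"
    have F: "finite ?F" using finite_component by simp
    show "(\<Sum>h\<in>hcomps gr (scale c x). f h) = s2 c (\<Sum>h\<in>hcomps gr x. f h)"
      using sum_hcomps[OF F, of x f] sum_hcomps[OF F, of "scale c x" f]
      by (simp add: 0 component_scale sc s2.scale_sum_right subset_iff)
  qed
qed

lemma hlists_Nil [simp]: "hlists gr [] = {[]}"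
  by (simp add: hlists_def)

lemma hlists_Cons: "hlists gr (v # vs) = (\<lambda>(h, hs). h # hs) ` (hcomps gr v \<times> hlists gr vs)"
  by (auto simp: hlists_def set_Cons_def)

lemma sum_hlists_Cons:
  "(\<Sum>hs\<in>hlists gr (v # vs). f hs) = (\<Sum>h\<in>hcomps gr v. \<Sum>hs\<in>hlists gr vs. f (h # hs))"
proof -
  have "inj_on (\<lambda>(h, hs). h # hs) (hcomps gr v \<times> hlists gr vs)"
    by (auto simp: inj_on_def)
  then show ?thesis
    by (simp add: hlists_Cons sum.reindex sum.cartesian_product split_def)
qed

lemma sum_hlists_append:
  "(\<Sum>hs\<in>hlists gr (us @ vs). f hs) = (\<Sum>h\<in>hlists gr us. \<Sum>hs\<in>hlists gr vs. f (h @ hs))"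
  by (induction us arbitrary: f) (simp_all add: sum_hlists_Cons)

definition homs :: "(int \<times> 'v) list \<Rightarrow> bool" where
  "homs hs \<longleftrightarrow> (\<forall>h\<in>set hs. snd h \<in> gr (fst h))"

lemma homs_simps [simp]:
  "homs []" "homs (h # hs) \<longleftrightarrow> snd h \<in> gr (fst h) \<and> homs hs" "homs (hs @ hs') \<longleftrightarrow> homs hs \<and> homs hs'"
  by (auto simp: homs_def)

lemma in_hlists: "hs \<in> hlists gr vs \<Longrightarrow> homs hs \<and> (\<forall>h\<in>set hs. snd h \<noteq> 0) \<and> length hs = length vs"
proof (induction vs arbitrary: hs)
  case (Cons v vs)
  then obtain h hs' where "hs = h # hs'" "h \<in> hcomps gr v" "hs' \<in> hlists gr vs"
    by (auto simp: hlists_def set_Cons_def)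
  then show ?case using Cons.IH[of hs'] in_hcomps[of h v] by auto
qed simp

end

section \<open>Multilinearity and degrees of brace terms\<close>

lemma weave_cong_drop:
  assumes "ps \<in> weak_chains lo N k" "length xs = length ys" "drop lo xs = drop lo ys"
  shows "weave lo ps gs xs = weave lo ps gs ys"
  using assms
proof (induction lo ps gs xs arbitrary: k rule: weave.induct)
  case (1 lo i j ps g gs xs)
  have le: "lo \<le> i" "i \<le> j" and ps: "ps \<in> weak_chains j N (k - 2)" using 1 by (auto simp: weak_chains_def)
  have "drop i xs = drop i ys" "drop j xs = drop j ys"
    using le "1.prems"(3) by (metis drop_drop le_add_diff_inverse2 order_trans)+
  then show ?case using 1 ps by (simp add: slice_def)
qed simp_all

text \<open>Each input occurs exactly once in a woven list, either as a direct entry or in the block of one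
  operation.\<close>

lemma linear_weave:
  assumes "\<And>g u v. g \<in> set gs \<Longrightarrow> Vector_Spaces.linear s s (\<lambda>x. g (u @ x # v))"
    and "\<And>u v. Vector_Spaces.linear s s (\<lambda>x. f (u @ x # v))"
    and "ps \<in> weak_chains lo (length us + Suc (length vs)) (2 * length gs)" "lo \<le> length us"
  shows "Vector_Spaces.linear s s (\<lambda>x. f (weave lo ps gs (us @ x # vs)))"
  using assms
proof (induction gs arbitrary: lo ps f)
  case Nil
  then show ?case by simp
next
  case (Cons g gs)
  let ?p = "length us"
  obtain i j ps' where ps: "ps = i # j # ps'"
    using Cons.prems by (cases ps; cases "tl ps") (auto simp: weak_chains_def)
  have ij: "lo \<le> i" "i \<le> j" and ps': "ps' \<in> weak_chains j (?p + Suc (length vs)) (2 * length gs)"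
    using Cons.prems ps by (auto simp: weak_chains_def)
  define W where "W = weave j ps' gs (us @ 0 # vs)"
  define B where "B = slice (us @ 0 # vs) i j"
  have const: "weave j ps' gs (us @ x # vs) = W" if "?p < j" for x
    unfolding W_def using that by (intro weave_cong_drop[OF ps']) (auto simp: drop_Cons')
  consider "?p < i" | "i \<le> ?p" "?p < j" | "j \<le> ?p" by linarith
  then show ?case
  proof cases
    case 1
    then have "slice (us @ x # vs) lo i = drop lo us @ x # take (i - Suc ?p) vs"
      "slice (us @ x # vs) i j = B" for x
      using Cons.prems(4) ij by (auto simp: B_def slice_def take_Cons' drop_Cons' Suc_diff_le)
    with 1 ij const show ?thesis
      using Cons.prems(2) by (simp add: ps)
  next
    case 2
    then have "slice (us @ x # vs) lo i = slice us lo i"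
      "slice (us @ x # vs) i j = drop i us @ x # take (j - Suc ?p) vs" for x
      using ij by (auto simp: slice_def take_Cons')
    moreover have "Vector_Spaces.linear s s (\<lambda>x. f (A @ g (B @ x # C) # W))" for A B C W
      using Vector_Spaces.linear_compose[OF Cons.prems(1)[of g B C] Cons.prems(2)[of A W]] by (simp add: o_def)
    ultimately show ?thesis using 2 const by (simp add: ps)
  next
    case 3
    then have "slice (us @ x # vs) lo i = slice us lo i"
      "slice (us @ x # vs) i j = slice us i j" for x
      using ij by (auto simp: slice_def)
    moreover have "Vector_Spaces.linear s s (\<lambda>x. f (A @ B # weave j ps' gs (us @ x # vs)))" for A B
    proof (rule Cons.IH)
      show "Vector_Spaces.linear s s (\<lambda>x. f (A @ B # u @ x # v))" for u v
        using Cons.prems(2)[of "A @ B # u" v] by simp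
    qed (use Cons.prems ps' 3 in auto)
    ultimately show ?thesis by (simp add: ps)
  qed
qed

lemma weave_degree:
  fixes gs :: "((int \<times> 'a) list \<Rightarrow> int \<times> 'a) list" and gr :: "int \<Rightarrow> 'a set"
  defines "hom \<equiv> \<lambda>hs. \<forall>h\<in>set hs. snd h \<in> gr (fst h)"
  assumes "length gs = length es"
    and "\<And>i k. i < length gs \<Longrightarrow> hom k \<Longrightarrow> fst ((gs ! i) k) = es ! i + tdeg k \<and> snd ((gs ! i) k) \<in> gr (es ! i + tdeg k)"
    and "ps \<in> weak_chains lo (length xs) (2 * length gs)" "lo \<le> length xs" "hom (drop lo xs)"
  shows "hom (weave lo ps gs xs) \<and> tdeg (weave lo ps gs xs) = sum_list es + tdeg (drop lo xs)"
  using assms(2-)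
proof (induction gs es arbitrary: lo ps rule: list_induct2)
  case Nil
  then show ?case by simp
next
  case (Cons g gs e es)
  obtain i j ps' where ps: "ps = i # j # ps'"
    using Cons.prems by (cases ps; cases "tl ps") (auto simp: weak_chains_def)
  have ij: "lo \<le> i" "i \<le> j" "j \<le> length xs" and ps': "ps' \<in> weak_chains j (length xs) (2 * length gs)"
    using Cons.prems ps by (auto simp: weak_chains_def)
  have dr: "drop lo xs = slice xs lo i @ slice xs i j @ drop j xs"
    using slice_split[of lo i "length xs" xs] slice_split[of i j "length xs" xs] ij by simp
  have h: "hom (slice xs lo i)" "hom (slice xs i j)" "hom (drop j xs)"
    using Cons.prems(4) unfolding dr by (auto simp: hom_def)
  have g: "fst (g k) = e + tdeg k \<and> snd (g k) \<in> gr (e + tdeg k)" if "hom k" for k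
    using Cons.prems(1)[of 0 k] that by simp
  have "hom (weave j ps' gs xs) \<and> tdeg (weave j ps' gs xs) = sum_list es + tdeg (drop j xs)"
  proof (rule Cons.IH)
    show "fst ((gs ! i) k) = es ! i + tdeg k \<and> snd ((gs ! i) k) \<in> gr (es ! i + tdeg k)" if "i < length gs" "hom k" for i k
      using Cons.prems(1)[of "Suc i" k] that by simp
  qed (use ps' ij h in auto)
  with g[OF h(2)] h(1) show ?case
    by (auto simp: ps dr tdeg_append hom_def tdeg_def[of "_ # _"] simp flip: tdeg_def)
qed

lemma tdeg_simps [simp]: "tdeg [] = 0" "tdeg (x # xs) = fst x + tdeg xs" "tdeg (xs @ ys) = tdeg xs + tdeg ys"
  by (simp_all add: tdeg_def)

lemma tdeg_concat: "tdeg (concat xss) = (\<Sum>xs\<leftarrow>xss. tdeg xs)"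
  by (induction xss) simp_all

lemma tdeg_mset: "mset xs = mset ys \<Longrightarrow> tdeg xs = tdeg ys"
  unfolding tdeg_def by (metis mset_map sum_mset_sum_list)

lemma brace_exp_cong:
  assumes "map fst as = map fst as'" "map fst Es = map fst Es'"
  shows "brace_exp Es zs as c ps = brace_exp Es' zs as' c ps"
proof -
  have "tdeg (slice as i j) = tdeg (slice as' i j)" for i j
    using assms(1) by (simp add: tdeg_def flip: slice_map)
  moreover have "fst (Es ! (j - 1)) = fst (Es' ! (j - 1))" if "j \<in> {1..length Es}" for j
    using assms(2) that by (metis (no_types, lifting) Suc_diff_1 Suc_le_lessD atLeastAtMost_iff length_map less_eq_Suc_le nth_map One_nat_def order_less_le_trans zero_less_one)
  moreover have "length as = length as'" "length Es = length Es'"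
    using assms by (metis length_map)+
  ultimately show ?thesis
    unfolding brace_exp_def Let_def by (intro arg_cong2[where f = "(+)"] sum.cong refl) simp_all
qed

context symplectic_data
begin

sublocale A: graded_vector_space "ascale S" "agr S" by (rule graded_A)
sublocale Z: graded_vector_space "zscale S" "zgr S" by (rule graded_Z)

definition alin :: "('z, 'a) cochain_map \<Rightarrow> bool" where
  "alin D \<longleftrightarrow> (\<forall>zs u v. Vector_Spaces.linear (ascale S) (ascale S) (\<lambda>x. D zs (u @ x # v)))"

text \<open>Multilinearity in the \<open>A\<close>-inputs and homogeneity pass from cochains to their braces and partial
  braces.\<close>

definition good :: "('z, 'a) hcochain \<Rightarrow> bool" where
  "good D \<longleftrightarrow> alin (snd D) \<and> homogeneous_of_degree S (fst D) (snd D)"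

lemma good_homogeneous_cochain: "homogeneous_cochain S D \<Longrightarrow> good D"
proof -
  assume D: "homogeneous_cochain S D"
  have "Vector_Spaces.linear (ascale S) (ascale S) (\<lambda>x. snd D zs (u @ x # v))" for zs u v
  proof -
    have "Vector_Spaces.linear (ascale S) (ascale S) (\<lambda>x. snd D zs ((u @ 0 # v)[length u := x]))"
      using D unfolding homogeneous_cochain_def cochain_def by (metis add_Suc_right length_Cons length_append less_add_Suc1)
    then show ?thesis by simp
  qed
  then show ?thesis using D by (simp add: good_def alin_def homogeneous_cochain_def)
qed

lemma homogeneous_of_degree_iff:
  "homogeneous_of_degree S d D \<longleftrightarrow> (\<forall>hz ha. Z.homs hz \<longrightarrow> A.homs ha \<longrightarrow>
     D (map snd hz) (map snd ha) \<in> agr S (d + tdeg hz + tdeg ha))" (is "?L \<longleftrightarrow> ?R")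
proof
  assume ?L
  show ?R
  proof (intro allI impI)
    fix hz ha assume "Z.homs hz" "A.homs ha"
    then have "list_all2 (\<lambda>z p. z \<in> zgr S p) (map snd hz) (map fst hz)" "list_all2 (\<lambda>z p. z \<in> agr S p) (map snd ha) (map fst ha)"
      by (auto simp: Z.homs_def A.homs_def list_all2_conv_all_nth)
    with \<open>?L\<close> show "D (map snd hz) (map snd ha) \<in> agr S (d + tdeg hz + tdeg ha)"
      by (simp add: homogeneous_of_degree_def tdeg_def)
  qed
next
  assume ?R
  show ?L
    unfolding homogeneous_of_degree_def
  proof (intro allI impI)
    fix zs as ps qs assume a: "list_all2 (\<lambda>z p. z \<in> zgr S p) zs ps" "list_all2 (\<lambda>a q. a \<in> agr S q) as qs"
    then have "Z.homs (zip ps zs)" "A.homs (zip qs as)"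
      by (auto simp: Z.homs_def A.homs_def list_all2_conv_all_nth in_set_zip)
    with \<open>?R\<close> have "D (map snd (zip ps zs)) (map snd (zip qs as)) \<in> agr S (d + tdeg (zip ps zs) + tdeg (zip qs as))"
      by blast
    then show "D zs as \<in> agr S (d + sum_list ps + sum_list qs)"
      using a by (simp add: tdeg_def list_all2_lengthD)
  qed
qed

lemma good_value:
  "good D \<Longrightarrow> Z.homs hz \<Longrightarrow> A.homs ha \<Longrightarrow> snd D (map snd hz) (map snd ha) \<in> agr S (fst D + tdeg hz + tdeg ha)"
  by (simp add: good_def homogeneous_of_degree_iff)

lemma linear_signed:
  assumes "Vector_Spaces.linear s t f"
  shows "Vector_Spaces.linear s t (\<lambda>x. signed_by n (f x))"
proof -
  interpret Vector_Spaces.linear s t f by (rule assms)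
  show ?thesis
    using assms by (auto simp: signed_by_def Vector_Spaces.linear_iff vs2.scale_minus_right)
qed

lemma linear_sumI:
  assumes "\<And>i. i \<in> I \<Longrightarrow> Vector_Spaces.linear s t (f i)" "vector_space s" "vector_space t"
  shows "Vector_Spaces.linear s t (\<lambda>x. \<Sum>i\<in>I. f i x)"
  using assms
proof (induction I rule: infinite_finite_induct)
  case (insert i I)
  interpret t: vector_space t by (rule assms(3))
  show ?case using insert by (auto simp: Vector_Spaces.linear_iff t.scale_right_distrib)
next
  case empty
  interpret t: vector_space t by (rule assms(3))
  show ?case using empty by (simp add: Vector_Spaces.linear_iff)
next
  case (infinite I)
  interpret t: vector_space t by (rule assms(3))
  show ?case using infinite by (simp add: Vector_Spaces.linear_iff)
qed

lemma linear_brace_term: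
  assumes "good D" "\<And>E. E \<in> set Es \<Longrightarrow> good E"
    and "ps \<in> weak_chains 0 (length us + Suc (length vs)) (2 * length Es)"
  shows "Vector_Spaces.linear (ascale S) (ascale S) (\<lambda>x. brace_term D Es hz (us @ (d, x) # vs) c ps)"
proof -
  let ?gs = "map (\<lambda>j. snd (Es ! (j - 1)) (map snd (zblock hz c j))) [1..<Suc (length Es)]"
  define n where "n = brace_exp Es hz (us @ (d, 0) # vs) c ps"
  have e: "brace_exp Es hz (us @ (d, x) # vs) c ps = n" for x
    unfolding n_def by (rule brace_exp_cong) simp_all
  have "Vector_Spaces.linear (ascale S) (ascale S) (\<lambda>x. snd D (map snd (zblock hz c 0)) (weave 0 ps ?gs (map snd us @ x # map snd vs)))"
  proof (rule linear_weave)
    fix g u v assume "g \<in> set ?gs"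
    then obtain j where j: "1 \<le> j" "j \<le> length Es" "g = snd (Es ! (j - 1)) (map snd (zblock hz c j))" by auto
    then have "good (Es ! (j - 1))" by (intro assms nth_mem) auto
    then show "Vector_Spaces.linear (ascale S) (ascale S) (\<lambda>x. g (u @ x # v))"
      by (simp add: j good_def alin_def)
  next
    show "ps \<in> weak_chains 0 (length (map snd us) + Suc (length (map snd vs))) (2 * length ?gs)"
      using assms(3) by (simp del: upt_Suc)
  qed (use assms(1) in \<open>simp_all add: good_def alin_def\<close>)
  then show ?thesis
    unfolding brace_term_def e by (simp add: linear_signed del: upt_Suc)
qed

lemma signed_in_agr: "x \<in> agr S d \<Longrightarrow> signed_by n x \<in> agr S d"
  using A.subspace_gr A.subspace_neg by (auto simp: signed_by_def)

lemma sum_in_agr: "(\<And>i. i \<in> I \<Longrightarrow> f i \<in> agr S d) \<Longrightarrow> sum f I \<in> agr S d"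
  using A.subspace_gr A.subspace_sum by blast

lemma zblock_homs: "Z.homs hz \<Longrightarrow> Z.homs (zblock hz c j)"
  by (auto simp: Z.homs_def zblock_def dest: in_set_nthsD)

lemma brace_term_degree:
  assumes "good D" "\<And>E. E \<in> set Es \<Longrightarrow> good E" "Z.homs hz" "A.homs ha"
    and ps: "ps \<in> weak_chains 0 (length ha) (2 * length Es)" and c: "c \<in> labellings (length Es) (length hz)"
  shows "brace_term D Es hz ha c ps \<in> agr S (fst D + tdeg Es + tdeg hz + tdeg ha)"
proof -
  let ?I = "[1..<Suc (length Es)]"
  let ?gs = "map (\<lambda>j. snd (Es ! (j - 1)) (map snd (zblock hz c j))) ?I"
  let ?e = "\<lambda>j. fst (Es ! (j - 1)) + tdeg (zblock hz c j)"
  let ?gs' = "map (\<lambda>j k. (?e j + tdeg k, snd (Es ! (j - 1)) (map snd (zblock hz c j)) (map snd k))) ?I"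
  let ?w = "weave 0 ps ?gs' ha"
  have w: "A.homs ?w \<and> tdeg ?w = sum_list (map ?e ?I) + tdeg (drop 0 ha)"
    unfolding A.homs_def
  proof (rule weave_degree)
    fix i k assume i: "i < length ?gs'" and "\<forall>h\<in>set k. snd h \<in> agr S (fst h)"
    then have "A.homs k" by (simp add: A.homs_def)
    moreover have "good (Es ! i)" using i by (intro assms nth_mem) (simp del: upt_Suc)
    ultimately have "snd (Es ! i) (map snd (zblock hz c (Suc i))) (map snd k) \<in> agr S (?e (Suc i) + tdeg k)"
      using good_value[of "Es ! i" "zblock hz c (Suc i)" k] assms(3) by (simp add: zblock_homs)
    then show "fst ((?gs' ! i) k) = map ?e ?I ! i + tdeg k \<and> snd ((?gs' ! i) k) \<in> agr S (map ?e ?I ! i + tdeg k)"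
      using i by (simp del: upt_Suc)
  qed (use ps assms(4) in \<open>simp_all add: A.homs_def del: upt_Suc\<close>)
  have m: "map snd ?w = weave 0 ps ?gs (map snd ha)"
    by (rule weave_map) (simp add: list_all2_conv_all_nth del: upt_Suc)
  have zb: "zblock hz c = tblock hz c" by (simp add: fun_eq_iff zblock_def tblock_def)
  have "tdeg hz = tdeg (concat (map (tblock hz c) [0..<Suc (length Es)]))"
    by (rule tdeg_mset) (rule mset_blocks[OF c, symmetric])
  also have "\<dots> = (\<Sum>j\<leftarrow>[0..<Suc (length Es)]. tdeg (tblock hz c j))"
    by (simp add: tdeg_concat o_def del: upt_Suc)
  also have "[0..<Suc (length Es)] = 0 # ?I" by (simp add: upt_conv_Cons del: upt_Suc)
  finally have hz: "tdeg hz = tdeg (zblock hz c 0) + (\<Sum>j\<leftarrow>?I. tdeg (zblock hz c j))"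
    by (simp add: zb del: upt_Suc)
  have "map (\<lambda>j. fst (Es ! (j - 1))) ?I = map fst Es"
    by (intro nth_equalityI) (simp_all del: upt_Suc)
  then have Es: "(\<Sum>j\<leftarrow>?I. ?e j) = tdeg Es + (\<Sum>j\<leftarrow>?I. tdeg (zblock hz c j))"
    by (simp add: sum_list_addf tdeg_def del: upt_Suc)
  have "snd D (map snd (zblock hz c 0)) (map snd ?w) \<in> agr S (fst D + tdeg (zblock hz c 0) + tdeg ?w)"
    using assms w by (intro good_value zblock_homs) auto
  then show ?thesis
    unfolding brace_term_def m[symmetric] using w Es hz by (intro signed_in_agr) (simp add: ac_simps del: upt_Suc)
qed

end

context graded_vector_space
begin

lemma hlists_homs:
  "homs hs \<Longrightarrow> hlists gr (map snd hs) = (if 0 \<in> snd ` set hs then {} else {hs})"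
proof (induction hs)
  case (Cons h hs)
  then show ?case
    by (cases "snd h = 0") (auto simp: hlists_Cons hcomps_homogeneous[of "snd h" "fst h"])
qed simp

end

context symplectic_data
begin

section \<open>Partial expansions and the forms defining cyclic braces\<close>

text \<open>A common form of the full expansion of a brace and of its parts that enter the cyclic braces
  of first and second order. \<open>C\<close> selects the chains, and the list of operations may depend on the chain,
  as it does when one of them is itself a partial expansion whose marked position is counted from the
  start of its block.\<close>

definition part ::
  "(nat \<Rightarrow> nat list set) \<Rightarrow> ('z, 'a) hcochain \<Rightarrow> (nat list \<Rightarrow> ('z, 'a) hcochain list) \<Rightarrow> nat \<Rightarrow>
   (int \<times> 'z) list \<Rightarrow> (int \<times> 'a) list \<Rightarrow> 'a" where
  "part C D E m zs as = (\<Sum>c\<in>labellings m (length zs). \<Sum>ps\<in>C (length as). brace_term D (E ps) zs as c ps)"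

definition part_data ::
  "(nat \<Rightarrow> nat list set) \<Rightarrow> ('z, 'a) hcochain \<Rightarrow> (nat list \<Rightarrow> ('z, 'a) hcochain list) \<Rightarrow> nat \<Rightarrow> int \<Rightarrow> bool" where
  "part_data C D E m e \<longleftrightarrow> good D \<and> (\<forall>N. C N \<subseteq> weak_chains 0 N (2 * m)) \<and>
     (\<forall>ps. length (E ps) = m \<and> tdeg (E ps) = e \<and> (\<forall>X\<in>set (E ps). good X))"

lemma vector_space_A: "vector_space (ascale S)" ..
lemma vector_space_k: "vector_space ((*) :: 'k \<Rightarrow> 'k \<Rightarrow> 'k)" by unfold_locales (auto simp: algebra_simps)

lemma linear_part:
  assumes "part_data C D E m e"
  shows "Vector_Spaces.linear (ascale S) (ascale S) (\<lambda>x. part C D E m hz (us @ (d, x) # vs))"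
  unfolding part_def length_append length_Cons
proof (intro linear_sumI linear_brace_term vector_space_A)
  fix c ps assume ps: "ps \<in> C (length us + Suc (length vs))"
  show "ps \<in> weak_chains 0 (length us + Suc (length vs)) (2 * length (E ps))" "good D" "\<And>X. X \<in> set (E ps) \<Longrightarrow> good X"
    using assms ps by (auto simp: part_data_def)
qed

lemma part_degree:
  assumes "part_data C D E m e" "Z.homs hz" "A.homs ha"
  shows "part C D E m hz ha \<in> agr S (fst D + e + tdeg hz + tdeg ha)"
  unfolding part_def
proof (intro sum_in_agr)
  fix c ps assume "c \<in> labellings m (length hz)" "ps \<in> C (length ha)"
  then show "brace_term D (E ps) hz ha c ps \<in> agr S (fst D + e + tdeg hz + tdeg ha)"
    using brace_term_degree[of D "E ps" hz ha ps c] assms by (auto simp: part_data_def)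
qed

lemma part_zero:
  assumes "part_data C D E m e" "0 \<in> snd ` set ha"
  shows "part C D E m hz ha = 0"
proof -
  obtain us h vs where "ha = us @ h # vs" "snd h = 0" using assms(2) by (metis imageE split_list)
  then have ha: "ha = us @ (fst h, 0) # vs" by (metis prod.collapse)
  have "f 0 = 0" if "Vector_Spaces.linear (ascale S) (ascale S) f" for f
    using that by (metis Vector_Spaces.linear_iff add_cancel_right_right)
  from this[OF linear_part[OF assms(1), of hz us "fst h" vs]] show ?thesis by (simp add: ha)
qed

definition part_op ::
  "(nat \<Rightarrow> nat list set) \<Rightarrow> ('z, 'a) hcochain \<Rightarrow> (nat list \<Rightarrow> ('z, 'a) hcochain list) \<Rightarrow> nat \<Rightarrow> int \<Rightarrow> ('z, 'a) hcochain" where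
  "part_op C D E m e = (fst D + e,
     \<lambda>zs as. \<Sum>hz\<in>hlists (zgr S) zs. \<Sum>ha\<in>hlists (agr S) as. part C D E m hz ha)"

lemma part_op_homs:
  assumes "part_data C D E m e" "Z.homs hz" "A.homs ha"
  shows "snd (part_op C D E m e) (map snd hz) (map snd ha) = (if 0 \<in> snd ` set hz then 0 else part C D E m hz ha)"
  using assms by (simp add: part_op_def Z.hlists_homs A.hlists_homs part_zero)

lemma good_part_op:
  assumes "part_data C D E m e"
  shows "good (part_op C D E m e)"
  unfolding good_def
proof
  show "alin (snd (part_op C D E m e))"
    unfolding alin_def
  proof (intro allI)
    fix zs u v
    have "Vector_Spaces.linear (ascale S) (ascale S) (\<lambda>x. \<Sum>hz\<in>hlists (zgr S) zs. \<Sum>hu\<in>hlists (agr S) u.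
        \<Sum>h\<in>hcomps (agr S) x. \<Sum>hv\<in>hlists (agr S) v. part C D E m hz (hu @ h # hv))"
      by (intro linear_sumI vector_space_A A.linear_sum_hcomps linear_part[OF assms])
    then show "Vector_Spaces.linear (ascale S) (ascale S) (\<lambda>x. snd (part_op C D E m e) zs (u @ x # v))"
      by (simp add: part_op_def A.sum_hlists_append A.sum_hlists_Cons)
  qed
  show "homogeneous_of_degree S (fst (part_op C D E m e)) (snd (part_op C D E m e))"
    unfolding homogeneous_of_degree_iff
    using part_degree[OF assms] A.zero_in_gr by (auto simp: part_op_homs[OF assms] part_op_def[of C D E m e, THEN arg_cong[of _ _ fst]])
qed

lemma brace_eq_part_op:
  "brace S D Es = part_op (\<lambda>N. weak_chains 0 N (2 * length Es)) D (\<lambda>_. Es) (length Es) (tdeg Es)"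
proof -
  have "(\<Sum>ha\<in>hlists (agr S) as. \<Sum>c\<in>labellings (length Es) (length zs). \<Sum>ps\<in>weak_chains 0 (length as) (2 * length Es).
          brace_term D Es hz ha c ps) =
      (\<Sum>ha\<in>hlists (agr S) as. part (\<lambda>N. weak_chains 0 N (2 * length Es)) D (\<lambda>_. Es) (length Es) hz ha)"
    if "hz \<in> hlists (zgr S) zs" for zs as hz
    using Z.in_hlists[OF that] by (intro sum.cong refl) (simp add: part_def A.in_hlists)
  then show ?thesis
    unfolding brace_def part_op_def by (auto simp: fun_eq_iff intro!: sum.cong)
qed

lemma part_data_brace:
  "good D \<Longrightarrow> \<forall>E\<in>set Es. good E \<Longrightarrow> part_data (\<lambda>N. weak_chains 0 N (2 * length Es)) D (\<lambda>_. Es) (length Es) (tdeg Es)"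
  by (simp add: part_data_def)

lemma good_brace: "good D \<Longrightarrow> \<forall>E\<in>set Es. good E \<Longrightarrow> good (brace S D Es)"
  by (simp add: brace_eq_part_op good_part_op part_data_brace)

definition gap_chains :: "nat \<Rightarrow> nat \<Rightarrow> nat \<Rightarrow> nat \<Rightarrow> nat list set" where
  "gap_chains m s p N = {ps \<in> weak_chains 0 N (2 * m). I_lo ps s \<le> p \<and> p < I_hi N ps s}"

lemma direct_part_eq_part:
  "direct_part D Es s p = part (gap_chains (length Es) s p) D (\<lambda>_. Es) (length Es)"
  by (simp add: fun_eq_iff direct_part_def part_def gap_chains_def)

lemma direct_brace_eq_part_op:
  "direct_brace S D Es s p = part_op (gap_chains (length Es) s p) D (\<lambda>_. Es) (length Es) (tdeg Es)"
  by (simp add: direct_brace_def part_op_def direct_part_eq_part)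

lemma part_data_direct:
  "good D \<Longrightarrow> \<forall>E\<in>set Es. good E \<Longrightarrow> part_data (gap_chains (length Es) s p) D (\<lambda>_. Es) (length Es) (tdeg Es)"
  by (auto simp: part_data_def gap_chains_def)

lemma good_direct_brace: "good D \<Longrightarrow> \<forall>E\<in>set Es. good E \<Longrightarrow> good (direct_brace S D Es s p)"
  by (simp add: direct_brace_eq_part_op good_part_op part_data_direct)

definition block_chains :: "nat \<Rightarrow> nat \<Rightarrow> nat \<Rightarrow> nat \<Rightarrow> nat list set" where
  "block_chains m i p N = {ps \<in> weak_chains 0 N (2 * m). K_lo ps i \<le> p \<and> p < K_hi ps i}"

lemma nested_part_eq_part:
  "nested_part S D Es i Fs j p = part (block_chains (length Es) i p) D
     (\<lambda>ps. Es[i - 1 := direct_brace S (Es ! (i - 1)) Fs j (p - K_lo ps i)]) (length Es)"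
  by (simp add: fun_eq_iff nested_part_def part_def block_chains_def)

lemma part_data_nested:
  assumes "good D" "\<forall>E\<in>set (Es @ E # Es'). good E" "\<forall>F\<in>set Fs. good F"
  shows "part_data (block_chains (length (Es @ E # Es')) (Suc (length Es)) p) D
     (\<lambda>ps. (Es @ E # Es')[length Es := direct_brace S E Fs j (p - K_lo ps (Suc (length Es)))])
     (length (Es @ E # Es')) (tdeg (Es @ E # Es') + tdeg Fs)"
  using assms good_direct_brace[of E Fs]
  by (auto simp: part_data_def block_chains_def direct_brace_def)

lemma pairing_sum_left: "pairing S (sum f I) b = (\<Sum>i\<in>I. pairing S (f i) b)"
  and pairing_zero: "pairing S 0 b = 0"
  and pairing_uminus: "pairing S (- a) b = - pairing S a b"
proof -
  interpret l: Vector_Spaces.linear "ascale S" "(*)" "\<lambda>a. pairing S a b" by (rule linear_left)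
  show "pairing S (sum f I) b = (\<Sum>i\<in>I. pairing S (f i) b)" by (rule l.sum)
  show "pairing S 0 b = 0" by (rule l.zero)
  show "pairing S (- a) b = - pairing S a b" by (rule l.neg)
qed

lemma pairing_signed: "pairing S (signed_by n a) b = signed_by n (pairing S a b)"
  by (simp add: signed_by_def pairing_uminus)

lemma pairing_eqI:
  assumes "\<And>b. pairing S x b = pairing S y b"
  shows "x = y"
proof -
  have "pairing S (x - y) b = 0" for b
  proof -
    interpret l: Vector_Spaces.linear "ascale S" "(*)" "\<lambda>a. pairing S a b" by (rule linear_left)
    show ?thesis using assms[of b] by (simp add: l.diff)
  qed
  then show ?thesis using nondegenerate_inj[of "x - y"] by simp
qed

text \<open>The linear form that defines a cyclic brace, for homogeneous inputs.\<close>

definition rotations ::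
  "(nat \<Rightarrow> (int \<times> 'z) list \<Rightarrow> (int \<times> 'a) list \<Rightarrow> 'a) \<Rightarrow> (int \<times> 'z) list \<Rightarrow> (int \<times> 'a) list \<Rightarrow> int \<times> 'a \<Rightarrow> 'k" where
  "rotations T hz ha h0 = (\<Sum>r = 0..length ha. signed_by (tdeg (take r ha) * (tdeg (drop r ha) + fst h0))
     (pairing S (T (length ha - r) hz (drop r ha @ h0 # take r ha)) (marked_elt S)))"

text \<open>For homogeneous inputs \<open>hz\<close> and \<open>ha\<close> the form is linear in \<open>a\<^sub>0\<close> and vanishes unless the degree of \<open>a\<^sub>0\<close>
  has the one value for which the total degree pairs with that of the marked element. Hence it is represented by
  an element, and so is the finite sum of these forms over all components.\<close>

lemma pairing_cyclic_dual:
  assumes "\<And>p. part_data (C p) D (E p) m e" and "zs \<noteq> [] \<or> as \<noteq> []"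
  shows "pairing S (cyclic_dual S (\<lambda>p. part (C p) D (E p) m) zs as) a0 =
     (\<Sum>hz\<in>hlists (zgr S) zs. \<Sum>ha\<in>hlists (agr S) as. \<Sum>h0\<in>hcomps (agr S) a0.
        rotations (\<lambda>p. part (C p) D (E p) m) hz ha h0)"
proof -
  let ?T = "\<lambda>p. part (C p) D (E p) m"
  let ?\<phi> = "\<lambda>hz ha a0. \<Sum>h0\<in>hcomps (agr S) a0. rotations ?T hz ha h0"
  have ex: "\<exists>g. \<forall>a0. pairing S g a0 = ?\<phi> hz ha a0" if hz: "Z.homs hz" and ha: "A.homs ha" for hz ha
  proof (rule nondegenerate_surj)
    show "Vector_Spaces.linear (ascale S) (*) (?\<phi> hz ha)"
    proof (rule A.linear_sum_hcomps)
      fix d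
      have "Vector_Spaces.linear (ascale S) (*) (\<lambda>x. pairing S (?T p hz (us @ (d, x) # vs)) (marked_elt S))" for p us vs
        using Vector_Spaces.linear_compose[OF linear_part[OF assms(1)] linear_left] by (simp add: o_def)
      then show "Vector_Spaces.linear (ascale S) (*) (\<lambda>x. rotations ?T hz ha (d, x))"
        unfolding rotations_def fst_conv by (intro linear_sumI linear_signed vector_space_A vector_space_k)
    qed
    \<comment> \<open>The degree is determined by \<open>|T| - 1 + |\<omega>| = 0\<close>, the marked element having degree \<open>-1\<close>.\<close>
    fix d b assume d: "d \<noteq> 1 - pairing_deg S - fst D - e - tdeg hz - tdeg ha" and b: "b \<in> agr S d"
    have "rotations ?T hz ha (d, b) = 0"
      unfolding rotations_def
    proof (rule sum.neutral, rule ballI)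
      fix r
      let ?l = "drop r ha @ (d, b) # take r ha"
      have "A.homs ?l" using ha b by (auto simp: A.homs_def dest: in_set_takeD in_set_dropD)
      then have "?T (length ha - r) hz ?l \<in> agr S (fst D + e + tdeg hz + tdeg ?l)"
        by (rule part_degree[OF assms(1) hz])
      moreover have "tdeg ?l = tdeg ha + d"
        using tdeg_simps(3)[of "take r ha" "drop r ha"] by simp
      ultimately have "pairing S (?T (length ha - r) hz ?l) (marked_elt S) = 0"
        using d by (intro pairing_degree[OF _ marked_deg]) auto
      then show "signed_by (tdeg (take r ha) * (tdeg (drop r ha) + fst (d, b))) (pairing S (?T (length ha - r) hz ?l) (marked_elt S)) = 0"
        by (simp add: signed_by_def)
    qed
    then show "?\<phi> hz ha b = 0"
      using b by (cases "b = 0") (simp_all add: A.hcomps_homogeneous)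
  qed
  define g where "g hz ha = (SOME g. \<forall>a0. pairing S g a0 = ?\<phi> hz ha a0)" for hz ha
  have g: "pairing S (g hz ha) a0 = ?\<phi> hz ha a0" if "Z.homs hz" "A.homs ha" for hz ha a0
    unfolding g_def using someI_ex[OF ex[OF that]] by (rule spec)
  let ?g = "\<Sum>hz\<in>hlists (zgr S) zs. \<Sum>ha\<in>hlists (agr S) as. g hz ha"
  have val: "pairing S ?g a0 = (\<Sum>hz\<in>hlists (zgr S) zs. \<Sum>ha\<in>hlists (agr S) as. ?\<phi> hz ha a0)" for a0
    unfolding pairing_sum_left by (intro sum.cong refl g Z.in_hlists[THEN conjunct1] A.in_hlists[THEN conjunct1])
  have "cyclic_dual S ?T zs as = (THE g. \<forall>a0. pairing S g a0 =
      (\<Sum>hz\<in>hlists (zgr S) zs. \<Sum>ha\<in>hlists (agr S) as. ?\<phi> hz ha a0))"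
  proof -
    have "(\<Sum>hz\<in>hlists (zgr S) zs. \<Sum>ha\<in>hlists (agr S) as. \<Sum>h0\<in>hcomps (agr S) a0. \<Sum>r = 0..length as.
             signed_by (tdeg (take r ha) * (tdeg (drop r ha) + fst h0))
               (pairing S (?T (length as - r) hz (drop r ha @ h0 # take r ha)) (marked_elt S))) =
       (\<Sum>hz\<in>hlists (zgr S) zs. \<Sum>ha\<in>hlists (agr S) as. ?\<phi> hz ha a0)" for a0
      unfolding rotations_def by (intro sum.cong refl) (simp_all only: A.in_hlists)
    then show ?thesis using assms(2) unfolding cyclic_dual_def by (simp only: if_not_P de_Morgan_conj simp_thms)
  qed
  also have "\<dots> = ?g"
  proof (rule the_equality)
    show "\<forall>a0. pairing S ?g a0 = (\<Sum>hz\<in>hlists (zgr S) zs. \<Sum>ha\<in>hlists (agr S) as. ?\<phi> hz ha a0)"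
      using val by blast
    fix g' assume "\<forall>a0. pairing S g' a0 = (\<Sum>hz\<in>hlists (zgr S) zs. \<Sum>ha\<in>hlists (agr S) as. ?\<phi> hz ha a0)"
    then show "g' = ?g" using val by (intro pairing_eqI) simp
  qed
  finally show ?thesis using val by simp
qed

end

section \<open>Exchanging cochains and formal sums\<close>

lemma csum_map: "csum (map h xs) f = csum xs (\<lambda>u v. f (map h u) (map h v))"
  by (induction xs arbitrary: f) simp_all

lemma dsum_map:
  "list_all2 (\<lambda>g g'. \<forall>k. h (g k) = g' (map h k)) gs gs' \<Longrightarrow>
   dsum gs' (map h xs) f = dsum gs xs (\<lambda>w. f (map h w))"
  by (induction gs gs' arbitrary: xs f rule: list_all2_induct) (simp_all add: csum_map)

lemma in_cuts: "(u, v) \<in> set (cuts xs) \<Longrightarrow> xs = u @ v"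
  by (induction xs arbitrary: u) auto

lemma in_unshuffles: "(L, J) \<in> set (unshuffles zs) \<Longrightarrow> mset L + mset J = mset zs"
  by (induction zs arbitrary: L J) auto

lemma csum_cong: "(\<And>u v. xs = u @ v \<Longrightarrow> f u v = g u v) \<Longrightarrow> csum xs f = csum xs g"
  unfolding csum_def by (rule lsum_cong) (auto dest: in_cuts)

lemma usum_cong: "(\<And>L J. mset L + mset J = mset zs \<Longrightarrow> f L J = g L J) \<Longrightarrow> usum zs f = usum zs g"
  unfolding usum_def by (rule lsum_cong) (auto dest: in_unshuffles)

lemma wsum_cong: "(\<And>J w. (J, w) \<in> set (words gs zs xs) \<Longrightarrow> f J w = g J w) \<Longrightarrow> wsum gs zs xs f = wsum gs zs xs g"
  unfolding wsum_def by (rule lsum_cong) auto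

lemma crossing_mset: "mset t = mset t' \<Longrightarrow> crossing d u t = crossing d u t' \<and> crossing d t u = crossing d t' u"
proof
  assume m: "mset t = mset t'"
  have "(\<Sum>y\<leftarrow>t. f y) = (\<Sum>y\<leftarrow>t'. f y)" for f :: "nat \<Rightarrow> bit"
    using m by (metis mset_map sum_mset_sum_list)
  then show "crossing d u t = crossing d u t'" "crossing d t u = crossing d t' u"
    unfolding crossing_def by simp_all
qed

text \<open>The crossings with the surroundings depend only on which tokens occur in the middle.\<close>

lemma kos_replace: "mset t = mset t' \<Longrightarrow> kos d (A @ t @ B) = kos d (A @ t' @ B) + kos d t' + kos d t"
proof -
  assume "mset t = mset t'"
  from crossing_mset[OF this] have "crossing d A t = crossing d A t'" "crossing d t B = crossing d t' B" by blast+
  then show ?thesis by (simp add: kos_append ac_simps)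
qed

text \<open>Two formal sums of items are equivalent if all their items consist of the same tokens and their
  values, each with the sign of its arrangement, have the same sum.\<close>

definition keq :: "(nat \<Rightarrow> int) \<Rightarrow> (nat list \<times> 'a::ab_group_add) list \<Rightarrow> (nat list \<times> 'a) list \<Rightarrow> bool" where
  "keq d ys ys' \<longleftrightarrow> (\<exists>T. \<forall>y\<in>set ys \<union> set ys'. mset (fst y) = T) \<and>
     lsum ys (\<lambda>y. sg (kos d (fst y)) (snd y)) = lsum ys' (\<lambda>y. sg (kos d (fst y)) (snd y))"

text \<open>Functions of a word that respect this equivalence in every entry.\<close>

definition klin :: "(nat \<Rightarrow> int) \<Rightarrow> ((nat list \<times> 'a::ab_group_add) list \<Rightarrow> 'b::ab_group_add) \<Rightarrow> bool" where
  "klin d f \<longleftrightarrow> (\<forall>u v ys ys'. keq d ys ys' \<longrightarrow> lsum ys (\<lambda>y. f (u @ y # v)) = lsum ys' (\<lambda>y. f (u @ y # v)))"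

definition entrywise_additive :: "('a::ab_group_add list \<Rightarrow> 'b::ab_group_add) \<Rightarrow> bool" where
  "entrywise_additive f \<longleftrightarrow> (\<forall>u v x y. f (u @ (x + y) # v) = f (u @ x # v) + f (u @ y # v))"

lemma entrywise_additive_sg_lsum:
  assumes "entrywise_additive f"
  shows "f (u @ lsum ys (\<lambda>y. sg (b y) (g y)) # v) = lsum ys (\<lambda>y. sg (b y) (f (u @ g y # v)))"
proof -
  have add: "f (u @ (x + y) # v) = f (u @ x # v) + f (u @ y # v)" for x y
    using assms by (simp add: entrywise_additive_def)
  have 0: "f (u @ 0 # v) = 0" using add[of 0 0] by simp
  have "f (u @ (- x) # v) = - f (u @ x # v)" for x
    using add[of x "- x"] 0 by (simp add: eq_neg_iff_add_eq_0 add.commute)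
  then have "f (u @ sg c x # v) = sg c (f (u @ x # v))" for c x
    by (simp add: sg_def)
  then show ?thesis
    by (induction ys) (simp_all add: add 0)
qed

text \<open>Replacing the tokens of one entry by a permutation of them changes the sign of the whole word
  as it changes the sign of the entry alone.\<close>

lemma klin_kos:
  fixes f :: "'a::ab_group_add list \<Rightarrow> 'b::ab_group_add"
  assumes "entrywise_additive f"
  shows "klin d (\<lambda>w. sg (kos d (pre @ toks (a @ w @ b))) (f (map snd (a @ w @ b))))"
  unfolding klin_def
proof (intro allI impI)
  fix u v and ys ys' :: "(nat list \<times> 'a) list" assume k: "keq d ys ys'"
  then obtain T where T: "\<forall>y\<in>set ys \<union> set ys'. mset (fst y) = T" by (auto simp: keq_def)
  obtain t where t: "mset t = T" using ex_mset by blast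
  \<comment> \<open>The part of the sign of the whole word that is common to all items of the two sums.\<close>
  let ?\<kappa> = "kos d ((pre @ toks (a @ u)) @ t @ toks (v @ b)) + kos d t"
  let ?f = "\<lambda>x. f (map snd (a @ u) @ x # map snd (v @ b))"
  have *: "lsum zs (\<lambda>y. sg (kos d (pre @ toks (a @ (u @ y # v) @ b))) (f (map snd (a @ (u @ y # v) @ b)))) =
      sg ?\<kappa> (?f (lsum zs (\<lambda>y. sg (kos d (fst y)) (snd y))))" if "set zs \<subseteq> set ys \<union> set ys'" for zs
  proof -
    have "kos d (pre @ toks (a @ (u @ y # v) @ b)) = ?\<kappa> + kos d (fst y)" if "y \<in> set zs" for y
    proof -
      have "mset (fst y) = mset t" using T t that \<open>set zs \<subseteq> set ys \<union> set ys'\<close> by blast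
      from kos_replace[OF this, of d "pre @ toks (a @ u)" "toks (v @ b)"] show ?thesis
        by (simp only: map_append list.map concat_append concat.simps append_assoc)
    qed
    then have "lsum zs (\<lambda>y. sg (kos d (pre @ toks (a @ (u @ y # v) @ b))) (f (map snd (a @ (u @ y # v) @ b)))) =
       lsum zs (\<lambda>y. sg ?\<kappa> (sg (kos d (fst y)) (?f (snd y))))"
      by (intro lsum_cong) simp
    then show ?thesis
      by (simp only: entrywise_additive_sg_lsum[OF assms] sg_lsum)
  qed
  show "lsum ys (\<lambda>y. sg (kos d (pre @ toks (a @ (u @ y # v) @ b))) (f (map snd (a @ (u @ y # v) @ b)))) =
    lsum ys' (\<lambda>y. sg (kos d (pre @ toks (a @ (u @ y # v) @ b))) (f (map snd (a @ (u @ y # v) @ b))))"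
    using k by (simp only: * Un_upper1 Un_upper2) (simp only: keq_def)
qed

lemma klin_wsum: "(\<And>J w'. klin d (f J w')) \<Longrightarrow> klin d (\<lambda>w. wsum gs zs xs (\<lambda>J w'. f J w' w))"
  by (simp add: klin_def lsum_wsum)

lemma klin_usum: "(\<And>L J. klin d (f L J)) \<Longrightarrow> klin d (\<lambda>w. usum zs (\<lambda>L J. f L J w))"
  by (simp add: klin_def lsum_usum)

lemma klin_context:
  fixes f :: "(nat list \<times> 'a::ab_group_add) list \<Rightarrow> 'b::ab_group_add"
  shows "klin d f \<Longrightarrow> klin d (\<lambda>w. f (a @ w @ b))"
  unfolding klin_def
proof (intro allI impI)
  fix u v and ys ys' :: "(nat list \<times> 'a) list"
  assume f: "\<forall>u v ys ys'. keq d ys ys' \<longrightarrow> lsum ys (\<lambda>y. f (u @ y # v)) = lsum ys' (\<lambda>y. f (u @ y # v))"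
    and "keq d ys ys'"
  then have "lsum ys (\<lambda>y. f ((a @ u) @ y # (v @ b))) = lsum ys' (\<lambda>y. f ((a @ u) @ y # (v @ b)))"
    by blast
  then show "lsum ys (\<lambda>y. f (a @ (u @ y # v) @ b)) = lsum ys' (\<lambda>y. f (a @ (u @ y # v) @ b))"
    by simp
qed

text \<open>Equivalence of the operations is only required on sublists of the given inputs, because outputs
  of braces are described correctly only for pairwise distinct tokens.\<close>

theorem wsum_keq:
  assumes "list_all2 (\<lambda>g g'. \<forall>L k. mset L \<subseteq># mset zs \<longrightarrow> (\<exists>u v. xs = u @ k @ v) \<longrightarrow> keq d (g L k) (g' L k)) gs gs'"
    and "\<And>J. klin d (f J)"
  shows "wsum gs zs xs f = wsum gs' zs xs f"
  using assms
proof (induction gs arbitrary: gs' zs xs f)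
  case Nil
  then show ?case by simp
next
  case (Cons g gs)
  then obtain g' gs'' where gs': "gs' = g' # gs''"
    and g: "\<And>L k. mset L \<subseteq># mset zs \<Longrightarrow> \<exists>u v. xs = u @ k @ v \<Longrightarrow> keq d (g L k) (g' L k)"
    and gs: "list_all2 (\<lambda>g g'. \<forall>L k. mset L \<subseteq># mset zs \<longrightarrow> (\<exists>u v. xs = u @ k @ v) \<longrightarrow> keq d (g L k) (g' L k)) gs gs''"
    by (auto simp: list_all2_Cons1)
  have "wsum gs z r (\<lambda>J w. f J (u @ y # w)) = wsum gs'' z r (\<lambda>J w. f J (u @ y # w))"
    if "mset L + mset z = mset zs" "xs = u @ k @ r" for L z u k r y
  proof (rule Cons.IH)
    show "klin d (\<lambda>w. f J (u @ y # w))" for J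
      using klin_context[OF Cons.prems(2), of J "u @ [y]" "[]"] by simp
    have z: "mset z \<subseteq># mset zs" using that(1) by (metis mset_subset_eq_add_right)
    show "list_all2 (\<lambda>g g'. \<forall>L k. mset L \<subseteq># mset z \<longrightarrow> (\<exists>u v. r = u @ k @ v) \<longrightarrow> keq d (g L k) (g' L k)) gs gs''"
    proof (rule list_all2_mono[OF gs], intro allI impI)
      fix g g' L k'
      assume gg: "\<forall>L k. mset L \<subseteq># mset zs \<longrightarrow> (\<exists>u v. xs = u @ k @ v) \<longrightarrow> keq d (g L k) (g' L k)"
        and L: "mset L \<subseteq># mset z" and "\<exists>u v. r = u @ k' @ v"
      then obtain a b where "r = a @ k' @ b" by blast
      then have "xs = (u @ k @ a) @ k' @ b" using that(2) by simp
      then show "keq d (g L k') (g' L k')"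
        using gg subset_mset.order_trans[OF L z] by blast
    qed
  qed
  then have "wsum (g # gs) zs xs f = usum zs (\<lambda>L z. csum xs (\<lambda>u r. csum r (\<lambda>k r'. lsum (g L k) (\<lambda>y.
       wsum gs'' z r' (\<lambda>J w. f J (u @ y # w))))))"
    unfolding wsum_simps by (intro usum_cong csum_cong lsum_cong) auto
  also have "\<dots> = usum zs (\<lambda>L z. csum xs (\<lambda>u r. csum r (\<lambda>k r'. lsum (g' L k) (\<lambda>y.
       wsum gs'' z r' (\<lambda>J w. f J (u @ y # w))))))"
  proof (intro usum_cong csum_cong)
    fix L z u r k r' assume a: "mset L + mset z = mset zs" "xs = u @ r" "r = k @ r'"
    have "keq d (g L k) (g' L k)"
      using a by (intro g) (auto intro: mset_subset_eq_add_left simp flip: a(1))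
    moreover have "klin d (\<lambda>w. wsum gs'' z r' (\<lambda>J w'. f J (w @ w')))"
      using klin_context[OF Cons.prems(2), of _ "[]"] by (intro klin_wsum) simp
    ultimately show "lsum (g L k) (\<lambda>y. wsum gs'' z r' (\<lambda>J w. f J (u @ y # w))) =
        lsum (g' L k) (\<lambda>y. wsum gs'' z r' (\<lambda>J w. f J (u @ y # w)))"
      unfolding klin_def
    proof -
      assume kq: "keq d (g L k) (g' L k)"
        and "\<forall>u v ys ys'. keq d ys ys' \<longrightarrow> lsum ys (\<lambda>y. wsum gs'' z r' (\<lambda>J w'. f J ((u @ y # v) @ w'))) =
           lsum ys' (\<lambda>y. wsum gs'' z r' (\<lambda>J w'. f J ((u @ y # v) @ w')))"
      from this(2)[rule_format, OF kq, of u "[]"] show ?thesis by simp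
    qed
  qed
  finally show ?case by (simp add: gs')
qed

definition pop :: "(nat \<Rightarrow> 'z) \<Rightarrow> nat list \<times> ('z, 'a) hcochain \<Rightarrow> (nat, nat list \<times> 'a) oper" where
  "pop v X = (\<lambda>L k. [plain v X L k])"

lemma wsum_pop:
  "wsum (map (pop v) Xs) zs xs f = bsum (length Xs) zs (\<lambda>J Ls. dsum (map2 (plain v) Xs Ls) xs (f J))"
  by (induction Xs arbitrary: zs xs f) (simp_all add: pop_def bsum_csum)

lemma wsum_pop_gap:
  assumes "s \<le> length Xs"
  shows "wsum (map (pop v) (take s Xs)) zs P (\<lambda>z u. wsum (map (pop v) (drop s Xs)) z Q (\<lambda>J w. f J (u @ a # w))) =
    bsum (length Xs) zs (\<lambda>J Ls. dsum (take s (map2 (plain v) Xs Ls)) P (\<lambda>u.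
      dsum (drop s (map2 (plain v) Xs Ls)) Q (\<lambda>w. f J (u @ a # w))))"
proof -
  have "bsum (length Xs) zs (\<lambda>J Ls. dsum (take s (map2 (plain v) Xs Ls)) P (\<lambda>u.
      dsum (drop s (map2 (plain v) Xs Ls)) Q (\<lambda>w. f J (u @ a # w)))) =
    bsum (s + (length Xs - s)) zs (\<lambda>J Ls. dsum (map2 (plain v) (take s Xs) (take s Ls)) P (\<lambda>u.
      dsum (map2 (plain v) (drop s Xs) (drop s Ls)) Q (\<lambda>w. f J (u @ a # w))))"
    using assms by (simp add: take_map drop_map take_zip drop_zip)
  also have "\<dots> = bsum s zs (\<lambda>z Ls. bsum (length Xs - s) z (\<lambda>J Ls'. dsum (map2 (plain v) (take s Xs) Ls) P (\<lambda>u.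
      dsum (map2 (plain v) (drop s Xs) Ls') Q (\<lambda>w. f J (u @ a # w)))))"
    unfolding bsum_add by (intro bsum_cong) simp
  also have "\<dots> = wsum (map (pop v) (take s Xs)) zs P (\<lambda>z u. wsum (map (pop v) (drop s Xs)) z Q (\<lambda>J w. f J (u @ a # w)))"
    using assms by (simp add: wsum_pop bsum_dsum)
  finally show ?thesis by simp
qed

lemma wsum_pop_block:
  assumes "i < length Xs"
  shows "wsum (map (pop v) (take i Xs)) zs P (\<lambda>z u. usum z (\<lambda>L z. wsum (map (pop v) (drop (Suc i) Xs)) z Q (\<lambda>J w. f J (u @ h L # w)))) =
    bsum (length Xs) zs (\<lambda>J Ls. dsum (take i (map2 (plain v) Xs Ls)) P (\<lambda>u.
      dsum (drop (Suc i) (map2 (plain v) Xs Ls)) Q (\<lambda>w. f J (u @ h (Ls ! i) # w))))"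
proof -
  have "bsum (length Xs) zs (\<lambda>J Ls. dsum (take i (map2 (plain v) Xs Ls)) P (\<lambda>u.
      dsum (drop (Suc i) (map2 (plain v) Xs Ls)) Q (\<lambda>w. f J (u @ h (Ls ! i) # w)))) =
    bsum (i + Suc (length Xs - Suc i)) zs (\<lambda>J Ls. dsum (map2 (plain v) (take i Xs) (take i Ls)) P (\<lambda>u.
      dsum (map2 (plain v) (drop (Suc i) Xs) (drop (Suc i) Ls)) Q (\<lambda>w. f J (u @ h (Ls ! i) # w))))"
  proof -
    have eq: "i + Suc (length Xs - Suc i) = length Xs" using assms by simp
    show ?thesis unfolding eq by (simp add: take_map drop_map take_zip drop_zip)
  qed
  also have "\<dots> = bsum i zs (\<lambda>z Ls. usum z (\<lambda>L z. bsum (length Xs - Suc i) z (\<lambda>J Ls'. dsum (map2 (plain v) (take i Xs) Ls) P (\<lambda>u.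
      dsum (map2 (plain v) (drop (Suc i) Xs) Ls') Q (\<lambda>w. f J (u @ h L # w))))))"
    unfolding bsum_add bsum.simps by (intro bsum_cong usum_cong) (simp add: nth_append)
  also have "\<dots> = wsum (map (pop v) (take i Xs)) zs P (\<lambda>z u. usum z (\<lambda>L z. wsum (map (pop v) (drop (Suc i) Xs)) z Q (\<lambda>J w. f J (u @ h L # w))))"
    using assms by (simp add: wsum_pop bsum_dsum dsum_usum)
  finally show ?thesis by simp
qed

context symplectic_data
begin

text \<open>Up to the sign of the initial arrangement, the three kinds of expansions are sums of words
  in which each word carries the sign of its own arrangement.\<close>

theorem kos_part_full:
  assumes "distinct (N0 @ concat (map fst Xs) @ zs @ toks xs)"
    and "\<And>X. X \<in> set Xs \<Longrightarrow> of_int (fst (snd X)) = bdeg d (fst X)"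
  shows "sg (kos d (N0 @ concat (map fst Xs) @ zs @ toks xs))
     (part (\<lambda>N. weak_chains 0 N (2 * length Xs)) D (\<lambda>_. map snd Xs) (length Xs) (map (zitem d v) zs) (map (hitem d) xs)) =
   wsum (map (pop v) Xs) zs xs (\<lambda>J w. sg (kos d (N0 @ J @ toks w)) (snd D (map v J) (map snd w)))"
    (is "?l = wsum _ _ _ ?f")
proof -
  have "?l = (\<Sum>c\<in>labellings (length Xs) (length zs). \<Sum>ps\<in>weak_chains 0 (length xs) (2 * length Xs).
      ?f (tblock zs c 0) (weave 0 ps (map2 (plain v) Xs (map (tblock zs c) [1..<Suc (length Xs)])) xs))"
    unfolding part_def sg_sum length_map
    by (intro sum.cong refl brace_term_kos[OF _ _ assms]) simp_all
  also have "\<dots> = (\<Sum>c\<in>labellings (length Xs) (length zs).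
      dsum (map2 (plain v) Xs (map (tblock zs c) [1..<Suc (length Xs)])) xs (?f (tblock zs c 0)))"
    using sum_weave[of 0 xs "?f J" "map2 (plain v) Xs (map (tblock zs c) [1..<Suc (length Xs)])" for J c]
    by (intro sum.cong refl) (simp del: upt_Suc)
  finally show ?thesis
    by (simp only: sum_labellings[where f = "\<lambda>J Ls. dsum (map2 (plain v) Xs Ls) xs (?f J)"] wsum_pop)
qed

theorem kos_direct_part:
  assumes "distinct (N0 @ concat (map fst Xs) @ zs @ toks (P @ a # Q))" "s \<le> length Xs"
    and "\<And>X. X \<in> set Xs \<Longrightarrow> of_int (fst (snd X)) = bdeg d (fst X)"
  shows "sg (kos d (N0 @ concat (map fst Xs) @ zs @ toks (P @ a # Q)))
     (direct_part D (map snd Xs) s (length P) (map (zitem d v) zs) (map (hitem d) (P @ a # Q))) =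
   wsum (map (pop v) (take s Xs)) zs P (\<lambda>z u. wsum (map (pop v) (drop s Xs)) z Q (\<lambda>J w.
     sg (kos d (N0 @ J @ toks (u @ a # w))) (snd D (map v J) (map snd (u @ a # w)))))"
    (is "?l = wsum _ _ _ (\<lambda>z u. wsum _ _ _ (\<lambda>J w. ?f J (u @ a # w)))")
proof -
  let ?xs = "P @ a # Q"
  have gap: "{ps \<in> weak_chains 0 N (2 * m). I_lo ps s \<le> p \<and> p < I_hi N ps s} = {ps. ps \<in> weak_chains 0 N (2 * m) \<and> in_gap 0 N s p ps}" for N m p
    by (auto simp: in_gap_def I_lo_def I_hi_def K_lo_def K_hi_def)
  have "?l = (\<Sum>c\<in>labellings (length Xs) (length zs). \<Sum>ps | ps \<in> weak_chains 0 (length ?xs) (2 * length Xs) \<and> in_gap 0 (length ?xs) s (length P) ps.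
      ?f (tblock zs c 0) (weave 0 ps (map2 (plain v) Xs (map (tblock zs c) [1..<Suc (length Xs)])) ?xs))"
    unfolding direct_part_def sg_sum length_map gap
    by (intro sum.cong refl brace_term_kos[OF _ _ assms(1,3)]) simp_all
  also have "\<dots> = (\<Sum>c\<in>labellings (length Xs) (length zs).
      dsum (take s (map2 (plain v) Xs (map (tblock zs c) [1..<Suc (length Xs)]))) P (\<lambda>u.
      dsum (drop s (map2 (plain v) Xs (map (tblock zs c) [1..<Suc (length Xs)]))) Q (\<lambda>w. ?f (tblock zs c 0) (u @ a # w))))"
  proof (intro sum.cong refl)
    fix c
    show "(\<Sum>ps | ps \<in> weak_chains 0 (length ?xs) (2 * length Xs) \<and> in_gap 0 (length ?xs) s (length P) ps.
      ?f (tblock zs c 0) (weave 0 ps (map2 (plain v) Xs (map (tblock zs c) [1..<Suc (length Xs)])) ?xs)) =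
      dsum (take s (map2 (plain v) Xs (map (tblock zs c) [1..<Suc (length Xs)]))) P (\<lambda>u.
      dsum (drop s (map2 (plain v) Xs (map (tblock zs c) [1..<Suc (length Xs)]))) Q (\<lambda>w. ?f (tblock zs c 0) (u @ a # w)))"
      using sum_weave_gap[of 0 "length P" ?xs s "map2 (plain v) Xs (map (tblock zs c) [1..<Suc (length Xs)])" "?f (tblock zs c 0)"] assms(2)
      by (simp add: slice_def del: upt_Suc)
  qed
  finally show ?thesis
    by (simp only: wsum_pop_gap[OF assms(2), where f = ?f]
        sum_labellings[where f = "\<lambda>J Ls. dsum (take s (map2 (plain v) Xs Ls)) P (\<lambda>u.
          dsum (drop s (map2 (plain v) Xs Ls)) Q (\<lambda>w. ?f J (u @ a # w)))"])
qed

text \<open>The tokens of the distinguished operation are those of \<open>E\<close> and of the \<open>F\<close>'s inside it, so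
  that its entry in \<open>Xs\<close> matters only through its tokens and its degree.\<close>

theorem kos_nested_part:
  assumes "distinct (N0 @ concat (map fst Xs) @ zs @ toks (P @ a # Q))" "i < length Xs"
    and "\<And>X. X \<in> set Xs \<Longrightarrow> of_int (fst (snd X)) = bdeg d (fst X)"
    and "fst (snd (Xs ! i)) = fst E + tdeg Fs"
    and "Es = (map snd Xs)[i := E]"
  shows "sg (kos d (N0 @ concat (map fst Xs) @ zs @ toks (P @ a # Q)))
     (nested_part S D Es (Suc i) Fs j (length P) (map (zitem d v) zs) (map (hitem d) (P @ a # Q))) =
   csum P (\<lambda>P1 P2. csum Q (\<lambda>Q1 Q2. wsum (map (pop v) (take i Xs)) zs P1 (\<lambda>z u. usum z (\<lambda>L z.
     wsum (map (pop v) (drop (Suc i) Xs)) z Q2 (\<lambda>J w.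
       (\<lambda>w. sg (kos d (N0 @ J @ toks w)) (snd D (map v J) (map snd w)))
         (u @ plain v (fst (Xs ! i), direct_brace S E Fs j (length P2)) L (P2 @ a # Q1) # w))))))"
    (is "?l = csum P (\<lambda>P1 P2. csum Q (\<lambda>Q1 Q2. wsum _ _ _ (\<lambda>z u. usum z (\<lambda>L z. wsum _ _ _ (\<lambda>J w. _ (u @ ?h (length P2) L (P2 @ a # Q1) # w))))))")
proof -
  let ?xs = "P @ a # Q" and ?m = "length Xs" and ?p = "length P"
  let ?f = "\<lambda>J w. sg (kos d (N0 @ J @ toks w)) (snd D (map v J) (map snd w))"
  let ?Ls = "\<lambda>c. map (tblock zs c) [1..<Suc (length Xs)]"
  let ?gs = "\<lambda>c. map2 (plain v) Xs (?Ls c)"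
  \<comment> \<open>The distinguished operation depends on the chain, through the start of its block.\<close>
  define Y where "Y ps = Xs[i := (fst (Xs ! i), direct_brace S E Fs j (?p - ps ! (2 * i)))]" for ps
  have Yfst: "map fst (Y ps) = map fst Xs" for ps
    by (simp add: Y_def map_update) (metis list_update_id map_update)
  have Ysnd: "map snd (Y ps) = Es[Suc i - 1 := direct_brace S (Es ! (Suc i - 1)) Fs j (?p - K_lo ps (Suc i))]" for ps
    using assms(2) by (simp add: Y_def map_update assms(5) K_lo_def)
  have Ylen: "length (Y ps) = ?m" for ps by (simp add: Y_def)
  have Ydeg: "of_int (fst (snd X)) = bdeg d (fst X)" if "X \<in> set (Y ps)" for X ps
  proof -
    have "X \<in> set Xs \<or> X = (fst (Xs ! i), direct_brace S E Fs j (?p - ps ! (2 * i)))"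
      using that set_update_subset_insert unfolding Y_def by fastforce
    then show ?thesis
    proof
      assume "X = (fst (Xs ! i), direct_brace S E Fs j (?p - ps ! (2 * i)))"
      then have "fst (snd X) = fst (snd (Xs ! i))" "fst X = fst (Xs ! i)"
        using assms(4) by (simp_all add: direct_brace_def)
      then show ?thesis using assms(3)[of "Xs ! i"] assms(2) by simp
    qed (rule assms(3))
  qed
  have gsY: "map2 (plain v) (Y ps) (?Ls c) = (?gs c)[i := ?h (?p - ps ! (2 * i)) (?Ls c ! i)]" for ps c
    using assms(2) unfolding Y_def by (intro nth_equalityI) (simp_all add: nth_list_update del: upt_Suc)
  have len: "length Es = ?m" by (simp add: assms(5))
  have blk: "{ps \<in> weak_chains 0 N k. K_lo ps (Suc i) \<le> p \<and> p < K_hi ps (Suc i)} = {ps. ps \<in> weak_chains 0 N k \<and> in_block i p ps}" for N k p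
    by (auto simp: in_block_def K_lo_def K_hi_def)
  have "?l = (\<Sum>c\<in>labellings ?m (length zs). \<Sum>ps | ps \<in> weak_chains 0 (length ?xs) (2 * ?m) \<and> in_block i ?p ps.
      ?f (tblock zs c 0) (weave 0 ps ((?gs c)[i := ?h (?p - ps ! (2 * i)) (?Ls c ! i)]) ?xs))"
    unfolding nested_part_def sg_sum length_map len blk
  proof (intro sum.cong refl)
    fix c ps assume c: "c \<in> labellings ?m (length zs)"
      and ps: "ps \<in> {ps. ps \<in> weak_chains 0 (length ?xs) (2 * ?m) \<and> in_block i ?p ps}"
    show "sg (kos d (N0 @ toks Xs @ zs @ toks ?xs))
        (brace_term D (Es[Suc i - 1 := direct_brace S (Es ! (Suc i - 1)) Fs j (?p - K_lo ps (Suc i))]) (map (zitem d v) zs) (map (hitem d) ?xs) c ps) =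
       ?f (tblock zs c 0) (weave 0 ps ((?gs c)[i := ?h (?p - ps ! (2 * i)) (?Ls c ! i)]) ?xs)"
      using brace_term_kos[of c "Y ps" zs ps ?xs N0 d _ v "tblock zs c 0" D] c ps Ydeg assms(1)
      unfolding Ylen Yfst Ysnd gsY by blast
  qed
  also have "\<dots> = (\<Sum>c\<in>labellings ?m (length zs). csum P (\<lambda>P1 P2. csum Q (\<lambda>Q1 Q2.
      dsum (take i (?gs c)) P1 (\<lambda>u. dsum (drop (Suc i) (?gs c)) Q2 (\<lambda>w. ?f (tblock zs c 0) (u @ ?h (length P2) (?Ls c ! i) (P2 @ a # Q1) # w))))))"
  proof (intro sum.cong refl)
    fix c
    have "length (?gs c) = ?m" by (simp del: upt_Suc)
    then show "(\<Sum>ps | ps \<in> weak_chains 0 (length ?xs) (2 * ?m) \<and> in_block i ?p ps.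
        ?f (tblock zs c 0) (weave 0 ps ((?gs c)[i := ?h (?p - ps ! (2 * i)) (?Ls c ! i)]) ?xs)) =
      csum P (\<lambda>P1 P2. csum Q (\<lambda>Q1 Q2.
        dsum (take i (?gs c)) P1 (\<lambda>u. dsum (drop (Suc i) (?gs c)) Q2 (\<lambda>w. ?f (tblock zs c 0) (u @ ?h (length P2) (?Ls c ! i) (P2 @ a # Q1) # w)))))"
      using sum_weave_block[of 0 ?p ?xs i "?gs c" "?f (tblock zs c 0)" "\<lambda>n. ?h n (?Ls c ! i)"] assms(2)
      by (simp add: slice_def del: upt_Suc)
  qed
  also have "\<dots> = csum P (\<lambda>P1 P2. csum Q (\<lambda>Q1 Q2. bsum ?m zs (\<lambda>J Ls.
      dsum (take i (map2 (plain v) Xs Ls)) P1 (\<lambda>u. dsum (drop (Suc i) (map2 (plain v) Xs Ls)) Q2 (\<lambda>w. ?f J (u @ ?h (length P2) (Ls ! i) (P2 @ a # Q1) # w))))))"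
    unfolding csum_sum[symmetric]
    by (simp only: sum_labellings[where f = "\<lambda>J Ls. dsum (take i (map2 (plain v) Xs Ls)) _ (\<lambda>u.
          dsum (drop (Suc i) (map2 (plain v) Xs Ls)) _ (\<lambda>w. ?f J (u @ ?h _ (Ls ! i) _ # w)))"])
  finally show ?thesis
    by (simp only: wsum_pop_block[OF assms(2), where f = ?f])
qed

end

lemma in_concat_singletons:
  "y \<in> set (concat (map (\<lambda>(J, w). [h J w]) ws)) \<Longrightarrow> \<exists>p\<in>set ws. y = h (fst p) (snd p)"
  by (induction ws) auto

section \<open>Woven operations with tokens\<close>

lemma words_ConsE:
  assumes "(J, w) \<in> set (words (g # gs) zs xs)"
  obtains L z u k r y w' where "mset L + mset z = mset zs" "xs = u @ k @ r" "y \<in> set (g L k)"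
    "(J, w') \<in> set (words gs z r)" "w = u @ y # w'"
proof -
  have "\<exists>L z u r k r' y w'. (L, z) \<in> set (unshuffles zs) \<and> (u, r) \<in> set (cuts xs) \<and> (k, r') \<in> set (cuts r) \<and>
      y \<in> set (g L k) \<and> (J, w') \<in> set (words gs z r') \<and> w = u @ y # w'"
    using assms by clarsimp blast
  then obtain L z u r k r' y w' where "(L, z) \<in> set (unshuffles zs)" "(u, r) \<in> set (cuts xs)" "(k, r') \<in> set (cuts r)"
      "y \<in> set (g L k)" "(J, w') \<in> set (words gs z r')" "w = u @ y # w'"
    by blast
  then show ?thesis
    using that[of L z u k r' y w'] in_cuts[of u r xs] in_cuts[of k r' r] in_unshuffles[of L z zs] by simp
qed

lemma words_z_subset: "(J, w) \<in> set (words gs zs xs) \<Longrightarrow> mset J \<subseteq># mset zs"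
proof (induction gs arbitrary: zs xs w)
  case (Cons g gs)
  then obtain L z r w' where "mset L + mset z = mset zs" "(J, w') \<in> set (words gs z r)"
    by (elim words_ConsE) blast
  then show ?case using Cons.IH by (metis mset_subset_eq_add_right subset_mset.order_trans)
qed simp

lemma mset_words_pop:
  "(J, w) \<in> set (words (map (pop v) Xs) zs xs) \<Longrightarrow>
   mset J + mset (toks w) = mset (concat (map fst Xs)) + mset zs + mset (toks xs)"
proof (induction Xs arbitrary: zs xs w)
  case (Cons X Xs)
  then have "(J, w) \<in> set (words (pop v X # map (pop v) Xs) zs xs)" by simp
  then obtain L z u k r y w' where *: "mset L + mset z = mset zs" "xs = u @ k @ r" "y \<in> set (pop v X L k)"
    "(J, w') \<in> set (words (map (pop v) Xs) z r)" "w = u @ y # w'"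
    by (rule words_ConsE)
  with Cons.IH[OF *(4)] show ?case
    by (simp add: pop_def plain_def ac_simps flip: *(1))
qed simp

lemma sublist_mset_distinct:
  assumes "mset L \<subseteq># mset zs"
  shows "(distinct zs \<longrightarrow> distinct L) \<and> set L \<subseteq> set zs"
proof -
  obtain M where "mset zs = mset L + M" using assms by (auto simp: subset_mset.le_iff_add)
  moreover obtain m where "mset m = M" using ex_mset by blast
  ultimately have "mset zs = mset (L @ m)" by simp
  from mset_eq_imp_distinct_iff[OF this] mset_eq_setD[OF this]
  have "distinct zs = distinct (L @ m)" "set zs = set (L @ m)"
    by blast+
  then show ?thesis by simp
qed

lemma weave_all:
  "\<forall>x\<in>set xs. P x \<Longrightarrow> \<forall>g\<in>set gs. \<forall>i j. P (g (slice xs i j)) \<Longrightarrow> \<forall>x\<in>set (weave lo ps gs xs). P x"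
  by (induction lo ps gs xs rule: weave.induct) (auto simp: slice_def; meson in_set_takeD in_set_dropD)+

lemma mset_concat_weave:
  assumes "ps \<in> weak_chains lo (length xs) (2 * length hs)" "lo \<le> length xs"
  shows "mset (concat (weave lo ps (map (\<lambda>h k. h @ concat k) hs) xs)) = mset (concat hs) + mset (concat (drop lo xs))"
  using assms
proof (induction hs arbitrary: lo ps)
  case (Cons h hs)
  then obtain i j ps' where ps: "ps = i # j # ps'"
    by (cases ps; cases "tl ps") (auto simp: weak_chains_def)
  have ij: "lo \<le> i" "i \<le> j" "j \<le> length xs" and ps': "ps' \<in> weak_chains j (length xs) (2 * length hs)"
    using Cons.prems ps by (auto simp: weak_chains_def)
  have "drop lo xs = slice xs lo i @ slice xs i j @ drop j xs"
    using slice_split[of lo i "length xs" xs] slice_split[of i j "length xs" xs] ij by simp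
  then show ?case using Cons.IH[OF ps' ij(3)] by (simp add: ps ac_simps)
qed simp

lemma bit_move: "(x::bit) + a = y + b \<Longrightarrow> x = y + (a + b)"
  by (cases x; cases a; cases y; cases b; simp add: add_bit_eq_xor)

lemma kos_weave_within:
  assumes "distinct (pre @ concat hs @ concat (drop lo xs))" "ps \<in> weak_chains lo (length xs) (2 * length hs)"
    "lo \<le> length xs"
  shows "kos d (pre @ concat (weave lo ps (map (\<lambda>h k. h @ concat k) hs) xs) @ post) =
     kos d (pre @ concat hs @ concat (drop lo xs) @ post)
     + (\<Sum>k<length hs. bdeg d (hs ! k) * bdeg d (concat (slice xs lo (ps ! (2 * k)))))"
proof -
  let ?A = "concat (weave lo ps (map (\<lambda>h k. h @ concat k) hs) xs)" and ?B = "concat hs @ concat (drop lo xs)"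
  have m: "mset ?A = mset ?B" using mset_concat_weave[OF assms(2,3)] by simp
  have "kos d (pre @ ?A @ post) + kos d (pre @ ?A) = kos d (pre @ ?B @ post) + kos d (pre @ ?B)"
    using kos_replace[OF m, of d pre post] kos_replace[OF m, of d pre "[]"] by (simp add: ac_simps)
  then have "kos d (pre @ ?A @ post) = kos d (pre @ ?B @ post) + (kos d (pre @ ?A) + kos d (pre @ ?B))"
    by (rule bit_move)
  then show ?thesis using kos_weave[OF assms, of d] by (simp add: ac_simps)
qed

context symplectic_data
begin

text \<open>Tokens with the right degrees for operations, for \<open>Z\<close>-inputs and for items.\<close>

definition tok :: "(nat \<Rightarrow> int) \<Rightarrow> nat list \<times> ('z, 'a) hcochain \<Rightarrow> bool" where
  "tok d X \<longleftrightarrow> good (snd X) \<and> fst (snd X) = (\<Sum>t\<leftarrow>fst X. d t)"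

definition zok :: "(nat \<Rightarrow> int) \<Rightarrow> (nat \<Rightarrow> 'z) \<Rightarrow> nat list \<Rightarrow> bool" where
  "zok d v zs \<longleftrightarrow> (\<forall>t\<in>set zs. v t \<in> zgr S (d t) \<and> v t \<noteq> 0)"

definition aok :: "(nat \<Rightarrow> int) \<Rightarrow> (nat list \<times> 'a) list \<Rightarrow> bool" where
  "aok d xs \<longleftrightarrow> (\<forall>x\<in>set xs. snd x \<in> agr S (\<Sum>t\<leftarrow>fst x. d t))"

lemma aok_simps [simp]:
  "aok d []" "aok d (x # xs) \<longleftrightarrow> snd x \<in> agr S (\<Sum>t\<leftarrow>fst x. d t) \<and> aok d xs" "aok d (xs @ ys) \<longleftrightarrow> aok d xs \<and> aok d ys"
  by (auto simp: aok_def)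

lemma aok_homs: "A.homs (map (hitem d) xs) \<longleftrightarrow> aok d xs"
  by (auto simp: A.homs_def aok_def hitem_def)

lemma zok_homs: "zok d v zs \<Longrightarrow> Z.homs (map (zitem d v) zs) \<and> 0 \<notin> snd ` set (map (zitem d v) zs)"
  by (auto simp: Z.homs_def zok_def zitem_def)

lemma zok_subset: "zok d v zs \<Longrightarrow> mset L \<subseteq># mset zs \<Longrightarrow> zok d v L"
  unfolding zok_def by (meson mset_subset_eqD in_multiset_in_set)

lemma tok_bdeg: "tok d X \<Longrightarrow> of_int (fst (snd X)) = bdeg d (fst X)"
  by (simp add: tok_def bdeg_sum_list)

lemma snd_items [simp]: "map snd (map (zitem d v) zs) = map v zs" "map snd (map (hitem d) xs) = map snd xs"
  by (simp_all add: zitem_def hitem_def)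

lemma plain_aok:
  assumes "tok d X" "zok d v L" "aok d k"
  shows "snd (plain v X L k) \<in> agr S (\<Sum>t\<leftarrow>fst (plain v X L k). d t)"
proof -
  have "tdeg (map (zitem d v) L) = (\<Sum>t\<leftarrow>L. d t)" by (simp add: tdeg_def zitem_def o_def)
  moreover have "tdeg (map (hitem d) k) = (\<Sum>t\<leftarrow>toks k. d t)"
    by (induction k) (simp_all add: hitem_def)
  ultimately show ?thesis
    using good_value[of "snd X" "map (zitem d v) L" "map (hitem d) k"] assms zok_homs[OF assms(2)]
    by (simp add: plain_def tok_def aok_homs add.assoc del: map_map)
qed

lemma words_pop_aok:
  "(J, w) \<in> set (words (map (pop v) Xs) zs xs) \<Longrightarrow> \<forall>X\<in>set Xs. tok d X \<Longrightarrow> zok d v zs \<Longrightarrow> aok d xs \<Longrightarrow> aok d w"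
proof (induction Xs arbitrary: zs xs w)
  case (Cons X Xs)
  then have "(J, w) \<in> set (words (pop v X # map (pop v) Xs) zs xs)" by simp
  then obtain L z u k r y w' where *: "mset L + mset z = mset zs" "xs = u @ k @ r" "y \<in> set (pop v X L k)"
    "(J, w') \<in> set (words (map (pop v) Xs) z r)" "w = u @ y # w'"
    by (rule words_ConsE)
  have "mset L \<subseteq># mset zs" "mset z \<subseteq># mset zs" by (simp_all flip: *(1))
  then have "zok d v L" "zok d v z" using zok_subset Cons.prems by blast+
  then show ?case
    using Cons.IH[OF *(4)] Cons.prems * plain_aok[of d X v L k] by (simp add: pop_def)
qed simp

lemma kos_brace:
  assumes "distinct (N0 @ concat (map fst Xs) @ zs @ toks xs)" "good D" "\<forall>X\<in>set Xs. tok d X" "zok d v zs" "aok d xs"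
  shows "sg (kos d (N0 @ concat (map fst Xs) @ zs @ toks xs)) (snd (brace S D (map snd Xs)) (map v zs) (map snd xs)) =
   wsum (map (pop v) Xs) zs xs (\<lambda>J w. sg (kos d (N0 @ J @ toks w)) (snd D (map v J) (map snd w)))"
proof -
  have "\<forall>E\<in>set (map snd Xs). good E" using assms(3) by (auto simp: tok_def)
  from part_op_homs[OF part_data_brace[OF assms(2) this], of "map (zitem d v) zs" "map (hitem d) xs"]
  have "snd (brace S D (map snd Xs)) (map v zs) (map snd xs) =
      part (\<lambda>N. weak_chains 0 N (2 * length Xs)) D (\<lambda>_. map snd Xs) (length Xs) (map (zitem d v) zs) (map (hitem d) xs)"
    using zok_homs[OF assms(4)] assms(5) by (simp add: brace_eq_part_op aok_homs del: map_map)
  then show ?thesis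
    using kos_part_full[OF assms(1), of d D v] assms(3) by (simp add: tok_bdeg)
qed

lemma kos_direct_brace:
  assumes "distinct (N0 @ concat (map fst Xs) @ zs @ toks (P @ a # Q))" "good D" "\<forall>X\<in>set Xs. tok d X" "zok d v zs"
    "aok d (P @ a # Q)" "s \<le> length Xs"
  shows "sg (kos d (N0 @ concat (map fst Xs) @ zs @ toks (P @ a # Q)))
     (snd (direct_brace S D (map snd Xs) s (length P)) (map v zs) (map snd (P @ a # Q))) =
   wsum (map (pop v) (take s Xs)) zs P (\<lambda>z u. wsum (map (pop v) (drop s Xs)) z Q (\<lambda>J w.
     sg (kos d (N0 @ J @ toks (u @ a # w))) (snd D (map v J) (map snd (u @ a # w)))))"
proof -
  have "\<forall>E\<in>set (map snd Xs). good E" using assms(3) by (auto simp: tok_def)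
  from part_op_homs[OF part_data_direct[OF assms(2) this], of "map (zitem d v) zs" "map (hitem d) (P @ a # Q)" s "length P"]
  have "snd (direct_brace S D (map snd Xs) s (length P)) (map v zs) (map snd (P @ a # Q)) =
      direct_part D (map snd Xs) s (length P) (map (zitem d v) zs) (map (hitem d) (P @ a # Q))"
    unfolding direct_brace_eq_part_op direct_part_eq_part snd_items
    using zok_homs[OF assms(4)] assms(5) unfolding aok_homs by simp
  then show ?thesis
    using kos_direct_part[OF assms(1,6), of d D v] assms(3) tok_bdeg by simp
qed

text \<open>A brace, evaluated as a cochain, is equivalent to the formal sum of its terms.\<close>

lemma keq_brace:
  assumes "tok d E" "\<forall>X\<in>set Xs. tok d X" "distinct ((fst E @ concat (map fst Xs)) @ L @ toks k)" "zok d v L" "aok d k"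
  shows "keq d (pop v (fst E @ concat (map fst Xs), brace S (snd E) (map snd Xs)) L k) (graft (pop v E) (map (pop v) Xs) L k)"
  unfolding keq_def
proof
  have "mset (fst y) = mset (fst E) + mset (concat (map fst Xs)) + mset L + mset (toks k)"
    if y: "y \<in> set (graft (pop v E) (map (pop v) Xs) L k)" for y
  proof -
    obtain p where "p \<in> set (words (map (pop v) Xs) L k)" "y = plain v E (fst p) (snd p)"
      using in_concat_singletons[of y "plain v E"] y unfolding graft_def pop_def[of v E] by blast
    then show ?thesis using mset_words_pop[of "fst p" "snd p" v Xs L k] by (simp add: plain_def add.assoc)
  qed
  then show "\<exists>T. \<forall>y\<in>set (pop v (fst E @ concat (map fst Xs), brace S (snd E) (map snd Xs)) L k) \<union>
      set (graft (pop v E) (map (pop v) Xs) L k). mset (fst y) = T"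
    by (intro exI[of _ "mset (fst E) + mset (concat (map fst Xs)) + mset L + mset (toks k)"])
      (auto simp: pop_def plain_def)
  show "lsum (pop v (fst E @ concat (map fst Xs), brace S (snd E) (map snd Xs)) L k) (\<lambda>y. sg (kos d (fst y)) (snd y)) =
      lsum (graft (pop v E) (map (pop v) Xs) L k) (\<lambda>y. sg (kos d (fst y)) (snd y))"
    using kos_brace[of "fst E" Xs L k "snd E" d v] assms
    by (simp add: lsum_graft pop_def plain_def tok_def)
qed

lemma keq_direct_brace:
  assumes "tok d E" "\<forall>X\<in>set Xs. tok d X" "distinct ((fst E @ concat (map fst Xs)) @ L @ toks (P @ a # Q))" "zok d v L" "aok d (P @ a # Q)"
  shows "keq d [plain v (fst E @ concat (map fst Xs), direct_brace S (snd E) (map snd Xs) (length Xs) (length P)) L (P @ a # Q)]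
    (concat (map (\<lambda>(L, u). pop v E L (u @ a # Q)) (words (map (pop v) Xs) L P)))"
  unfolding keq_def
proof
  let ?ys = "concat (map (\<lambda>(L, u). pop v E L (u @ a # Q)) (words (map (pop v) Xs) L P))"
  have "mset (fst y) = mset (fst E) + mset (concat (map fst Xs)) + mset L + mset (toks (P @ a # Q))"
    if y: "y \<in> set ?ys" for y
  proof -
    obtain p where "p \<in> set (words (map (pop v) Xs) L P)" "y = plain v E (fst p) (snd p @ a # Q)"
      using in_concat_singletons[of y "\<lambda>J w. plain v E J (w @ a # Q)"] y unfolding pop_def[of v E] by blast
    then show ?thesis using mset_words_pop[of "fst p" "snd p" v Xs L P] by (simp add: plain_def add.assoc)
  qed
  then show "\<exists>T. \<forall>y\<in>set [plain v (fst E @ concat (map fst Xs), direct_brace S (snd E) (map snd Xs) (length Xs) (length P)) L (P @ a # Q)] \<union>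
      set ?ys. mset (fst y) = T"
    by (intro exI[of _ "mset (fst E) + mset (concat (map fst Xs)) + mset L + mset (toks (P @ a # Q))"])
      (auto simp: plain_def)
  show "lsum [plain v (fst E @ concat (map fst Xs), direct_brace S (snd E) (map snd Xs) (length Xs) (length P)) L (P @ a # Q)] (\<lambda>y. sg (kos d (fst y)) (snd y)) =
      lsum ?ys (\<lambda>y. sg (kos d (fst y)) (snd y))"
    using kos_direct_brace[of "fst E" Xs L P a Q "snd E" d v "length Xs"] assms
    by (simp add: wsum_def pop_def plain_def tok_def split_def)
qed

type_synonym (in -) ('z, 'a) node = "(nat list \<times> ('z, 'a) hcochain) \<times> (nat, nat list \<times> 'a) oper"

definition leaf :: "(nat \<Rightarrow> 'z) \<Rightarrow> nat list \<times> ('z, 'a) hcochain \<Rightarrow> ('z, 'a) node" where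
  "leaf v X = (X, pop v X)"

definition branch :: "(nat \<Rightarrow> 'z) \<Rightarrow> nat list \<times> ('z, 'a) hcochain \<Rightarrow> ('z, 'a) node list \<Rightarrow> ('z, 'a) node" where
  "branch v E B = ((fst E @ concat (map (fst \<circ> fst) B), brace S (snd E) (map (snd \<circ> fst) B)),
     graft (pop v E) (map snd B))"

text \<open>The cochain and the formal operation of a node describe the same operation.\<close>

definition sound :: "(nat \<Rightarrow> int) \<Rightarrow> (nat \<Rightarrow> 'z) \<Rightarrow> ('z, 'a) node \<Rightarrow> bool" where
  "sound d v x \<longleftrightarrow> tok d (fst x) \<and> (\<forall>L k. distinct (fst (fst x) @ L @ toks k) \<longrightarrow> zok d v L \<longrightarrow> aok d k \<longrightarrow>
     keq d (pop v (fst x) L k) (snd x L k))"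

lemma sound_leaf: "tok d X \<Longrightarrow> sound d v (leaf v X)"
  by (auto simp: sound_def leaf_def keq_def pop_def)

lemma sound_branch:
  assumes "tok d E" "\<forall>X\<in>set Xs. tok d X"
  shows "sound d v (branch v E (map (leaf v) Xs))"
proof -
  have b: "branch v E (map (leaf v) Xs) = ((fst E @ concat (map fst Xs), brace S (snd E) (map snd Xs)), graft (pop v E) (map (pop v) Xs))"
    by (simp add: branch_def leaf_def o_def)
  have "(\<Sum>t\<leftarrow>concat (map fst Xs). d t) = tdeg (map snd Xs)"
    using assms(2) by (induction Xs) (simp_all add: tok_def)
  moreover have "good (brace S (snd E) (map snd Xs))"
    using assms by (intro good_brace) (auto simp: tok_def)
  moreover have "fst (brace S (snd E) (map snd Xs)) = fst (snd E) + tdeg (map snd Xs)"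
    by (simp add: brace_def)
  ultimately show ?thesis
    unfolding sound_def b using keq_brace[OF assms] assms(1) by (simp add: tok_def)
qed

definition weaving :: "(nat \<Rightarrow> 'z) \<Rightarrow> nat \<Rightarrow> nat list \<Rightarrow> (nat list \<times> ('z, 'a) hcochain) list \<Rightarrow>
    (nat list \<times> ('z, 'a) hcochain) list \<Rightarrow> ('z, 'a) node list" where
  "weaving v lo ps XE XF = weave lo ps (map (branch v) XE) (map (leaf v) XF)"

lemma weaving_tokens: "map (fst \<circ> fst) (weaving v lo ps XE XF) = weave lo ps (map (\<lambda>h k. h @ concat k) (map fst XE)) (map fst XF)"
proof -
  have "map (fst \<circ> fst) (weaving v lo ps XE XF) = weave lo ps (map (\<lambda>h k. h @ concat k) (map fst XE)) (map (fst \<circ> fst) (map (leaf v) XF))"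
    unfolding weaving_def by (rule weave_map) (simp add: list_all2_conv_all_nth branch_def)
  then show ?thesis by (simp add: leaf_def o_def)
qed

lemma weaving_cochains: "map (snd \<circ> fst) (weaving v lo ps XE XF) = weave lo ps (map (brace S) (map snd XE)) (map snd XF)"
proof -
  have "map (snd \<circ> fst) (weaving v lo ps XE XF) = weave lo ps (map (brace S) (map snd XE)) (map (snd \<circ> fst) (map (leaf v) XF))"
    unfolding weaving_def by (rule weave_map) (simp add: list_all2_conv_all_nth branch_def)
  then show ?thesis by (simp add: leaf_def o_def)
qed

lemma sound_weaving:
  assumes "\<forall>X\<in>set XE. tok d X" "\<forall>X\<in>set XF. tok d X"
  shows "\<forall>x\<in>set (weaving v lo ps XE XF). sound d v x"
  unfolding weaving_def
proof (rule weave_all)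
  show "\<forall>x\<in>set (map (leaf v) XF). sound d v x" using assms sound_leaf by auto
  show "\<forall>g\<in>set (map (branch v) XE). \<forall>i j. sound d v (g (slice (map (leaf v) XF) i j))"
  proof (intro ballI allI)
    fix g i j assume "g \<in> set (map (branch v) XE)"
    moreover have "\<forall>X\<in>set (slice XF i j). tok d X"
      using assms(2) by (auto simp: slice_def dest: in_set_takeD in_set_dropD)
    ultimately show "sound d v (g (slice (map (leaf v) XF) i j))"
      using assms(1) sound_branch by (auto simp: slice_map)
  qed
qed

text \<open>Summing over the chains of a weaving produces the weavings of the formal operations that appear in the word
  identities.\<close>

lemma sum_weaving:
  assumes "lo \<le> length XF"
  shows "(\<Sum>ps\<in>weak_chains lo (length XF) (2 * length XE). f (map snd (weaving v lo ps XE XF))) =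
    dsum (map graft (map (pop v) XE)) (map (pop v) (drop lo XF)) f"
proof -
  have "(\<Sum>ps\<in>weak_chains lo (length XF) (2 * length XE). f (map snd (weaving v lo ps XE XF))) =
     dsum (map (branch v) XE) (drop lo (map (leaf v) XF)) (\<lambda>w. f (map snd w))"
    unfolding weaving_def
    using sum_weave[of lo "map (leaf v) XF" "\<lambda>w. f (map snd w)" "map (branch v) XE"] assms by simp
  also have "\<dots> = dsum (map graft (map (pop v) XE)) (map snd (drop lo (map (leaf v) XF))) f"
    by (rule dsum_map[symmetric]) (simp add: list_all2_conv_all_nth branch_def)
  finally show ?thesis by (simp add: drop_map o_def leaf_def)
qed

lemma wsum_sound:
  assumes "\<forall>x\<in>set W. sound d v x" "distinct (concat (map (fst \<circ> fst) W) @ zs @ toks xs)" "zok d v zs" "aok d xs"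
    and "\<And>J. klin d (f J)"
  shows "wsum (map (pop v) (map fst W)) zs xs f = wsum (map snd W) zs xs f"
proof (rule wsum_keq[OF _ assms(5)])
  show "list_all2 (\<lambda>g g'. \<forall>L k. mset L \<subseteq># mset zs \<longrightarrow> (\<exists>u v. xs = u @ k @ v) \<longrightarrow> keq d (g L k) (g' L k))
     (map (pop v) (map fst W)) (map snd W)"
    unfolding list_all2_conv_all_nth
  proof (intro conjI allI impI)
    fix i L k assume i: "i < length (map (pop v) (map fst W))" and L: "mset L \<subseteq># mset zs" and "\<exists>u v. xs = u @ k @ v"
    then obtain u u' where xs: "xs = u @ k @ u'" by blast
    have W: "W ! i \<in> set W" using i by simp
    have "distinct (fst (fst (W ! i)))" "set (fst (fst (W ! i))) \<subseteq> set (concat (map (fst \<circ> fst) W))"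
      using assms(2) W by (auto simp: distinct_concat_iff)
    moreover have "distinct L" "set L \<subseteq> set zs"
      using sublist_mset_distinct[OF L] assms(2) by auto
    ultimately have "distinct (fst (fst (W ! i)) @ L @ toks k)"
      using assms(2) unfolding xs by auto
    then show "keq d ((map (pop v) (map fst W) ! i) L k) ((map snd W ! i) L k)"
      using assms(1,3,4) W i zok_subset[OF _ L] unfolding xs by (auto simp: sound_def)
  qed simp
qed

end

lemma signed_by_0: "signed_by n 0 = 0"
  by (simp add: signed_by_def)

lemma distinct_snoc_mset:
  fixes t0 :: nat
  assumes "mset A = mset B" "distinct B" "\<forall>t\<in>set B. t < t0"
  shows "distinct (A @ [t0])"
proof -
  have "distinct A" using assms(1,2) mset_eq_imp_distinct_iff by blast
  moreover have "t0 \<notin> set A" unfolding mset_eq_setD[OF assms(1)] using assms(3) by blast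
  ultimately show ?thesis by simp
qed

lemma kos_last: "\<forall>t\<in>set A. t < t0 \<Longrightarrow> kos d (A @ [t0]) = kos d A"
  by (induction A) (auto simp: kos_append crossing_def)

lemma distinct_middle:
  "distinct (A @ B @ F @ C @ Z @ p @ k @ q) \<Longrightarrow> distinct L \<Longrightarrow> set L \<subseteq> set Z \<Longrightarrow> distinct (F @ L @ k)"
  by auto

lemma distinct_mset: "mset ts = mset ts' \<Longrightarrow> distinct ts' \<Longrightarrow> distinct ts"
  using mset_eq_imp_distinct_iff by blast

lemma bdeg_slice:
  assumes "\<forall>X\<in>set Xs. of_int (fst (snd X)) = bdeg d (fst X)" "i \<le> length Xs"
  shows "of_int (\<Sum>a = lo + 1..i. fst (map snd Xs ! (a - 1))) = bdeg d (concat (map fst (slice Xs lo i)))"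
  using assms(2)
proof (induction i)
  case 0
  then show ?case by (simp add: slice_def)
next
  case (Suc i)
  show ?case
  proof (cases "lo \<le> i")
    case True
    then have "slice Xs lo (Suc i) = slice Xs lo i @ [Xs ! i]"
      using Suc.prems by (intro slice_Suc) auto
    then show ?thesis using Suc assms(1) True by simp
  qed (simp add: slice_def)
qed

text \<open>The exponents of the two relations. Each is the Koszul sign of carrying the operations
  \<open>E\<^sub>k\<close> (and, for the second, the block \<open>F\<^sub>1, \<dots>, F\<^sub>r\<close>) from the order
  \<open>E\<^sub>1, \<dots>, E\<^sub>m, F\<^sub>1, \<dots>, F\<^sub>n\<close> to the order in which a summand names them.\<close>

abbreviation weave_exp ::
  "('z, 'a) hcochain list \<Rightarrow> ('z, 'a) hcochain list \<Rightarrow> nat \<Rightarrow> nat \<Rightarrow> nat \<Rightarrow> nat list \<Rightarrow> int" where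
  "weave_exp Es Fs m n s ps \<equiv>
     (\<Sum>k = 1..s. fst (Es ! (k - 1)) * (\<Sum>a = 1..ps ! (2 * k - 2). fst (Fs ! (a - 1))))
       + (\<Sum>k = s + 1..m. fst (Es ! (k - 1)) * (\<Sum>a = 1..n. fst (Fs ! (a - 1))))"

abbreviation rotation_exp ::
  "('z, 'a) hcochain list \<Rightarrow> ('z, 'a) hcochain list \<Rightarrow> nat \<Rightarrow> nat \<Rightarrow> nat \<Rightarrow> nat list \<Rightarrow> int" where
  "rotation_exp Es Fs m n r ps \<equiv>
     (\<Sum>k = 1..m. fst (Es ! (k - 1)) * (\<Sum>a = r + 1..ps ! (2 * k - 2). fst (Fs ! (a - 1))))
       + (\<Sum>p = 1..r. \<Sum>q = r + 1..n. fst (Fs ! (p - 1)) * fst (Fs ! (q - 1)))"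

context symplectic_data
begin

abbreviation direct_summand ::
  "('z, 'a) hcochain \<Rightarrow> ('z, 'a) hcochain list \<Rightarrow> ('z, 'a) hcochain list \<Rightarrow> nat \<Rightarrow> nat list \<Rightarrow> nat \<Rightarrow>
   (int \<times> 'z) list \<Rightarrow> (int \<times> 'a) list \<Rightarrow> 'a" where
  "direct_summand D Es Fs s ps p \<equiv>
     direct_part D (weave 0 ps (map (brace S) (take s Es)) Fs @ drop s Es)
       (length (weave 0 ps (map (brace S) (take s Es)) Fs)) p"

abbreviation nested_summand ::
  "('z, 'a) hcochain \<Rightarrow> ('z, 'a) hcochain list \<Rightarrow> ('z, 'a) hcochain list \<Rightarrow> nat \<Rightarrow> nat list \<Rightarrow> nat \<Rightarrow>
   (int \<times> 'z) list \<Rightarrow> (int \<times> 'a) list \<Rightarrow> 'a" where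
  "nested_summand D Es Fs s ps p \<equiv>
     nested_part S D (weave 0 (butlast ps) (map (brace S) (take (s - 1) Es)) (take (last ps) Fs) @ Es ! (s - 1) # drop s Es)
       (Suc (length (weave 0 (butlast ps) (map (brace S) (take (s - 1) Es)) (take (last ps) Fs))))
       (drop (last ps) Fs @ []) (length (drop (last ps) Fs)) p"

abbreviation rotated_summand ::
  "('z, 'a) hcochain \<Rightarrow> ('z, 'a) hcochain list \<Rightarrow> ('z, 'a) hcochain list \<Rightarrow> nat \<Rightarrow> nat list \<Rightarrow> nat \<Rightarrow>
   (int \<times> 'z) list \<Rightarrow> (int \<times> 'a) list \<Rightarrow> 'a" where
  "rotated_summand D Es Fs r ps p \<equiv>
     direct_part D (weave r ps (map (brace S) Es) Fs @ take r Fs) (length (weave r ps (map (brace S) Es) Fs)) p"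

text \<open>The exponents in the relations account for moving the \<open>E\<^sub>k\<close> past those \<open>F\<close>'s that end up in front of
  them.\<close>

lemma kos_weaving:
  assumes "ps \<in> weak_chains lo (length XF) (2 * length XE)" "lo \<le> length XF"
    and "distinct (pre @ concat (map fst XE) @ concat (map fst (drop lo XF)))"
    and "\<forall>X\<in>set XE. tok d X" "\<forall>X\<in>set XF. tok d X"
  shows "kos d (pre @ concat (map (fst \<circ> fst) (weaving v lo ps XE XF)) @ post) =
    kos d (pre @ concat (map fst XE) @ concat (map fst (drop lo XF)) @ post)
    + of_int (\<Sum>k = 1..length XE. fst (map snd XE ! (k - 1)) * (\<Sum>a = lo + 1..ps ! (2 * k - 2). fst (map snd XF ! (a - 1))))"
proof -
  have chain: "ps ! (2 * k) \<le> length XF" if "k < length XE" for k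
    using weak_chains_nth[OF assms(1), of "2 * k"] that by simp
  have "of_int (\<Sum>k = 1..length XE. fst (map snd XE ! (k - 1)) * (\<Sum>a = lo + 1..ps ! (2 * k - 2). fst (map snd XF ! (a - 1)))) =
     (\<Sum>k<length XE. of_int (fst (snd (XE ! k))) * of_int (\<Sum>a = lo + 1..ps ! (2 * k). fst (map snd XF ! (a - 1))))"
    unfolding One_nat_def sum.atLeast1_atMost_eq by simp
  also have "\<dots> = (\<Sum>k<length (map fst XE). bdeg d (map fst XE ! k) * bdeg d (concat (slice (map fst XF) lo (ps ! (2 * k)))))"
  proof (simp only: length_map, intro sum.cong refl)
    fix k assume k: "k \<in> {..<length XE}"
    have "of_int (fst (snd (XE ! k))) = bdeg d (fst (XE ! k))" using k assms(4) tok_bdeg by simp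
    moreover have "of_int (\<Sum>a = lo + 1..ps ! (2 * k). fst (map snd XF ! (a - 1))) = bdeg d (concat (map fst (slice XF lo (ps ! (2 * k)))))"
      using bdeg_slice[of XF d "ps ! (2 * k)" lo] assms(5) tok_bdeg chain k by blast
    ultimately show "of_int (fst (snd (XE ! k))) * of_int (\<Sum>a = lo + 1..ps ! (2 * k). fst (map snd XF ! (a - 1))) =
        bdeg d (map fst XE ! k) * bdeg d (concat (slice (map fst XF) lo (ps ! (2 * k))))"
      using k by (simp add: slice_map del: of_int_sum)
  qed
  finally show ?thesis
    using kos_weave_within[of pre "map fst XE" lo "map fst XF" ps d post] assms(1-3)
    by (simp add: weaving_tokens drop_map del: of_int_sum)
qed

lemma length_weaving: "length (weaving v lo ps XE XF) = length (weave lo ps (map (brace S) (map snd XE)) (map snd XF))"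
  using weaving_cochains[of v lo ps XE XF, THEN arg_cong[of _ _ length]] by (simp only: length_map)

lemma mset_weaving:
  assumes "ps \<in> weak_chains lo (length XF) (2 * length XE)" "lo \<le> length XF"
  shows "mset (concat (map (fst \<circ> fst) (weaving v lo ps XE XF))) = mset (concat (map fst XE)) + mset (concat (map fst (drop lo XF)))"
  using mset_concat_weave[of ps lo "map fst XF" "map fst XE"] assms by (simp add: weaving_tokens drop_map)

end

section \<open>The relations for homogeneous inputs\<close>

locale koszul_setup = symplectic_data S
  for S :: "('k::field, 'z::ab_group_add, 'a::ab_group_add) cyclic_data" +
  fixes d :: "nat \<Rightarrow> int" and v :: "nat \<Rightarrow> 'z" and ND :: "nat list" and D :: "('z, 'a) hcochain"
    and XE XF :: "(nat list \<times> ('z, 'a) hcochain) list" and zs :: "nat list" and xs :: "(nat list \<times> 'a) list"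
  assumes dist: "distinct (ND @ concat (map fst XE) @ concat (map fst XF) @ zs @ toks xs)"
    and good_D: "good D" and tok_E: "\<forall>X\<in>set XE. tok d X" and tok_F: "\<forall>X\<in>set XF. tok d X"
    and zok: "zok d v zs" and aok: "aok d xs"
begin

abbreviation "Es \<equiv> map snd XE"
abbreviation "Fs \<equiv> map snd XF"
abbreviation "NE \<equiv> concat (map fst XE)"
abbreviation "NF \<equiv> concat (map fst XF)"
abbreviation "hz \<equiv> map (zitem d v) zs"

definition total :: bit where "total = kos d (ND @ NE @ NF @ zs @ toks xs)"

definition val :: "nat list \<Rightarrow> (nat list \<times> 'a) list \<Rightarrow> 'a" where
  "val J w = sg (kos d (ND @ J @ toks w)) (snd D (map v J) (map snd w))"

lemma additive_D: "entrywise_additive (snd D (map v J))"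
  using good_D by (auto simp: entrywise_additive_def good_def alin_def Vector_Spaces.linear_iff)

lemma klin_val: "klin d (\<lambda>w. val J (a @ w @ b))"
  using klin_kos[OF additive_D[of J], of d "ND @ J" a b] by (simp add: val_def)

lemma good_Es: "\<forall>E\<in>set Es. good E" and good_Fs: "\<forall>E\<in>set Fs. good E"
  using tok_E tok_F by (auto simp: tok_def)

lemma bdeg_all: "\<forall>X\<in>set Xs. tok d X \<Longrightarrow> bdeg d (concat (map fst Xs)) = of_int (\<Sum>X\<leftarrow>Xs. fst (snd X))"
proof (induction Xs)
  case (Cons X Xs)
  then show ?case using tok_bdeg[of d X] by simp
qed simp

lemma bdeg_NF: "of_int (\<Sum>a = 1..length XF. fst (Fs ! (a - 1))) = bdeg d NF"
  using bdeg_slice[of XF d "length XF" 0] tok_F tok_bdeg by simp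

context
  fixes P a Q
  assumes xs: "xs = P @ a # Q"
begin

text \<open>The left-hand side of the first relation as a sum of words of words.\<close>

lemma composite_words:
  "sg total (direct_part (brace S D Es) Fs (length Fs) (length P) hz (map (hitem d) xs)) =
   wsum (map (pop v) XF) zs P (\<lambda>J u. wsum (map (pop v) XE) J (u @ a # Q) val)"
proof -
  have "sg total (direct_part (brace S D Es) Fs (length Fs) (length P) hz (map (hitem d) xs)) =
    wsum (map (pop v) XF) zs P (\<lambda>J u. sg (kos d ((ND @ NE) @ J @ toks (u @ a # Q)))
      (snd (brace S D Es) (map v J) (map snd (u @ a # Q))))"
    unfolding total_def
    using kos_direct_part[of "ND @ NE" XF zs P a Q "length XF" d "brace S D Es" v] dist tok_F tok_bdeg
    by (simp add: xs)
  also have "\<dots> = wsum (map (pop v) XF) zs P (\<lambda>J u. wsum (map (pop v) XE) J (u @ a # Q) val)"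
  proof (rule wsum_cong)
    fix J u assume w: "(J, u) \<in> set (words (map (pop v) XF) zs P)"
    have "mset (ND @ NE @ J @ toks (u @ a # Q)) = mset (ND @ NE @ NF @ zs @ toks xs)"
      using mset_words_pop[OF w] by (simp add: xs ac_simps)
    then have "distinct (ND @ NE @ J @ toks (u @ a # Q))"
      by (rule distinct_mset) (rule dist)
    moreover have "zok d v J" using words_z_subset[OF w] zok zok_subset by blast
    moreover have "aok d (u @ a # Q)"
      using words_pop_aok[OF w tok_F zok] aok by (simp add: xs)
    ultimately show "sg (kos d ((ND @ NE) @ J @ toks (u @ a # Q))) (snd (brace S D Es) (map v J) (map snd (u @ a # Q))) =
        wsum (map (pop v) XE) J (u @ a # Q) val"
      using kos_brace[of ND XE J "u @ a # Q" D d v] good_D tok_E unfolding val_def by simp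
  qed
  finally show ?thesis .
qed

text \<open>A summand of the first relation in which \<open>a\<^sub>0\<close> is a direct input of \<open>D\<close>. Its sign arises by first moving
  \<open>E\<^sub>s\<^sub>+\<^sub>1, \<dots>, E\<^sub>m\<close> past all \<open>F\<close>'s and then weaving the other \<open>E\<close>'s into the \<open>F\<close>'s.\<close>

lemma direct_words:
  assumes s: "s \<le> length XE" and ps: "ps \<in> weak_chains 0 (length XF) (2 * s)"
  defines "W \<equiv> weaving v 0 ps (take s XE) XF" and "G \<equiv> weave 0 ps (map (brace S) (take s Es)) Fs"
  shows "sg total (signed_by
        (weave_exp Es Fs (length XE) (length XF) s ps)
        (direct_part D (G @ drop s Es) (length G) (length P) hz (map (hitem d) xs))) =
    wsum (map snd W) zs P (\<lambda>z u. wsum (map (pop v) (drop s XE)) z Q (\<lambda>J w. val J (u @ a # w)))"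
proof -
  let ?t1 = "\<Sum>k = 1..s. fst (Es ! (k - 1)) * (\<Sum>a = 1..ps ! (2 * k - 2). fst (Fs ! (a - 1)))"
  let ?t2 = "\<Sum>k = s + 1..length XE. fst (Es ! (k - 1)) * (\<Sum>a = 1..length XF. fst (Fs ! (a - 1)))"
  let ?N1 = "concat (map fst (take s XE))" and ?N2 = "concat (map fst (drop s XE))" and ?R = "zs @ toks xs"
  let ?NW = "concat (map (fst \<circ> fst) W)"
  have NE: "NE = ?N1 @ ?N2" by (metis append_take_drop_id concat_append map_append)
  have ps': "ps \<in> weak_chains 0 (length XF) (2 * length (take s XE))" using ps s by simp
  have tk: "\<forall>X\<in>set (take s XE). tok d X" "\<forall>X\<in>set (drop s XE). tok d X"
    using tok_E by (auto dest: in_set_takeD in_set_dropD)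
  have mW: "mset ?NW = mset ?N1 + mset NF" using mset_weaving[OF ps'] by (simp add: W_def)
  have mall: "mset (ND @ ?NW @ ?N2 @ ?R) = mset (ND @ NE @ NF @ ?R)"
    by (simp add: mW NE ac_simps)
  have t2: "of_int ?t2 = bdeg d ?N2 * bdeg d NF"
  proof -
    have "of_int ?t2 = of_int (\<Sum>k = s + 1..length XE. fst (Es ! (k - 1))) * (of_int (\<Sum>a = 1..length XF. fst (Fs ! (a - 1))) :: bit)"
      by (simp add: sum_distrib_right)
    also have "of_int (\<Sum>k = s + 1..length XE. fst (Es ! (k - 1))) = bdeg d ?N2"
      using bdeg_slice[of XE d "length XE" s] tok_E tok_bdeg by simp
    finally show ?thesis by (simp only: bdeg_NF)
  qed
  have t1: "?t1 = (\<Sum>k = 1..length (take s XE). fst (map snd (take s XE) ! (k - 1)) * (\<Sum>a = 0 + 1..ps ! (2 * k - 2). fst (Fs ! (a - 1))))"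
  proof (intro sum.cong arg_cong2[where f = "(*)"])
    fix k assume "k \<in> {1..length (take s XE)}"
    then have "k - 1 < s" "k - 1 < length XE" using s by auto
    then show "fst (Es ! (k - 1)) = fst (map snd (take s XE) ! (k - 1))" by simp
  qed (use s in auto)
  have dis: "set ?N2 \<inter> set NF = {}" "distinct (ND @ ?N1 @ concat (map fst (drop 0 XF)))"
    using dist unfolding NE by auto
  have "total = kos d (ND @ ?N1 @ NF @ ?N2 @ ?R) + of_int ?t2"
    using kos_swap[OF dis(1), of d "ND @ ?N1" ?R] by (simp only: total_def NE t2 append_assoc)
  also have "kos d (ND @ ?N1 @ NF @ ?N2 @ ?R) = kos d (ND @ ?NW @ ?N2 @ ?R) + of_int ?t1"
    using kos_weaving[OF ps' _ dis(2) tk(1) tok_F, of v "?N2 @ ?R"] unfolding t1 W_def by simp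
  finally have sign: "total + of_int (?t1 + ?t2) = kos d (ND @ ?NW @ ?N2 @ ?R)"
    by (simp add: add.assoc)
  have cochains: "map snd (map fst W @ drop s XE) = G @ drop s Es"
    using weaving_cochains[of v 0 ps "take s XE" XF] by (simp add: G_def W_def take_map drop_map o_def)
  have len: "length W = length G"
    using length_weaving[of v 0 ps "take s XE" XF] by (simp add: G_def W_def take_map)
  have sW: "\<forall>x\<in>set W. sound d v x" unfolding W_def by (rule sound_weaving[OF tk(1) tok_F])
  have "sg total (signed_by (?t1 + ?t2) (direct_part D (G @ drop s Es) (length G) (length P) hz (map (hitem d) xs))) =
     sg (kos d (ND @ concat (map fst (map fst W @ drop s XE)) @ zs @ toks (P @ a # Q)))
       (direct_part D (map snd (map fst W @ drop s XE)) (length W) (length P) hz (map (hitem d) (P @ a # Q)))"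
  proof -
    have "concat (map fst (map fst W @ drop s XE)) = ?NW @ ?N2" by (simp add: o_def)
    then show ?thesis
      unfolding signed_by_eq_sg sg_sg sign by (simp only: cochains len xs append_assoc)
  qed
  also have "\<dots> = wsum (map (pop v) (take (length W) (map fst W @ drop s XE))) zs P (\<lambda>z u.
      wsum (map (pop v) (drop (length W) (map fst W @ drop s XE))) z Q (\<lambda>J w. val J (u @ a # w)))"
    unfolding val_def
  proof (rule kos_direct_part)
    show "distinct (ND @ concat (map fst (map fst W @ drop s XE)) @ zs @ toks (P @ a # Q))"
      by (rule distinct_mset[OF _ dist]) (use mall in \<open>simp add: xs o_def\<close>)
    fix X assume X: "X \<in> set (map fst W @ drop s XE)"
    have "\<forall>y\<in>set (map fst W). tok d y" using sW by (simp add: sound_def)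
    then have "tok d X" using X tk(2) by auto
    then show "of_int (fst (snd X)) = bdeg d (fst X)"
      by (rule tok_bdeg)
  qed simp
  also have "\<dots> = wsum (map (pop v) (map fst W)) zs P (\<lambda>z u. wsum (map (pop v) (drop s XE)) z Q (\<lambda>J w. val J (u @ a # w)))"
    by simp
  also have "\<dots> = wsum (map snd W) zs P (\<lambda>z u. wsum (map (pop v) (drop s XE)) z Q (\<lambda>J w. val J (u @ a # w)))"
  proof (rule wsum_sound[OF sW _ zok])
    have "distinct (ND @ ?NW @ ?N2 @ ?R)" by (rule distinct_mset[OF mall dist])
    then show "distinct (?NW @ zs @ toks P)" by (auto simp: xs)
    show "aok d P" using aok by (simp add: xs)
    show "klin d (\<lambda>u. wsum (map (pop v) (drop s XE)) J Q (\<lambda>J w. val J (u @ a # w)))" for J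
      using klin_val[of _ "[]"] by (intro klin_wsum) simp
  qed
  finally show ?thesis .
qed

text \<open>A summand of the first relation in which \<open>a\<^sub>0\<close> is a direct input of an \<open>E\<close>, the one with zero-based
  index \<open>s\<close>. Here \<open>i\<close> is the number of \<open>F\<close>'s in front of that \<open>E\<close>; the others are inside it.\<close>

lemma nested_words:
  assumes s: "s < length XE" and i: "i \<le> length XF" and ps: "ps \<in> weak_chains 0 i (2 * s)"
  defines "W \<equiv> weaving v 0 ps (take s XE) (take i XF)" and "G \<equiv> weave 0 ps (map (brace S) (take s Es)) (take i Fs)"
  shows "sg total (signed_by
        (weave_exp Es Fs (length XE) (length XF) (Suc s) (ps @ [i]))
        (nested_part S D (G @ Es ! s # drop (Suc s) Es) (Suc (length G)) (drop i Fs @ []) (length (drop i Fs)) (length P) hz (map (hitem d) xs))) =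
    csum P (\<lambda>P1 P2. csum Q (\<lambda>Q1 Q2. wsum (map snd W) zs P1 (\<lambda>z u. usum z (\<lambda>L z.
      wsum (map (pop v) (drop i XF)) L P2 (\<lambda>L w. lsum (pop v (XE ! s) L (w @ a # Q1)) (\<lambda>y.
        wsum (map (pop v) (drop (Suc s) XE)) z Q2 (\<lambda>J w. val J (u @ y # w))))))))"
proof -
  let ?t0 = "\<Sum>k = 1..s. fst (Es ! (k - 1)) * (\<Sum>a = 1..ps ! (2 * k - 2). fst (Fs ! (a - 1)))"
  let ?t1 = "\<Sum>k = 1..Suc s. fst (Es ! (k - 1)) * (\<Sum>a = 1..(ps @ [i]) ! (2 * k - 2). fst (Fs ! (a - 1)))"
  let ?t2 = "\<Sum>k = Suc s + 1..length XE. fst (Es ! (k - 1)) * (\<Sum>a = 1..length XF. fst (Fs ! (a - 1)))"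
  let ?N1 = "concat (map fst (take s XE))" and ?Ns = "fst (XE ! s)" and ?N2 = "concat (map fst (drop (Suc s) XE))"
  let ?F1 = "concat (map fst (take i XF))" and ?F2 = "concat (map fst (drop i XF))" and ?R = "zs @ toks xs"
  let ?NW = "concat (map (fst \<circ> fst) W)"
  have NE: "NE = ?N1 @ ?Ns @ ?N2"
    using id_take_nth_drop[OF s] by (metis (no_types, lifting) concat.simps(2) concat_append list.simps(9) map_append)
  have NF: "NF = ?F1 @ ?F2" by (metis append_take_drop_id concat_append map_append)
  have ps': "ps \<in> weak_chains 0 (length (take i XF)) (2 * length (take s XE))" using ps s i by simp
  have tk: "\<forall>X\<in>set (take s XE). tok d X" "\<forall>X\<in>set (drop (Suc s) XE). tok d X" "tok d (XE ! s)"
    "\<forall>X\<in>set (take i XF). tok d X" "\<forall>X\<in>set (drop i XF). tok d X"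
    using tok_E tok_F s by (auto dest: in_set_takeD in_set_dropD)
  have mW: "mset ?NW = mset ?N1 + mset ?F1" using mset_weaving[OF ps'] by (simp add: W_def)
  have mall: "mset (ND @ ?NW @ (?Ns @ ?F2) @ ?N2 @ ?R) = mset (ND @ NE @ NF @ ?R)"
    unfolding NE NF by (simp add: mW ac_simps)
  have t2: "of_int ?t2 = bdeg d ?N2 * bdeg d NF"
  proof -
    have "of_int ?t2 = of_int (\<Sum>k = Suc s + 1..length XE. fst (Es ! (k - 1))) * (of_int (\<Sum>a = 1..length XF. fst (Fs ! (a - 1))) :: bit)"
      by (simp add: sum_distrib_right)
    also have "of_int (\<Sum>k = Suc s + 1..length XE. fst (Es ! (k - 1))) = bdeg d ?N2"
      using bdeg_slice[of XE d "length XE" "Suc s"] tok_E tok_bdeg by simp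
    finally show ?thesis by (simp only: bdeg_NF)
  qed
  have lps: "length ps = 2 * s" using ps by (simp add: weak_chains_def)
  have ps_le: "ps ! (2 * k - 2) \<le> i" if "1 \<le> k" "k \<le> s" for k
    using weak_chains_nth[OF ps, of "2 * k - 2"] that by simp
  have t1: "?t1 = ?t0 + fst (Es ! s) * (\<Sum>a = 1..i. fst (Fs ! (a - 1)))"
  proof -
    have "(\<Sum>k = 1..s. fst (Es ! (k - 1)) * (\<Sum>a = 1..(ps @ [i]) ! (2 * k - 2). fst (Fs ! (a - 1)))) = ?t0"
    proof (intro sum.cong refl)
      fix k assume "k \<in> {1..s}"
      then have "(ps @ [i]) ! (2 * k - 2) = ps ! (2 * k - 2)" using lps by (auto simp: nth_append)
      then show "fst (Es ! (k - 1)) * (\<Sum>a = 1..(ps @ [i]) ! (2 * k - 2). fst (Fs ! (a - 1))) =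
          fst (Es ! (k - 1)) * (\<Sum>a = 1..ps ! (2 * k - 2). fst (Fs ! (a - 1)))" by simp
    qed
    moreover have "(ps @ [i]) ! (2 * Suc s - 2) = i" using lps by (simp add: nth_append)
    ultimately show ?thesis by simp
  qed
  have ts: "of_int (fst (Es ! s) * (\<Sum>a = 1..i. fst (Fs ! (a - 1)))) = bdeg d ?Ns * bdeg d ?F1"
    using bdeg_slice[of XF d i 0] tok_F tok_bdeg i tok_bdeg[OF tk(3)] s by (simp add: slice_def del: of_int_sum)
  have t0: "?t0 = (\<Sum>k = 1..length (take s XE). fst (map snd (take s XE) ! (k - 1)) * (\<Sum>a = 0 + 1..ps ! (2 * k - 2). fst (map snd (take i XF) ! (a - 1))))"
  proof (intro sum.cong arg_cong2[where f = "(*)"])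
    fix k assume k: "k \<in> {1..length (take s XE)}"
    then have "k - 1 < s" "k - 1 < length XE" using s by auto
    then show "fst (Es ! (k - 1)) = fst (map snd (take s XE) ! (k - 1))" by simp
    fix b assume "b \<in> {0 + 1..ps ! (2 * k - 2)}"
    then show "fst (Fs ! (b - 1)) = fst (map snd (take i XF) ! (b - 1))" using ps_le[of k] k s i by auto
  qed (use s in auto)
  have d': "distinct (ND @ ?N1 @ ?Ns @ ?N2 @ ?F1 @ ?F2 @ ?R)" using dist unfolding NE NF by simp
  then have dis: "set ?N2 \<inter> set NF = {}" "set ?Ns \<inter> set ?F1 = {}" "distinct (ND @ ?N1 @ concat (map fst (drop 0 (take i XF))))"
    unfolding NF by auto
  have "total = kos d (ND @ ?N1 @ ?Ns @ NF @ ?N2 @ ?R) + of_int ?t2"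
    using kos_swap[OF dis(1), of d "ND @ ?N1 @ ?Ns" ?R] by (simp only: total_def NE t2 append_assoc)
  also have "kos d (ND @ ?N1 @ ?Ns @ NF @ ?N2 @ ?R) = kos d (ND @ ?N1 @ ?F1 @ ?Ns @ ?F2 @ ?N2 @ ?R) + of_int (fst (Es ! s) * (\<Sum>a = 1..i. fst (Fs ! (a - 1))))"
    using kos_swap[OF dis(2), of d "ND @ ?N1" "?F2 @ ?N2 @ ?R"] by (simp only: NF ts append_assoc)
  also have "kos d (ND @ ?N1 @ ?F1 @ ?Ns @ ?F2 @ ?N2 @ ?R) = kos d (ND @ ?NW @ (?Ns @ ?F2) @ ?N2 @ ?R) + of_int ?t0"
    using kos_weaving[OF ps' _ dis(3) tk(1,4), of v "?Ns @ ?F2 @ ?N2 @ ?R"] unfolding t0 W_def by simp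
  finally have sign: "total + of_int (?t1 + ?t2) = kos d (ND @ ?NW @ (?Ns @ ?F2) @ ?N2 @ ?R)"
    unfolding t1 by (simp only: of_int_add ac_simps bit_double add_0_left add_0_right)
  \<comment> \<open>A placeholder for \<open>E{F, \<dots>}\<close>: only its tokens and its degree enter.\<close>
  define X where "X = (?Ns @ ?F2, (fst (Es ! s) + tdeg (drop i Fs), snd (Es ! s)))"
  let ?Xs = "map fst W @ X # drop (Suc s) XE"
  have cochains: "map snd (map fst W) = G"
    using weaving_cochains[of v 0 ps "take s XE" "take i XF"] by (simp add: G_def W_def take_map o_def)
  have len: "length W = length G" using cochains by (metis length_map)
  have sW: "\<forall>x\<in>set W. sound d v x" unfolding W_def by (rule sound_weaving[OF tk(1,4)])
  have distall: "distinct (ND @ ?NW @ (?Ns @ ?F2) @ ?N2 @ ?R)" by (rule distinct_mset[OF mall dist])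
  have degX: "of_int (fst (snd X)) = bdeg d (fst X)"
    using tok_bdeg[OF tk(3)] bdeg_all[OF tk(5)] s by (simp add: X_def tdeg_def drop_map o_def)
  have "sg total (signed_by (?t1 + ?t2) (nested_part S D (G @ Es ! s # drop (Suc s) Es) (Suc (length G)) (drop i Fs @ []) (length (drop i Fs)) (length P) hz (map (hitem d) xs))) =
     sg (kos d (ND @ concat (map fst ?Xs) @ zs @ toks (P @ a # Q)))
       (nested_part S D (G @ Es ! s # drop (Suc s) Es) (Suc (length W)) (drop i Fs) (length (drop i Fs)) (length P) hz (map (hitem d) (P @ a # Q)))"
    unfolding signed_by_eq_sg sg_sg sign by (simp add: len xs o_def X_def)
  also have "\<dots> = csum P (\<lambda>P1 P2. csum Q (\<lambda>Q1 Q2. wsum (map (pop v) (take (length W) ?Xs)) zs P1 (\<lambda>z u. usum z (\<lambda>L z.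
      wsum (map (pop v) (drop (Suc (length W)) ?Xs)) z Q2 (\<lambda>J w.
        val J (u @ plain v (fst (?Xs ! length W), direct_brace S (Es ! s) (drop i Fs) (length (drop i Fs)) (length P2)) L (P2 @ a # Q1) # w))))))"
    unfolding val_def
  proof (rule kos_nested_part)
    show "distinct (ND @ concat (map fst ?Xs) @ zs @ toks (P @ a # Q))"
      using distall by (simp add: X_def xs o_def)
    show "length W < length ?Xs" by simp
    show "of_int (fst (snd Y)) = bdeg d (fst Y)" if "Y \<in> set ?Xs" for Y
    proof -
      have "\<forall>y\<in>set (map fst W). tok d y" using sW by (simp add: sound_def)
      then have "tok d Y \<or> Y = X" using that tk(2) by auto
      then show ?thesis using tok_bdeg degX by blast
    qed
    show "fst (snd (?Xs ! length W)) = fst (Es ! s) + tdeg (drop i Fs)" by (simp add: X_def nth_append)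
    show "G @ Es ! s # drop (Suc s) Es = (map snd ?Xs)[length W := Es ! s]"
      using cochains len by (simp add: list_update_append drop_map)
  qed
  also have "\<dots> = csum P (\<lambda>P1 P2. csum Q (\<lambda>Q1 Q2. wsum (map (pop v) (map fst W)) zs P1 (\<lambda>z u. usum z (\<lambda>L z.
      wsum (map (pop v) (drop (Suc s) XE)) z Q2 (\<lambda>J w.
        val J (u @ plain v (?Ns @ ?F2, direct_brace S (Es ! s) (drop i Fs) (length (drop i Fs)) (length P2)) L (P2 @ a # Q1) # w))))))"
    by (simp add: X_def nth_append)
  also have "\<dots> = csum P (\<lambda>P1 P2. csum Q (\<lambda>Q1 Q2. wsum (map snd W) zs P1 (\<lambda>z u. usum z (\<lambda>L z.
      wsum (map (pop v) (drop i XF)) L P2 (\<lambda>L w. lsum (pop v (XE ! s) L (w @ a # Q1)) (\<lambda>y.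
        wsum (map (pop v) (drop (Suc s) XE)) z Q2 (\<lambda>J w. val J (u @ y # w))))))))"
  proof (intro csum_cong)
    fix P1 P2 Q1 Q2 assume P: "P = P1 @ P2" and Q: "Q = Q1 @ Q2"
    let ?h = "\<lambda>L. plain v (?Ns @ ?F2, direct_brace S (Es ! s) (drop i Fs) (length (drop i Fs)) (length P2)) L (P2 @ a # Q1)"
    have "wsum (map (pop v) (map fst W)) zs P1 (\<lambda>z u. usum z (\<lambda>L z. wsum (map (pop v) (drop (Suc s) XE)) z Q2 (\<lambda>J w. val J (u @ ?h L # w)))) =
       wsum (map snd W) zs P1 (\<lambda>z u. usum z (\<lambda>L z. wsum (map (pop v) (drop (Suc s) XE)) z Q2 (\<lambda>J w. val J (u @ ?h L # w))))"
    proof (rule wsum_sound[OF sW _ zok])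
      show "distinct (?NW @ zs @ toks P1)" using distall by (auto simp: xs P)
      show "aok d P1" using aok by (simp add: xs P)
      show "klin d (\<lambda>u. usum J (\<lambda>L z. wsum (map (pop v) (drop (Suc s) XE)) z Q2 (\<lambda>J w. val J (u @ ?h L # w))))" for J
        using klin_val[of _ "[]"] by (intro klin_usum klin_wsum) simp
    qed
    also have "\<dots> = wsum (map snd W) zs P1 (\<lambda>z u. usum z (\<lambda>L z.
      wsum (map (pop v) (drop i XF)) L P2 (\<lambda>L w. lsum (pop v (XE ! s) L (w @ a # Q1)) (\<lambda>y.
        wsum (map (pop v) (drop (Suc s) XE)) z Q2 (\<lambda>J w. val J (u @ y # w))))))"
    proof (intro wsum_cong usum_cong)
      fix z u L z' assume z: "(z, u) \<in> set (words (map snd W) zs P1)" and L: "mset L + mset z' = mset z"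
      have "mset L \<subseteq># mset zs" using words_z_subset[OF z] L by (metis mset_subset_eq_add_left subset_mset.order_trans)
      then have Lz: "zok d v L" "set L \<subseteq> set zs" "distinct L"
        using zok_subset[OF zok] sublist_mset_distinct[of L zs] dist by auto
      have "keq d [plain v (?Ns @ ?F2, direct_brace S (snd (XE ! s)) (map snd (drop i XF)) (length (drop i XF)) (length P2)) L (P2 @ a # Q1)]
        (concat (map (\<lambda>(L, u). pop v (XE ! s) L (u @ a # Q1)) (words (map (pop v) (drop i XF)) L P2)))"
      proof (rule keq_direct_brace[OF tk(3,5) _ Lz(1)])
        show "distinct ((?Ns @ ?F2) @ L @ toks (P2 @ a # Q1))"
        proof -
          have "toks xs = toks P1 @ toks (P2 @ a # Q1) @ toks Q2" by (simp add: xs P Q)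
          from distinct_middle[OF distall[unfolded this] Lz(3,2)] show ?thesis .
        qed
        show "aok d (P2 @ a # Q1)" using aok by (simp add: xs P Q)
      qed
      then have keq: "keq d [?h L] (concat (map (\<lambda>(L, u). pop v (XE ! s) L (u @ a # Q1)) (words (map (pop v) (drop i XF)) L P2)))"
        using s by (simp only: nth_map drop_map length_map length_drop)
      have "klin d (\<lambda>y. wsum (map (pop v) (drop (Suc s) XE)) z' Q2 (\<lambda>J w. val J (u @ y @ w)))"
        by (intro klin_wsum klin_val)
      from this[unfolded klin_def, rule_format, OF keq, of "[]" "[]"]
      have "lsum [?h L] (\<lambda>y. wsum (map (pop v) (drop (Suc s) XE)) z' Q2 (\<lambda>J w. val J (u @ y # w))) =
          lsum (concat (map (\<lambda>(L, u). pop v (XE ! s) L (u @ a # Q1)) (words (map (pop v) (drop i XF)) L P2)))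
            (\<lambda>y. wsum (map (pop v) (drop (Suc s) XE)) z' Q2 (\<lambda>J w. val J (u @ y # w)))"
        by (simp only: append_Cons append_Nil)
      then show "wsum (map (pop v) (drop (Suc s) XE)) z' Q2 (\<lambda>J w. val J (u @ ?h L # w)) =
          wsum (map (pop v) (drop i XF)) L P2 (\<lambda>L w. lsum (pop v (XE ! s) L (w @ a # Q1)) (\<lambda>y.
            wsum (map (pop v) (drop (Suc s) XE)) z' Q2 (\<lambda>J w. val J (u @ y # w))))"
        by (simp add: wsum_def[of "map (pop v) (drop i XF)"] split_def)
    qed
    finally show "wsum (map (pop v) (map fst W)) zs P1 (\<lambda>z u. usum z (\<lambda>L z. wsum (map (pop v) (drop (Suc s) XE)) z Q2 (\<lambda>J w. val J (u @ ?h L # w)))) =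
      wsum (map snd W) zs P1 (\<lambda>z u. usum z (\<lambda>L z.
      wsum (map (pop v) (drop i XF)) L P2 (\<lambda>L w. lsum (pop v (XE ! s) L (w @ a # Q1)) (\<lambda>y.
        wsum (map (pop v) (drop (Suc s) XE)) z Q2 (\<lambda>J w. val J (u @ y # w))))))" .
  qed
  finally show ?thesis .
qed

theorem direct_part_of_brace:
  "direct_part (brace S D Es) Fs (length Fs) (length P) hz (map (hitem d) xs) =
    (\<Sum>s = 0..length XE. \<Sum>ps\<in>weak_chains 0 (length XF) (2 * s). signed_by
        (weave_exp Es Fs (length XE) (length XF) s ps)
        (direct_summand D Es Fs s ps (length P) hz (map (hitem d) xs)))
  + (\<Sum>s = 1..length XE. \<Sum>ps\<in>weak_chains 0 (length XF) (2 * s - 1). signed_by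
        (weave_exp Es Fs (length XE) (length XF) s ps)
        (nested_summand D Es Fs s ps (length P) hz (map (hitem d) xs)))"
    (is "?L = (\<Sum>s = 0..length XE. ?A s) + (\<Sum>s = 1..length XE. ?B s)")
proof -
  let ?pE = "map (pop v) XE" and ?pF = "map (pop v) XF"
  have A: "sg total (?A s) = dsum (map graft (take s ?pE)) ?pF (\<lambda>G. wsum G zs P (\<lambda>z u.
       wsum (drop s ?pE) z Q (\<lambda>J w. val J (u @ a # w))))" if s: "s \<in> {0..length XE}" for s
  proof -
    have "sg total (?A s) = (\<Sum>ps\<in>weak_chains 0 (length XF) (2 * length (take s XE)).
       (\<lambda>G. wsum G zs P (\<lambda>z u. wsum (drop s ?pE) z Q (\<lambda>J w. val J (u @ a # w)))) (map snd (weaving v 0 ps (take s XE) XF)))"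
      unfolding sg_sum using s by (intro sum.cong) (simp_all only: direct_words drop_map[where f = "pop v"] length_take min_absorb2 atLeastAtMost_iff)
    then show ?thesis by (subst (asm) sum_weaving) (simp_all add: take_map drop_map)
  qed
  have B: "sg total (?B (Suc s)) = csum ?pF (\<lambda>F1 F2. dsum (map graft (take s ?pE)) F1 (\<lambda>G.
       csum P (\<lambda>P1 P2. csum Q (\<lambda>Q1 Q2. wsum G zs P1 (\<lambda>z u. usum z (\<lambda>L z.
         wsum F2 L P2 (\<lambda>L w. lsum ((?pE ! s) L (w @ a # Q1)) (\<lambda>y.
           wsum (drop (Suc s) ?pE) z Q2 (\<lambda>J w. val J (u @ y # w))))))))))" if s: "s < length XE" for s
  proof -
    let ?f = "\<lambda>F2 G. csum P (\<lambda>P1 P2. csum Q (\<lambda>Q1 Q2. wsum G zs P1 (\<lambda>z u. usum z (\<lambda>L z.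
         wsum F2 L P2 (\<lambda>L w. lsum ((?pE ! s) L (w @ a # Q1)) (\<lambda>y.
           wsum (drop (Suc s) ?pE) z Q2 (\<lambda>J w. val J (u @ y # w))))))))"
    have e: "2 * Suc s - 1 = Suc (2 * s)" by simp
    have "sg total (?B (Suc s)) = (\<Sum>i = 0..length XF. \<Sum>ps\<in>weak_chains 0 i (2 * s).
        ?f (drop i ?pF) (map snd (weaving v 0 ps (take s XE) (take i XF))))"
      unfolding sg_sum e sum_weak_chains_snoc butlast_snoc last_snoc diff_Suc_1
      using s by (intro sum.cong refl) (simp only: nested_words atLeastAtMost_iff drop_map[where f = "pop v"] nth_map[where f = "pop v"])
    also have "\<dots> = (\<Sum>i = 0..length XF. dsum (map graft (take s ?pE)) (take i ?pF) (?f (drop i ?pF)))"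
    proof (intro sum.cong refl)
      fix i assume "i \<in> {0..length XF}"
      then show "(\<Sum>ps\<in>weak_chains 0 i (2 * s). ?f (drop i ?pF) (map snd (weaving v 0 ps (take s XE) (take i XF)))) =
          dsum (map graft (take s ?pE)) (take i ?pF) (?f (drop i ?pF))"
        using sum_weaving[of 0 "take i XF" "?f (drop i ?pF)" v "take s XE"] s by (simp add: take_map)
    qed
    finally show ?thesis by (simp add: csum_eq_sum)
  qed
  have "sg total ?L = (\<Sum>s = 0..length XE. sg total (?A s)) + (\<Sum>s < length XE. sg total (?B (Suc s)))"
    unfolding composite_words unfolding wsum_wsum_word_mark length_map
    by (intro arg_cong2[where f = "(+)"] sum.cong refl) (simp_all only: A B lessThan_iff)
  also have "\<dots> = sg total ((\<Sum>s = 0..length XE. ?A s) + (\<Sum>s = 1..length XE. ?B s))"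
    unfolding One_nat_def sum.atLeast1_atMost_eq by (simp only: sg_add sg_sum)
  finally show ?thesis by (simp add: sg_eq_iff)
qed

end

lemma pairing_sg: "pairing S (sg b y) z = sg b (pairing S y z)"
  by (simp add: sg_def pairing_uminus)

lemma pairing_lsum: "pairing S (lsum ys f) z = lsum ys (\<lambda>y. pairing S (f y) z)"
proof -
  interpret l: Vector_Spaces.linear "ascale S" "(*)" "\<lambda>a. pairing S a z" by (rule linear_left)
  show ?thesis by (induction ys) (simp_all add: l.zero l.add)
qed

lemma pairing_wsum: "pairing S (wsum gs ys ws f) z = wsum gs ys ws (\<lambda>J w. pairing S (f J w) z)"
  by (simp add: wsum_def pairing_lsum split_def)

lemma rotations_csum:
  "rotations T ys (map (hitem d) w) (hitem d a) = csum w (\<lambda>u r.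
     signed_by (tdeg (map (hitem d) u) * (tdeg (map (hitem d) r) + fst (hitem d a)))
       (pairing S (T (length r) ys (map (hitem d) (r @ a # u))) (marked_elt S)))"
  unfolding rotations_def csum_eq_sum length_map
  by (intro sum.cong refl) (simp add: take_map drop_map)

text \<open>If some entry of \<open>w\<close> is zero, it has no homogeneous components and the defining sum is
  empty; the right-hand side vanishes as well, by multilinearity.\<close>

lemma pairing_cyclic_brace:
  assumes "good D" "\<forall>E\<in>set As. good E" "\<forall>E\<in>set Bs. good E" "zok d v J" "aok d w" "J \<noteq> [] \<or> w \<noteq> []"
    and a: "snd a \<in> agr S (fst (hitem d a))"
  shows "pairing S (snd (cyclic_brace S D As Bs) (map v J) (map snd w)) (snd a) =
    rotations (\<lambda>p. direct_part D (As @ Bs) (length As) p) (map (zitem d v) J) (map (hitem d) w) (hitem d a)"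
proof -
  let ?T = "\<lambda>p. part (gap_chains (length (As @ Bs)) (length As) p) D (\<lambda>_. As @ Bs) (length (As @ Bs))"
  have pd: "part_data (gap_chains (length (As @ Bs)) (length As) p) D (\<lambda>_. As @ Bs) (length (As @ Bs)) (tdeg (As @ Bs))" for p
    using assms(1-3) by (intro part_data_direct) auto
  have T: "(\<lambda>p. direct_part D (As @ Bs) (length As) p) = ?T" by (simp add: direct_part_eq_part)
  have zero: "rotations ?T ys ha h0 = 0" if "0 \<in> snd ` set (h0 # ha)" for ys ha h0
  proof -
    have "?T (length ha - r) ys (drop r ha @ h0 # take r ha) = 0" for r
    proof (rule part_zero[OF pd])
      have "set (drop r ha @ h0 # take r ha) = set (h0 # ha)"
        by (metis Un_commute append_take_drop_id list.simps(15) set_append Un_insert_right)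
      then show "0 \<in> snd ` set (drop r ha @ h0 # take r ha)" using that by simp
    qed
    then show ?thesis by (simp add: rotations_def pairing_zero signed_by_0)
  qed
  have hw: "A.homs (map (hitem d) w)" using assms(5) by (simp add: aok_homs)
  have "pairing S (snd (cyclic_brace S D As Bs) (map v J) (map snd w)) (snd a) =
     (\<Sum>hz\<in>hlists (zgr S) (map v J). \<Sum>ha\<in>hlists (agr S) (map snd w). \<Sum>h0\<in>hcomps (agr S) (snd a). rotations ?T hz ha h0)"
    unfolding cyclic_brace_def snd_conv T using assms(6) by (intro pairing_cyclic_dual[OF pd]) auto
  also have "\<dots> = (\<Sum>ha\<in>hlists (agr S) (map snd w). \<Sum>h0\<in>hcomps (agr S) (snd a). rotations ?T (map (zitem d v) J) ha h0)"
  proof -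
    have "hlists (zgr S) (map v J) = {map (zitem d v) J}"
      using Z.hlists_homs[of "map (zitem d v) J"] zok_homs[OF assms(4)] unfolding snd_items by presburger
    then show ?thesis by simp
  qed
  also have "\<dots> = (\<Sum>h0\<in>hcomps (agr S) (snd a). rotations ?T (map (zitem d v) J) (map (hitem d) w) h0)"
  proof (cases "0 \<in> snd ` set (map (hitem d) w)")
    case True
    then have "hlists (agr S) (map snd w) = {}" "\<And>h0. rotations ?T (map (zitem d v) J) (map (hitem d) w) h0 = 0"
      using A.hlists_homs[OF hw] zero[of _ "map (hitem d) w"] unfolding snd_items by auto
    then show ?thesis by simp
  next
    case False
    then have "hlists (agr S) (map snd w) = {map (hitem d) w}"
      using A.hlists_homs[OF hw] unfolding snd_items by presburger
    then show ?thesis by simp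
  qed
  also have "\<dots> = rotations ?T (map (zitem d v) J) (map (hitem d) w) (hitem d a)"
  proof (cases "snd a = 0")
    case True
    have "rotations ?T (map (zitem d v) J) (map (hitem d) w) (hitem d a) = 0"
      by (rule zero) (simp add: True hitem_def)
    then show ?thesis using True by simp
  next
    case False
    then have "hcomps (agr S) (snd a) = {hitem d a}"
      using A.hcomps_homogeneous[OF a] by (simp add: hitem_def)
    then show ?thesis by simp
  qed
  finally show ?thesis by (simp only: T)
qed

context
  fixes t0 :: nat and x :: 'a
  assumes t0: "\<forall>t\<in>set (ND @ NE @ NF @ zs @ toks xs). t < t0" and x: "x \<in> agr S (d t0)"
begin

abbreviation "a0 \<equiv> ([t0], x)"

definition pval :: "nat list \<Rightarrow> (nat list \<times> 'a) list \<Rightarrow> 'k" where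
  "pval J w = sg (kos d (ND @ J @ toks w)) (pairing S (snd D (map v J) (map snd w)) (marked_elt S))"

lemma klin_pval: "klin d (\<lambda>w. pval J (b @ w @ c))"
proof -
  have "entrywise_additive (\<lambda>as. pairing S (snd D (map v J) as) (marked_elt S))"
    using additive_D[of J] linear_left by (auto simp: entrywise_additive_def Vector_Spaces.linear_iff)
  from klin_kos[OF this, of d "ND @ J" b c] show ?thesis by (simp add: pval_def)
qed

text \<open>The sign of a rotation is the Koszul sign of moving the initial part of the word behind \<open>a\<^sub>0\<close>. The token
  of \<open>a\<^sub>0\<close> exceeds all others, so that appending it to an arrangement creates no inversions.\<close>

lemma sg_rotate:
  assumes "mset (pre @ toks u @ toks r) = mset (ND @ NE @ NF @ zs @ toks xs)"
  shows "sg (kos d (pre @ toks u @ toks r)) (signed_by (tdeg (map (hitem d) u) * (tdeg (map (hitem d) r) + fst (hitem d a0))) y) =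
     sg (kos d (pre @ toks (r @ a0 # u))) y"
proof -
  let ?all = "ND @ NE @ NF @ zs @ toks xs"
  have s: "set (pre @ toks u @ toks r) = set ?all" using assms by (rule mset_eq_setD)
  have d: "distinct (pre @ toks u @ toks r)" by (rule distinct_mset[OF assms dist])
  have lt: "\<forall>t\<in>set (pre @ toks u @ toks r). t < t0" using t0 unfolding s .
  then have "set (toks u) \<inter> set (toks r @ [t0]) = {}" using d by auto
  from kos_swap[OF this, of d pre "[]"]
  have "kos d ((pre @ toks u @ toks r) @ [t0]) = kos d (pre @ toks r @ [t0] @ toks u) + bdeg d (toks u) * (bdeg d (toks r) + of_int (d t0))"
    by simp
  then have "kos d (pre @ toks u @ toks r) = kos d (pre @ toks r @ [t0] @ toks u) + bdeg d (toks u) * (bdeg d (toks r) + of_int (d t0))"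
    unfolding kos_last[OF lt] .
  then show ?thesis
    by (simp add: signed_by_eq_sg tdeg_hitem hitem_def[of d a0] add.assoc)
qed

text \<open>The left-hand side of the second relation. The cyclic brace is evaluated at words of \<open>F\<close>-outputs; the
  assumption on the inputs ensures that none of them is the empty word without \<open>Z\<close>-inputs, where
  cyclic braces vanish by convention.\<close>

lemma brace_of_cyclic_words:
  assumes ne: "zs \<noteq> [] \<or> xs \<noteq> []" and xs: "\<forall>y\<in>set xs. fst y \<noteq> []"
  shows "sg total (pairing S (part (\<lambda>N. weak_chains 0 N (2 * length XF)) (cyclic_brace S D Es []) (\<lambda>_. Fs) (length XF) hz (map (hitem d) xs)) x) =
    wsum (map (pop v) XF) zs xs (\<lambda>J w. csum w (\<lambda>u r. wsum (map (pop v) XE) J r (\<lambda>J r. pval J (r @ a0 # u))))"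
proof -
  let ?X = "cyclic_brace S D Es []"
  have "sg total (pairing S (part (\<lambda>N. weak_chains 0 N (2 * length XF)) (cyclic_brace S D Es []) (\<lambda>_. Fs) (length XF) hz (map (hitem d) xs)) x) =
     wsum (map (pop v) XF) zs xs (\<lambda>J w. sg (kos d (ND @ NE @ J @ toks w)) (pairing S (snd ?X (map v J) (map snd w)) x))"
    using kos_part_full[of "ND @ NE" XF zs xs d ?X v, THEN arg_cong[of _ _ "\<lambda>y. pairing S y x"]] dist tok_F tok_bdeg
    unfolding pairing_sg[symmetric] total_def by (simp add: pairing_wsum)
  also have "\<dots> = wsum (map (pop v) XF) zs xs (\<lambda>J w. csum w (\<lambda>u r. wsum (map (pop v) XE) J r (\<lambda>J r. pval J (r @ a0 # u))))"
  proof (rule wsum_cong)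
    fix J w assume w: "(J, w) \<in> set (words (map (pop v) XF) zs xs)"
    have m: "mset J + mset (toks w) = mset NF + mset zs + mset (toks xs)" by (rule mset_words_pop[OF w])
    have "J \<noteq> [] \<or> w \<noteq> []"
    proof (rule ccontr)
      assume "\<not> (J \<noteq> [] \<or> w \<noteq> [])"
      then have "zs = []" "toks xs = []" using m by auto
      then show False using ne xs by (cases "xs :: (nat list \<times> 'a) list") auto
    qed
    moreover have zJ: "zok d v J" using words_z_subset[OF w] zok zok_subset by blast
    moreover have aw: "aok d w" by (rule words_pop_aok[OF w tok_F zok aok])
    ultimately have "pairing S (snd ?X (map v J) (map snd w)) x =
        rotations (\<lambda>p. direct_part D (Es @ []) (length Es) p) (map (zitem d v) J) (map (hitem d) w) (hitem d a0)"
      using pairing_cyclic_brace[of Es "[]" J w a0] good_D good_Es x by (simp add: hitem_def)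
    then have "sg (kos d (ND @ NE @ J @ toks w)) (pairing S (snd ?X (map v J) (map snd w)) x) =
       csum w (\<lambda>u r. sg (kos d (ND @ NE @ J @ toks w)) (signed_by (tdeg (map (hitem d) u) * (tdeg (map (hitem d) r) + fst (hitem d a0)))
       (pairing S (direct_part D Es (length XE) (length r) (map (zitem d v) J) (map (hitem d) (r @ a0 # u))) (marked_elt S))))"
      by (simp add: rotations_csum csum_eq_sum sg_sum)
    also have "\<dots> = csum w (\<lambda>u r. wsum (map (pop v) XE) J r (\<lambda>J r. pval J (r @ a0 # u)))"
    proof (rule csum_cong)
      fix u r assume ur: "w = u @ r"
      have mm: "mset ((ND @ NE @ J) @ toks u @ toks r) = mset (ND @ NE @ NF @ zs @ toks xs)"
        using m by (simp add: ur ac_simps)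
      have "distinct ((ND @ NE @ J @ toks w) @ [t0])"
      proof -
        have "mset (ND @ NE @ J @ toks w) = mset (ND @ NE @ NF @ zs @ toks xs)" using m by (simp add: ac_simps)
        from distinct_snoc_mset[OF this dist t0] show ?thesis .
      qed
      then have dist': "distinct (ND @ NE @ J @ toks (r @ a0 # u))"
        by (rule distinct_mset[rotated]) (simp add: ur ac_simps)
      have "sg (kos d (ND @ NE @ J @ toks w)) (signed_by (tdeg (map (hitem d) u) * (tdeg (map (hitem d) r) + fst (hitem d a0)))
         (pairing S (direct_part D Es (length XE) (length r) (map (zitem d v) J) (map (hitem d) (r @ a0 # u))) (marked_elt S))) =
        pairing S (sg (kos d (ND @ NE @ J @ toks (r @ a0 # u))) (direct_part D Es (length XE) (length r) (map (zitem d v) J) (map (hitem d) (r @ a0 # u)))) (marked_elt S)"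
        using sg_rotate[OF mm] by (simp add: ur pairing_sg)
      also have "\<dots> = wsum (map (pop v) XE) J r (\<lambda>J r. pval J (r @ a0 # u))"
        using kos_direct_part[OF dist', of "length XE" d D v] tok_E tok_bdeg
        by (simp add: pairing_wsum pairing_sg pval_def)
      finally show "sg (kos d (ND @ NE @ J @ toks w)) (signed_by (tdeg (map (hitem d) u) * (tdeg (map (hitem d) r) + fst (hitem d a0)))
         (pairing S (direct_part D Es (length XE) (length r) (map (zitem d v) J) (map (hitem d) (r @ a0 # u))) (marked_elt S))) =
        wsum (map (pop v) XE) J r (\<lambda>J r. pval J (r @ a0 # u))" .
    qed
    finally show "sg (kos d (ND @ NE @ J @ toks w)) (pairing S (snd ?X (map v J) (map snd w)) x) =
        csum w (\<lambda>u r. wsum (map (pop v) XE) J r (\<lambda>J r. pval J (r @ a0 # u)))" .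
  qed
  finally show ?thesis .
qed

text \<open>A summand on the right-hand side of the second relation. The double sum in its exponent is the cost of moving the block
  \<open>F\<^sub>1, \<dots>, F\<^sub>r\<close> behind the other \<open>F\<close>'s.\<close>

lemma cyclic_words:
  assumes r: "r \<le> length XF" and ps: "ps \<in> weak_chains r (length XF) (2 * length XE)"
  defines "W \<equiv> weaving v r ps XE XF" and "G \<equiv> weave r ps (map (brace S) Es) Fs"
  shows "sg total (signed_by
      (rotation_exp Es Fs (length XE) (length XF) r ps)
      (rotations (\<lambda>p. direct_part D (G @ take r Fs) (length G) p) hz (map (hitem d) xs) (hitem d a0))) =
    csum xs (\<lambda>P Q. wsum (map snd W) zs Q (\<lambda>z w. wsum (map (pop v) (take r XF)) z P (\<lambda>J u. pval J (w @ a0 # u))))"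
proof -
  let ?t1 = "\<Sum>k = 1..length XE. fst (Es ! (k - 1)) * (\<Sum>a = r + 1..ps ! (2 * k - 2). fst (Fs ! (a - 1)))"
  let ?t2 = "\<Sum>p = 1..r. \<Sum>q = r + 1..length XF. fst (Fs ! (p - 1)) * fst (Fs ! (q - 1))"
  let ?F1 = "concat (map fst (take r XF))" and ?F2 = "concat (map fst (drop r XF))" and ?R = "zs @ toks xs"
  let ?NW = "concat (map (fst \<circ> fst) W)"
  have NF: "NF = ?F1 @ ?F2" by (metis append_take_drop_id concat_append map_append)
  have tk: "\<forall>X\<in>set (take r XF). tok d X" using tok_F by (auto dest: in_set_takeD)
  have mW: "mset ?NW = mset NE + mset ?F2" using mset_weaving[OF ps r] by (simp add: W_def)
  have mall: "mset (ND @ ?NW @ ?F1 @ ?R) = mset (ND @ NE @ NF @ ?R)"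
    unfolding NF by (simp add: mW ac_simps)
  have t2: "of_int ?t2 = bdeg d ?F1 * bdeg d ?F2"
  proof -
    have "of_int ?t2 = of_int (\<Sum>p = 1..r. fst (Fs ! (p - 1))) * (of_int (\<Sum>q = r + 1..length XF. fst (Fs ! (q - 1))) :: bit)"
      by (simp add: sum_product)
    moreover have "of_int (\<Sum>p = 1..r. fst (Fs ! (p - 1))) = bdeg d ?F1"
      using bdeg_slice[of XF d r 0] tok_F tok_bdeg r by (simp add: slice_def del: of_int_sum)
    moreover have "of_int (\<Sum>q = r + 1..length XF. fst (Fs ! (q - 1))) = bdeg d ?F2"
      using bdeg_slice[of XF d "length XF" r] tok_F tok_bdeg by (simp del: of_int_sum)
    ultimately show ?thesis by simp
  qed
  have dis: "set ?F1 \<inter> set ?F2 = {}" "distinct (ND @ NE @ ?F2)"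
    using dist unfolding NF by auto
  have "total = kos d (ND @ NE @ ?F2 @ ?F1 @ ?R) + of_int ?t2"
    using kos_swap[OF dis(1), of d "ND @ NE" ?R] by (simp only: total_def NF t2 append_assoc)
  also have "kos d (ND @ NE @ ?F2 @ ?F1 @ ?R) = kos d (ND @ ?NW @ ?F1 @ ?R) + of_int ?t1"
    using kos_weaving[OF ps r dis(2) tok_E tok_F, of v "?F1 @ ?R"] unfolding W_def by simp
  finally have sign: "total + of_int (?t1 + ?t2) = kos d (ND @ ?NW @ ?F1 @ ?R)"
    by (simp only: of_int_add ac_simps bit_double add_0_left add_0_right)
  have cochains: "map snd (map fst W) = G"
    using weaving_cochains[of v r ps XE XF] by (simp add: G_def W_def o_def)
  have len: "length W = length G" using cochains by (metis length_map)
  have sW: "\<forall>y\<in>set W. sound d v y" unfolding W_def by (rule sound_weaving[OF tok_E tok_F])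
  have toksW: "concat (map fst (map fst W @ take r XF)) = ?NW @ ?F1" by (simp add: o_def)
  have cW: "map snd (map fst W @ take r XF) = G @ take r Fs" using cochains by (simp add: take_map)
  have degs: "of_int (fst (snd X)) = bdeg d (fst X)" if X: "X \<in> set (map fst W @ take r XF)" for X
  proof -
    have "\<forall>y\<in>set (map fst W). tok d y" using sW by (simp add: sound_def)
    then have "tok d X" using X tk by auto
    then show ?thesis by (rule tok_bdeg)
  qed
  have "sg total (signed_by (?t1 + ?t2) (rotations (\<lambda>p. direct_part D (G @ take r Fs) (length G) p) hz (map (hitem d) xs) (hitem d a0))) =
     csum xs (\<lambda>P Q. sg (kos d (ND @ ?NW @ ?F1 @ ?R)) (signed_by (tdeg (map (hitem d) P) * (tdeg (map (hitem d) Q) + fst (hitem d a0)))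
       (pairing S (direct_part D (G @ take r Fs) (length G) (length Q) hz (map (hitem d) (Q @ a0 # P))) (marked_elt S))))"
    unfolding signed_by_eq_sg[of "?t1 + ?t2"] sg_sg sign by (simp add: rotations_csum csum_eq_sum sg_sum)
  also have "\<dots> = csum xs (\<lambda>P Q. wsum (map snd W) zs Q (\<lambda>z w. wsum (map (pop v) (take r XF)) z P (\<lambda>J u. pval J (w @ a0 # u))))"
  proof (rule csum_cong)
    fix P Q assume PQ: "xs = P @ Q"
    have mm: "mset ((ND @ ?NW @ ?F1 @ zs) @ toks P @ toks Q) = mset (ND @ NE @ NF @ zs @ toks xs)"
      using mall by (simp add: PQ)
    have "distinct ((ND @ ?NW @ ?F1 @ zs @ toks xs) @ [t0])"
      using distinct_snoc_mset[OF mall dist t0] by (simp only: append_assoc)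
    then have dist': "distinct (ND @ concat (map fst (map fst W @ take r XF)) @ zs @ toks (Q @ a0 # P))"
      unfolding toksW by (rule distinct_mset[rotated]) (simp add: PQ ac_simps)
    have "sg (kos d (ND @ ?NW @ ?F1 @ ?R)) (signed_by (tdeg (map (hitem d) P) * (tdeg (map (hitem d) Q) + fst (hitem d a0)))
       (pairing S (direct_part D (G @ take r Fs) (length G) (length Q) hz (map (hitem d) (Q @ a0 # P))) (marked_elt S))) =
      pairing S (sg (kos d (ND @ concat (map fst (map fst W @ take r XF)) @ zs @ toks (Q @ a0 # P)))
        (direct_part D (map snd (map fst W @ take r XF)) (length W) (length Q) hz (map (hitem d) (Q @ a0 # P)))) (marked_elt S)"
      using sg_rotate[OF mm] unfolding toksW cW len by (simp add: PQ pairing_sg)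
    also have "\<dots> = wsum (map (pop v) (map fst W)) zs Q (\<lambda>z w. wsum (map (pop v) (take r XF)) z P (\<lambda>J u. pval J (w @ a0 # u)))"
      by (subst kos_direct_part[OF dist' _ degs]) (simp_all add: pairing_wsum pairing_sg pval_def)
    also have "\<dots> = wsum (map snd W) zs Q (\<lambda>z w. wsum (map (pop v) (take r XF)) z P (\<lambda>J u. pval J (w @ a0 # u)))"
    proof (rule wsum_sound[OF sW _ zok])
      show "distinct (?NW @ zs @ toks Q)" using distinct_mset[OF mall dist] by (auto simp: PQ)
      show "aok d Q" using aok by (simp add: PQ)
      show "klin d (\<lambda>w. wsum (map (pop v) (take r XF)) J P (\<lambda>J u. pval J (w @ a0 # u)))" for J
        using klin_pval[of _ "[]"] by (intro klin_wsum) simp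
    qed
    finally show "sg (kos d (ND @ ?NW @ ?F1 @ ?R)) (signed_by (tdeg (map (hitem d) P) * (tdeg (map (hitem d) Q) + fst (hitem d a0)))
       (pairing S (direct_part D (G @ take r Fs) (length G) (length Q) hz (map (hitem d) (Q @ a0 # P))) (marked_elt S))) =
      wsum (map snd W) zs Q (\<lambda>z w. wsum (map (pop v) (take r XF)) z P (\<lambda>J u. pval J (w @ a0 # u)))" .
  qed
  finally show ?thesis .
qed

theorem pairing_brace_of_cyclic:
  assumes ne: "zs \<noteq> [] \<or> xs \<noteq> []" and xs: "\<forall>y\<in>set xs. fst y \<noteq> []"
  shows "pairing S (part (\<lambda>N. weak_chains 0 N (2 * length XF)) (cyclic_brace S D Es []) (\<lambda>_. Fs) (length XF) hz (map (hitem d) xs)) x =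
    (\<Sum>r = 0..length XF. \<Sum>ps\<in>weak_chains r (length XF) (2 * length XE). signed_by
      (rotation_exp Es Fs (length XE) (length XF) r ps)
      (rotations (\<lambda>p. rotated_summand D Es Fs r ps p)
         hz (map (hitem d) xs) (hitem d a0)))"
    (is "?L = (\<Sum>r = 0..length XF. ?A r)")
proof -
  let ?pE = "map (pop v) XE" and ?pF = "map (pop v) XF"
  let ?f = "\<lambda>A G. csum xs (\<lambda>P Q. wsum G zs Q (\<lambda>z w. wsum A z P (\<lambda>J u. pval J (w @ a0 # u))))"
  have A: "sg total (?A r) = dsum (map graft ?pE) (drop r ?pF) (?f (take r ?pF))" if r: "r \<in> {0..length XF}" for r
  proof -
    have "sg total (?A r) = (\<Sum>ps\<in>weak_chains r (length XF) (2 * length XE). ?f (take r ?pF) (map snd (weaving v r ps XE XF)))"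
      unfolding sg_sum using r by (intro sum.cong refl) (simp only: cyclic_words atLeastAtMost_iff take_map[where f = "pop v"])
    then show ?thesis
      using sum_weaving[of r XF "?f (take r ?pF)" v XE] r by (simp add: drop_map)
  qed
  have "sg total ?L = csum ?pF (\<lambda>A B. csum xs (\<lambda>P Q. dsum (map graft ?pE) B (\<lambda>G. wsum G zs Q (\<lambda>z w. wsum A z P (\<lambda>J u. pval J (w @ a0 # u))))))"
    unfolding brace_of_cyclic_words[OF ne xs] by (rule wsum_wsum_word_rotate[where f = "\<lambda>J r u. pval J (r @ a0 # u)"])
  also have "\<dots> = (\<Sum>r = 0..length XF. sg total (?A r))"
    by (simp only: csum_eq_sum[of ?pF] length_map flip: dsum_csum) (intro sum.cong refl, simp only: A)
  finally show ?thesis by (simp add: sg_eq_iff flip: sg_sum)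
qed

end

end

lemma signed_by_add: "signed_by n (x + y) = signed_by n x + signed_by n y"
  by (simp add: signed_by_def)

lemma signed_by_sum: "signed_by n (sum f I) = (\<Sum>i\<in>I. signed_by n (f i))"
  by (simp add: signed_by_def sum_negf)

lemma signed_by_commute: "signed_by n (signed_by m x) = signed_by m (signed_by n x)"
  by (simp add: signed_by_def)

section \<open>Arbitrary inputs\<close>

lemma sum_triple_swap:
  "(\<Sum>i\<in>I. \<Sum>x\<in>A. \<Sum>y\<in>B. \<Sum>z\<in>C. F i x y z) = (\<Sum>x\<in>A. \<Sum>y\<in>B. \<Sum>z\<in>C. \<Sum>i\<in>I. F i x y z)"
proof -
  have "(\<Sum>i\<in>I. \<Sum>x\<in>A. \<Sum>y\<in>B. \<Sum>z\<in>C. F i x y z) = (\<Sum>x\<in>A. \<Sum>i\<in>I. \<Sum>y\<in>B. \<Sum>z\<in>C. F i x y z)"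
    by (rule sum.swap)
  also have "\<dots> = (\<Sum>x\<in>A. \<Sum>y\<in>B. \<Sum>i\<in>I. \<Sum>z\<in>C. F i x y z)"
    by (intro sum.cong refl sum.swap)
  also have "\<dots> = (\<Sum>x\<in>A. \<Sum>y\<in>B. \<Sum>z\<in>C. \<Sum>i\<in>I. F i x y z)"
    by (intro sum.cong refl sum.swap)
  finally show ?thesis .
qed

lemma consecutive_tokens: "concat (map fst (map (\<lambda>i. ([k + i], f i)) [0..<n])) = [k..<k + n]"
  by (induction n) simp_all

lemma map_shift_upt: "map (\<lambda>i. k + i) [0..<n] = [k..<k + n]"
  by (induction n) simp_all

context symplectic_data
begin

definition component_sum ::
  "'z list \<Rightarrow> 'a list \<Rightarrow> 'a \<Rightarrow> ((int \<times> 'z) list \<Rightarrow> (int \<times> 'a) list \<Rightarrow> int \<times> 'a \<Rightarrow> 'k) \<Rightarrow> 'k" where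
  "component_sum zs as b f =
     (\<Sum>hz\<in>hlists (zgr S) zs. \<Sum>ha\<in>hlists (agr S) as. \<Sum>h0\<in>hcomps (agr S) b. f hz ha h0)"

lemma component_sum_sum: "component_sum zs as b (\<lambda>hz ha h0. \<Sum>i\<in>I. f i hz ha h0) = (\<Sum>i\<in>I. component_sum zs as b (f i))"
  unfolding component_sum_def by (rule sum_triple_swap[symmetric])

lemma component_sum_add:
  "component_sum zs as b (\<lambda>hz ha h0. f hz ha h0 + g hz ha h0) = component_sum zs as b f + component_sum zs as b g"
  by (simp add: component_sum_def sum.distrib)

lemma component_sum_signed:
  "component_sum zs as b (\<lambda>hz ha h0. signed_by n (f hz ha h0)) = signed_by n (component_sum zs as b f)"
  by (simp add: component_sum_def signed_by_sum)

lemma component_sum_cong: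
  "(\<And>hz ha h0. hz \<in> hlists (zgr S) zs \<Longrightarrow> ha \<in> hlists (agr S) as \<Longrightarrow> h0 \<in> hcomps (agr S) b \<Longrightarrow> f hz ha h0 = g hz ha h0) \<Longrightarrow>
   component_sum zs as b f = component_sum zs as b g"
  unfolding component_sum_def by (intro sum.cong refl)

lemma rotations_add:
  "rotations (\<lambda>p ys l. T p ys l + U p ys l) hz ha h0 = rotations T hz ha h0 + rotations U hz ha h0"
proof -
  interpret l: Vector_Spaces.linear "ascale S" "(*)" "\<lambda>a. pairing S a (marked_elt S)" by (rule linear_left)
  show ?thesis by (simp add: rotations_def l.add signed_by_add sum.distrib)
qed

lemma rotations_sum:
  "rotations (\<lambda>p ys l. \<Sum>i\<in>I. T i p ys l) hz ha h0 = (\<Sum>i\<in>I. rotations (T i) hz ha h0)"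
  unfolding rotations_def pairing_sum_left signed_by_sum by (rule sum.swap)

lemma rotations_signed:
  "rotations (\<lambda>p ys l. signed_by n (T p ys l)) hz ha h0 = signed_by n (rotations T hz ha h0)"
  unfolding rotations_def pairing_signed signed_by_sum by (intro sum.cong refl signed_by_commute)

text \<open>Tokens are handed out consecutively: to \<open>D\<close>, the \<open>E\<close>'s, the \<open>F\<close>'s, the \<open>Z\<close>-inputs, the
  \<open>A\<close>-inputs, and last to \<open>a\<^sub>0\<close>.\<close>

lemma exists_tokens:
  assumes D: "good D" and Es: "\<forall>E\<in>set Es. good E" and Fs: "\<forall>F\<in>set Fs. good F"
    and hz: "Z.homs hz" "\<forall>h\<in>set hz. snd h \<noteq> 0" and ha: "A.homs ha"
  obtains d v XE XF zs xs t0 where "koszul_setup S d v [0] D XE XF zs xs" "map snd XE = Es" "map snd XF = Fs"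
    "map (zitem d v) zs = hz" "map (hitem d) xs = ha" "d t0 = d0"
    "\<forall>t\<in>set ([0] @ concat (map fst XE) @ concat (map fst XF) @ zs @ toks xs). t < t0" "\<forall>y\<in>set xs. fst y \<noteq> []"
proof -
  let ?oF = "1 + length Es"
  let ?oz = "?oF + length Fs"
  let ?oa = "?oz + length hz"
  let ?t0 = "?oa + length ha"
  define ds where "ds = fst D # map fst Es @ map fst Fs @ map fst hz @ map fst ha @ [d0]"
  define d where "d i = ds ! i" for i
  define v where "v i = snd (hz ! (i - ?oz))" for i
  define XE where "XE = map (\<lambda>i. ([1 + i], Es ! i)) [0..<length Es]"
  define XF where "XF = map (\<lambda>i. ([?oF + i], Fs ! i)) [0..<length Fs]"
  define zs where "zs = map (\<lambda>i. ?oz + i) [0..<length hz]"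
  define xs where "xs = map (\<lambda>i. ([?oa + i], snd (ha ! i))) [0..<length ha]"
  have dE: "d (1 + i) = fst (Es ! i)" if "i < length Es" for i
    using that by (simp add: d_def ds_def nth_append)
  have dF: "d (?oF + i) = fst (Fs ! i)" if "i < length Fs" for i
    using that by (simp add: d_def ds_def nth_append)
  have dz: "d (?oz + i) = fst (hz ! i)" if "i < length hz" for i
    using that by (simp add: d_def ds_def nth_append)
  have da: "d (?oa + i) = fst (ha ! i)" if "i < length ha" for i
    using that by (simp add: d_def ds_def nth_append)
  have dt: "d ?t0 = d0" by (simp add: d_def ds_def nth_append)
  have tE: "concat (map fst XE) = [1..<?oF]" and tF: "concat (map fst XF) = [?oF..<?oz]" and tx: "toks xs = [?oa..<?t0]"
    and tz: "zs = [?oz..<?oz + length hz]"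
    unfolding XE_def XF_def xs_def zs_def consecutive_tokens map_shift_upt by simp_all
  have sE: "map snd XE = Es" and sF: "map snd XF = Fs"
    by (simp_all add: XE_def XF_def o_def map_nth)
  have szs: "map (zitem d v) zs = hz"
    by (rule nth_equalityI) (simp_all add: zs_def zitem_def v_def dz[simplified])
  have sxs: "map (hitem d) xs = ha"
    by (rule nth_equalityI) (simp_all add: xs_def hitem_def da[simplified])
  have "koszul_setup S d v [0] D XE XF zs xs"
  proof (intro koszul_setup.intro koszul_setup_axioms.intro)
    show "symplectic_data S" by (rule symplectic_data_axioms)
    show "distinct ([0] @ concat (map fst XE) @ concat (map fst XF) @ zs @ toks xs)"
      unfolding tE tF tx tz by auto
    show "\<forall>X\<in>set XE. tok d X" using Es dE[simplified] by (auto simp: tok_def XE_def)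
    show "\<forall>X\<in>set XF. tok d X" using Fs dF[simplified] by (auto simp: tok_def XF_def)
    show "zok d v zs"
      unfolding zok_def
    proof
      fix t assume "t \<in> set zs"
      then have "zitem d v t \<in> set hz" by (simp flip: szs)
      then show "v t \<in> zgr S (d t) \<and> v t \<noteq> 0" using hz by (auto simp: Z.homs_def zitem_def)
    qed
    show "aok d xs" using ha by (simp add: sxs flip: aok_homs)
  qed (rule D)
  moreover have "\<forall>t\<in>set ([0] @ concat (map fst XE) @ concat (map fst XF) @ zs @ toks xs). t < ?t0"
    unfolding tE tF tx tz by auto
  moreover have "\<forall>y\<in>set xs. fst y \<noteq> []" by (auto simp: xs_def)
  ultimately show ?thesis using that sE sF szs sxs dt by blast
qed

lemma pairing_hcomps: "pairing S y b = (\<Sum>h\<in>hcomps (agr S) b. pairing S y (snd h))"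
proof -
  interpret l: Vector_Spaces.linear "ascale S" "(*)" "pairing S y" by (rule linear_right)
  let ?F = "{d. component (agr S) b d \<noteq> 0}"
  have "pairing S y b = pairing S y (\<Sum>d\<in>?F. component (agr S) b d)"
    using A.sum_component[of ?F b] A.finite_component by simp
  also have "\<dots> = (\<Sum>h\<in>hcomps (agr S) b. pairing S y (snd h))"
    using A.sum_hcomps[of ?F b "\<lambda>h. pairing S y (snd h)"] A.finite_component by (simp add: l.sum l.zero)
  finally show ?thesis .
qed

lemma good_weave:
  assumes "\<forall>E\<in>set Es. good E" "\<forall>F\<in>set Fs. good F"
  shows "\<forall>X\<in>set (weave lo ps (map (brace S) Es) Fs). good X"
proof (rule weave_all[OF assms(2)], intro ballI allI)
  fix g i j assume "g \<in> set (map (brace S) Es)"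
  moreover have "\<forall>F\<in>set (slice Fs i j). good F"
    using assms(2) by (auto simp: slice_def dest: in_set_takeD in_set_dropD)
  ultimately show "good (g (slice Fs i j))" using assms(1) good_brace by auto
qed

lemma pairing_cyclic_brace1:
  assumes "good D" "\<forall>E\<in>set As. good E" "\<forall>E\<in>set Bs. good E" "zs \<noteq> [] \<or> as \<noteq> []"
  shows "pairing S (snd (cyclic_brace S D As Bs) zs as) b =
    component_sum zs as b (rotations (\<lambda>p. direct_part D (As @ Bs) (length As) p))"
proof -
  have pd: "part_data (gap_chains (length (As @ Bs)) (length As) p) D (\<lambda>_. As @ Bs) (length (As @ Bs)) (tdeg (As @ Bs))" for p
    using assms(1-3) by (intro part_data_direct) auto
  have T: "(\<lambda>p. direct_part D (As @ Bs) (length As) p) =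
      (\<lambda>p. part (gap_chains (length (As @ Bs)) (length As) p) D (\<lambda>_. As @ Bs) (length (As @ Bs)))"
    by (simp add: direct_part_eq_part)
  show ?thesis
    unfolding cyclic_brace_def snd_conv T component_sum_def by (rule pairing_cyclic_dual[OF pd assms(4)])
qed

lemma pairing_cyclic_brace2:
  assumes "good D" "\<forall>E\<in>set As. good E" "good E" "\<forall>E\<in>set Bs. good E" "\<forall>F\<in>set (Cs @ Cs'). good F" "zs \<noteq> [] \<or> as \<noteq> []"
  shows "pairing S (snd (cyclic_brace2 S D As E Cs Cs' Bs) zs as) b =
    component_sum zs as b (rotations (\<lambda>p. nested_part S D (As @ E # Bs) (Suc (length As)) (Cs @ Cs') (length Cs) p))"
proof -
  have g: "\<forall>X\<in>set (As @ E # Bs). good X" using assms(2-4) by auto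
  have T: "(\<lambda>p. nested_part S D (As @ E # Bs) (Suc (length As)) (Cs @ Cs') (length Cs) p) =
     (\<lambda>p. part (block_chains (length (As @ E # Bs)) (Suc (length As)) p) D
        (\<lambda>ps. (As @ E # Bs)[length As := direct_brace S E (Cs @ Cs') (length Cs) (p - K_lo ps (Suc (length As)))])
        (length (As @ E # Bs)))"
    by (simp add: nested_part_eq_part)
  show ?thesis
    unfolding cyclic_brace2_def snd_conv T component_sum_def
    by (rule pairing_cyclic_dual[OF part_data_nested[OF assms(1) g assms(5)] assms(6)])
qed

lemma direct_part_of_brace_expansion:
  assumes "good D" "\<forall>E\<in>set Es. good E" "\<forall>F\<in>set Fs. good F" "Z.homs hz" "\<forall>h\<in>set hz. snd h \<noteq> 0" "A.homs l" "p < length l"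
  shows "direct_part (brace S D Es) Fs (length Fs) p hz l =
    (\<Sum>s = 0..length Es. \<Sum>ps\<in>weak_chains 0 (length Fs) (2 * s). signed_by
        (weave_exp Es Fs (length Es) (length Fs) s ps)
        (direct_summand D Es Fs s ps p hz l))
  + (\<Sum>s = 1..length Es. \<Sum>ps\<in>weak_chains 0 (length Fs) (2 * s - 1). signed_by
        (weave_exp Es Fs (length Es) (length Fs) s ps)
        (nested_summand D Es Fs s ps p hz l))"
proof -
  obtain d v XE XF zs xs t0 where K: "koszul_setup S d v [0] D XE XF zs xs"
    and E: "map snd XE = Es" and F: "map snd XF = Fs" and z: "map (zitem d v) zs = hz" and x: "map (hitem d) xs = l"
    by (rule exists_tokens[OF assms(1-6)])
  have lE: "length XE = length Es" and lF: "length XF = length Fs" using E F by (metis length_map)+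
  have lx: "p < length xs" using x assms(7) by (metis length_map)
  have P: "length (take p xs) = p" using lx by simp
  show ?thesis
    using koszul_setup.direct_part_of_brace[OF K id_take_nth_drop[OF lx]] unfolding E F z x lE lF P .
qed

text \<open>Cochains have no component in arity \<open>(0, 0)\<close>, so that without inputs every \<open>F\<close> contributes a
  zero.\<close>

lemma brace_of_cyclic_empty:
  assumes "good D" "\<forall>E\<in>set Es. good E" "\<forall>F\<in>set Fs. snd F [] [] = 0"
  shows "snd (brace S (cyclic_brace S D Es []) Fs) [] [] = 0"
proof -
  let ?X = "cyclic_brace S D Es []"
  have X: "snd ?X [] w = 0" if w: "\<forall>y\<in>set w. y = 0" for w
  proof (cases w)
    case Nil
    then show ?thesis by (simp add: cyclic_brace_def cyclic_dual_def)
  next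
    case (Cons y w')
    then have "hlists (agr S) w = {}" using w by (simp add: A.hlists_Cons)
    then show ?thesis
      using pairing_cyclic_brace1[OF assms(1,2), of "[]" "[]" w] Cons
      by (intro pairing_eqI) (simp add: pairing_zero component_sum_def)
  qed
  have "brace_term ?X Fs [] [] c ps = 0" for c ps
  proof -
    have "\<forall>y\<in>set (weave 0 ps (map (\<lambda>j. snd (Fs ! (j - 1)) (map snd (zblock [] c j))) [1..<Suc (length Fs)]) (map snd [])). y = 0"
      by (rule weave_all) (use assms(3) in \<open>auto simp: zblock_def slice_def simp del: upt_Suc\<close>)
    from X[OF this] show ?thesis by (simp add: brace_term_def zblock_def signed_by_0 del: upt_Suc)
  qed
  then show ?thesis by (simp add: brace_def)
qed

theorem brace_then_cyclic:
  assumes "good D" "\<forall>E\<in>set Es. good E" "\<forall>F\<in>set Fs. good F"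
  shows "snd (cyclic_brace S (brace S D Es) Fs []) zs as =
    (\<Sum>s = 0..length Es. \<Sum>ps\<in>weak_chains 0 (length Fs) (2 * s). signed_by
        (weave_exp Es Fs (length Es) (length Fs) s ps)
        (snd (cyclic_brace S D (weave 0 ps (map (brace S) (take s Es)) Fs) (drop s Es)) zs as))
  + (\<Sum>s = 1..length Es. \<Sum>ps\<in>weak_chains 0 (length Fs) (2 * s - 1). signed_by
        (weave_exp Es Fs (length Es) (length Fs) s ps)
        (snd (cyclic_brace2 S D (weave 0 (butlast ps) (map (brace S) (take (s - 1) Es)) (take (last ps) Fs))
           (Es ! (s - 1)) (drop (last ps) Fs) [] (drop s Es)) zs as))"
    (is "?L = (\<Sum>s = 0..length Es. \<Sum>ps\<in>?C1 s. signed_by (?t s ps) (?A s ps)) +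
       (\<Sum>s = 1..length Es. \<Sum>ps\<in>?C2 s. signed_by (?t s ps) (?B s ps))")
proof (cases "zs = [] \<and> as = []")
  case True
  then show ?thesis by (simp add: cyclic_brace_def cyclic_brace2_def cyclic_dual_def signed_by_0)
next
  case False
  then have ne: "zs \<noteq> [] \<or> as \<noteq> []" by simp
  have sub: "\<forall>E\<in>set (take k Es). good E" "\<forall>E\<in>set (drop k Es). good E"
    "\<forall>F\<in>set (take k Fs). good F" "\<forall>F\<in>set (drop k Fs @ []). good F" for k
    using assms by (auto dest: in_set_takeD in_set_dropD)
  define TA where "TA s ps = (\<lambda>p. direct_summand D Es Fs s ps p)" for s ps
  define TB where "TB s ps = (\<lambda>p. nested_summand D Es Fs s ps p)" for s ps
  have A: "pairing S (?A s ps) b = component_sum zs as b (rotations (TA s ps))" for s ps b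
    unfolding TA_def by (rule pairing_cyclic_brace1[OF assms(1) good_weave[OF sub(1) assms(3)] sub(2) ne])
  have B: "pairing S (?B s ps) b = component_sum zs as b (rotations (TB s ps))" if "s \<in> {1..length Es}" for s ps b
  proof -
    have "good (Es ! (s - 1))" using assms(2) that by auto
    then show ?thesis
      unfolding TB_def by (rule pairing_cyclic_brace2[OF assms(1) good_weave[OF sub(1) sub(3)] _ sub(2) sub(4) ne])
  qed
  have rot: "rotations (\<lambda>p. direct_part (brace S D Es) (Fs @ []) (length Fs) p) hz ha h0 =
     (\<Sum>s = 0..length Es. \<Sum>ps\<in>?C1 s. signed_by (?t s ps) (rotations (TA s ps) hz ha h0)) +
     (\<Sum>s = 1..length Es. \<Sum>ps\<in>?C2 s. signed_by (?t s ps) (rotations (TB s ps) hz ha h0))"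
    if "hz \<in> hlists (zgr S) zs" "ha \<in> hlists (agr S) as" "h0 \<in> hcomps (agr S) b" for hz ha h0 b
  proof -
    have "direct_part (brace S D Es) (Fs @ []) (length Fs) (length ha - r) hz (drop r ha @ h0 # take r ha) =
      (\<Sum>s = 0..length Es. \<Sum>ps\<in>?C1 s. signed_by (?t s ps) (TA s ps (length ha - r) hz (drop r ha @ h0 # take r ha))) +
      (\<Sum>s = 1..length Es. \<Sum>ps\<in>?C2 s. signed_by (?t s ps) (TB s ps (length ha - r) hz (drop r ha @ h0 # take r ha)))" for r
    proof -
      have "A.homs (drop r ha @ h0 # take r ha)"
        using A.in_hlists[OF that(2)] A.in_hcomps[OF that(3)] by (auto simp: A.homs_def dest: in_set_takeD in_set_dropD)
      then show ?thesis
        unfolding TA_def TB_def append_Nil2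
        using direct_part_of_brace_expansion[OF assms _ _ _, of hz "drop r ha @ h0 # take r ha" "length ha - r"] Z.in_hlists[OF that(1)]
        by simp
    qed
    then have "rotations (\<lambda>p. direct_part (brace S D Es) (Fs @ []) (length Fs) p) hz ha h0 =
      rotations (\<lambda>p ys l. (\<Sum>s = 0..length Es. \<Sum>ps\<in>?C1 s. signed_by (?t s ps) (TA s ps p ys l)) +
      (\<Sum>s = 1..length Es. \<Sum>ps\<in>?C2 s. signed_by (?t s ps) (TB s ps p ys l))) hz ha h0"
      unfolding rotations_def by (simp only:)
    then show ?thesis
      by (simp only: rotations_add rotations_sum rotations_signed)
  qed
  show ?thesis
  proof (rule pairing_eqI)
    fix b
    have "pairing S ?L b = component_sum zs as b (rotations (\<lambda>p. direct_part (brace S D Es) (Fs @ []) (length Fs) p))"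
      by (rule pairing_cyclic_brace1[OF good_brace[OF assms(1,2)] assms(3) _ ne]) simp
    also have "\<dots> = component_sum zs as b (\<lambda>hz ha h0.
       (\<Sum>s = 0..length Es. \<Sum>ps\<in>?C1 s. signed_by (?t s ps) (rotations (TA s ps) hz ha h0)) +
       (\<Sum>s = 1..length Es. \<Sum>ps\<in>?C2 s. signed_by (?t s ps) (rotations (TB s ps) hz ha h0)))"
      by (rule component_sum_cong) (rule rot)
    also have "\<dots> = (\<Sum>s = 0..length Es. \<Sum>ps\<in>?C1 s. signed_by (?t s ps) (pairing S (?A s ps) b)) +
       (\<Sum>s = 1..length Es. \<Sum>ps\<in>?C2 s. signed_by (?t s ps) (pairing S (?B s ps) b))"
      unfolding component_sum_add component_sum_sum component_sum_signed
      by (intro arg_cong2[where f = "(+)"] sum.cong refl) (simp_all only: A B)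
    finally show "pairing S ?L b = pairing S ((\<Sum>s = 0..length Es. \<Sum>ps\<in>?C1 s. signed_by (?t s ps) (?A s ps)) +
       (\<Sum>s = 1..length Es. \<Sum>ps\<in>?C2 s. signed_by (?t s ps) (?B s ps))) b"
      using linear_left[of b] by (simp only: pairing_sum_left pairing_signed Vector_Spaces.linear_iff)
  qed
qed

theorem cyclic_then_brace:
  assumes "good D" "\<forall>E\<in>set Es. good E" "\<forall>F\<in>set Fs. good F" "\<forall>F\<in>set Fs. snd F [] [] = 0"
  shows "snd (brace S (cyclic_brace S D Es []) Fs) zs as =
    (\<Sum>r = 0..length Fs. \<Sum>ps\<in>weak_chains r (length Fs) (2 * length Es). signed_by
      (rotation_exp Es Fs (length Es) (length Fs) r ps)
      (snd (cyclic_brace S D (weave r ps (map (brace S) Es) Fs) (take r Fs)) zs as))"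
    (is "?L = (\<Sum>r = 0..length Fs. \<Sum>ps\<in>?C r. signed_by (?t r ps) (?A r ps))")
proof (cases "zs = [] \<and> as = []")
  case True
  then show ?thesis
    using brace_of_cyclic_empty[OF assms(1,2,4)] by (simp add: cyclic_brace_def[of _ _ "weave _ _ _ _"] cyclic_dual_def signed_by_0)
next
  case False
  then have ne: "zs \<noteq> [] \<or> as \<noteq> []" by simp
  let ?X = "cyclic_brace S D Es []"
  let ?P = "part (\<lambda>N. weak_chains 0 N (2 * length Fs)) ?X (\<lambda>_. Fs) (length Fs)"
  define TA where "TA r ps = (\<lambda>p. rotated_summand D Es Fs r ps p)" for r ps
  have sub: "\<forall>F\<in>set (take k Fs). good F" for k
    using assms(3) by (auto dest: in_set_takeD)
  have A: "pairing S (?A r ps) b = component_sum zs as b (rotations (TA r ps))" for r ps b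
    unfolding TA_def by (rule pairing_cyclic_brace1[OF assms(1) good_weave[OF assms(2,3)] sub ne])
  have P: "pairing S (?P hz ha) (snd h0) = (\<Sum>r = 0..length Fs. \<Sum>ps\<in>?C r. signed_by (?t r ps) (rotations (TA r ps) hz ha h0))"
    if "hz \<in> hlists (zgr S) zs" "ha \<in> hlists (agr S) as" "h0 \<in> hcomps (agr S) b" for hz ha h0 b
  proof -
    have h: "Z.homs hz" "\<forall>h\<in>set hz. snd h \<noteq> 0" "A.homs ha" "hz \<noteq> [] \<or> ha \<noteq> []"
      using Z.in_hlists[OF that(1)] A.in_hlists[OF that(2)] ne by auto
    obtain d v XE XF ts xs t0 where K: "koszul_setup S d v [0] D XE XF ts xs"
      and E: "map snd XE = Es" and F: "map snd XF = Fs" and z: "map (zitem d v) ts = hz" and x: "map (hitem d) xs = ha"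
      and t0: "d t0 = fst h0" "\<forall>t\<in>set ([0] @ concat (map fst XE) @ concat (map fst XF) @ ts @ toks xs). t < t0"
      and xs: "\<forall>y\<in>set xs. fst y \<noteq> []"
      by (rule exists_tokens[OF assms(1-3) h(1-3)])
    have lE: "length XE = length Es" and lF: "length XF = length Fs" using E F by (metis length_map)+
    have h0: "snd h0 \<in> agr S (d t0)" using A.in_hcomps[OF that(3)] by (simp add: t0)
    have it: "hitem d ([t0], snd h0) = h0" by (simp add: hitem_def t0)
    have "ts \<noteq> [] \<or> xs \<noteq> []" using h(4) z x by auto
    from koszul_setup.pairing_brace_of_cyclic[OF K t0(2) h0 this xs]
    show ?thesis unfolding E F z x lE lF it TA_def .
  qed
  show ?thesis
  proof (rule pairing_eqI)
    fix b
    have "pairing S ?L b = (\<Sum>hz\<in>hlists (zgr S) zs. \<Sum>ha\<in>hlists (agr S) as. pairing S (?P hz ha) b)"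
      unfolding brace_eq_part_op part_op_def snd_conv pairing_sum_left by (rule refl)
    also have "\<dots> = component_sum zs as b (\<lambda>hz ha h0. pairing S (?P hz ha) (snd h0))"
      unfolding component_sum_def by (intro sum.cong refl pairing_hcomps)
    also have "\<dots> = component_sum zs as b (\<lambda>hz ha h0.
       \<Sum>r = 0..length Fs. \<Sum>ps\<in>?C r. signed_by (?t r ps) (rotations (TA r ps) hz ha h0))"
      by (rule component_sum_cong) (rule P)
    also have "\<dots> = (\<Sum>r = 0..length Fs. \<Sum>ps\<in>?C r. signed_by (?t r ps) (pairing S (?A r ps) b))"
      unfolding component_sum_sum component_sum_signed by (simp only: A)
    finally show "pairing S ?L b = pairing S (\<Sum>r = 0..length Fs. \<Sum>ps\<in>?C r. signed_by (?t r ps) (?A r ps)) b"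
      by (simp only: pairing_sum_left pairing_signed)
  qed
qed

end

theorem theorem1p6:
  fixes S :: "('k::field, 'z::ab_group_add, 'a::ab_group_add) cyclic_data"
    and D :: "('z, 'a) hcochain"
    and Es Fs :: "('z, 'a) hcochain list"
  assumes "symplectic_data S"
    and "homogeneous_cochain S D"
    and "\<forall>E \<in> set Es. homogeneous_cochain S E"
    and "\<forall>F \<in> set Fs. homogeneous_cochain S F"
    and "m = length Es" and "n = length Fs"
  shows "(\<forall>zs as. snd (cyclic_brace S (brace S D Es) Fs []) zs as =
      (\<Sum>s = 0..m. \<Sum>ps \<in> weak_chains 0 n (2 * s).
         signed_by ((\<Sum>k = 1..s. fst (Es ! (k - 1)) * (\<Sum>a = 1..ps ! (2 * k - 2). fst (Fs ! (a - 1))))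
                    + (\<Sum>k = s + 1..m. fst (Es ! (k - 1)) * (\<Sum>a = 1..n. fst (Fs ! (a - 1)))))
           (snd (cyclic_brace S D
                   (weave 0 ps (map (brace S) (take s Es)) Fs)
                   (drop s Es)) zs as))
    + (\<Sum>s = 1..m. \<Sum>ps \<in> weak_chains 0 n (2 * s - 1).
         signed_by ((\<Sum>k = 1..s. fst (Es ! (k - 1)) * (\<Sum>a = 1..ps ! (2 * k - 2). fst (Fs ! (a - 1))))
                    + (\<Sum>k = s + 1..m. fst (Es ! (k - 1)) * (\<Sum>a = 1..n. fst (Fs ! (a - 1)))))
           (snd (cyclic_brace2 S D
                   (weave 0 (butlast ps) (map (brace S) (take (s - 1) Es)) (take (last ps) Fs))
                   (Es ! (s - 1)) (drop (last ps) Fs) []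
                   (drop s Es)) zs as)))
    \<and> (\<forall>zs as. snd (brace S (cyclic_brace S D Es []) Fs) zs as =
      (\<Sum>r = 0..n. \<Sum>ps \<in> weak_chains r n (2 * m).
         signed_by ((\<Sum>k = 1..m. fst (Es ! (k - 1)) * (\<Sum>a = r + 1..ps ! (2 * k - 2). fst (Fs ! (a - 1))))
                    + (\<Sum>p = 1..r. \<Sum>q = r + 1..n. fst (Fs ! (p - 1)) * fst (Fs ! (q - 1))))
           (snd (cyclic_brace S D
                   (weave r ps (map (brace S) Es) Fs)
                   (take r Fs)) zs as)))"
proof -
  interpret symplectic_data S by (rule assms(1))
  have g: "good D" "\<forall>E\<in>set Es. good E" "\<forall>F\<in>set Fs. good F" "\<forall>F\<in>set Fs. snd F [] [] = 0"
    using assms(2-4) good_homogeneous_cochain by (auto simp: homogeneous_cochain_def cochain_def)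
  show ?thesis
    unfolding assms(5,6) by (intro conjI allI brace_then_cyclic[OF g(1-3)] cyclic_then_brace[OF g])
qed

end
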